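(* If $G$ is a finite non-abelian group with $\mathrm{tp}(G) > 4/81$, then $G$ is soluble of derived length exactly $2$. Furthermore, the bound is sharp: for no real number $c<4/81$ is it true that every finite non-abelian group $G$ with $\mathrm{tp}(G)>c$ has derived length $2$.
   Context: For a subgroup $H$ of index $n$ in a finite group $G$, $P_G(H) := |\mathrm{DT}_G(H)|/|H|^n$, where $\mathrm{DT}_G(H)$ is the set of all subsets of $G$ that are simultaneously a left transversal (exactly one element of each left coset $gH$) and a right transversal (exactly one element of each right coset $Hg$) of $H$ in $G$. The common transversal probability of $G$ is $\mathrm{tp}(G) := \min_{H\leq G} P_G(H)$, the minimum over all subgroups $H$ of $G$. Derived length $2$ means $G'\neq 1$ and $G''=1$. *)

theory Defs
  imports Complex_Main "HOL-Algebra.Left_Coset" "HOL-Algebra.Solvable_Groups"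
begin

definition left_transversal :: "('a, 'b) monoid_scheme \<Rightarrow> 'a set \<Rightarrow> 'a set \<Rightarrow> bool" where
  "left_transversal G H T \<longleftrightarrow>
     T \<subseteq> carrier G \<and> (\<forall>C \<in> lcosets\<^bsub>G\<^esub> H. \<exists>!x. x \<in> T \<and> x \<in> C)"

definition right_transversal :: "('a, 'b) monoid_scheme \<Rightarrow> 'a set \<Rightarrow> 'a set \<Rightarrow> bool" where
  "right_transversal G H T \<longleftrightarrow>
     T \<subseteq> carrier G \<and> (\<forall>C \<in> rcosets\<^bsub>G\<^esub> H. \<exists>!x. x \<in> T \<and> x \<in> C)"

definition DT :: "('a, 'b) monoid_scheme \<Rightarrow> 'a set \<Rightarrow> 'a set set" where
  "DT G H = {T. left_transversal G H T \<and> right_transversal G H T}"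

definition transversal_prob :: "('a, 'b) monoid_scheme \<Rightarrow> 'a set \<Rightarrow> real" where
  "transversal_prob G H = real (card (DT G H)) / real (card H) ^ card (rcosets\<^bsub>G\<^esub> H)"

text \<open>Only meaningful for finite groups, where the minimum is over a finite nonempty set.\<close>

definition tp :: "('a, 'b) monoid_scheme \<Rightarrow> real" where
  "tp G = Min (transversal_prob G ` {H. subgroup H G})"

definition derived_length_two :: "('a, 'b) monoid_scheme \<Rightarrow> bool" where
  "derived_length_two G \<longleftrightarrow>
     derived G (carrier G) \<noteq> {\<one>\<^bsub>G\<^esub>} \<and> derived G (derived G (carrier G)) = {\<one>\<^bsub>G\<^esub>}"

end

theory Submission
  imports Defs "HOL-Library.FuncSet" "HOL-Library.Countable"
    "HOL-Computational_Algebra.Primes" "HOL-Combinatorics.Permutations"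
    "HOL-Algebra.Multiplicative_Group" "HOL-Algebra.Sylow" "HOL-Algebra.Weak_Morphisms"
begin

text \<open>A double coset \<open>D\<close> of \<open>H\<close> that consists of \<open>k\<close> left cosets also consists of \<open>k\<close> right cosets, and
  any two of them meet in the same number of elements; counting gives
  \<open>P\<^sub>G(H) = \<Prod>\<^sub>D k\<^sub>D!/k\<^sub>D\<^sup>k\<close>. If this exceeds \<open>4/81\<close> and \<open>H\<close> is a cyclic \<open>p\<close>-group that is not normal, then
  \<open>p \<le> 3\<close> and only very few double cosets lie outside the normaliser \<open>N\<close> of \<open>H\<close>: one with \<open>k = 3\<close> if
  \<open>p = 3\<close>; one with \<open>k = 4\<close>, or at most four with \<open>k = 2\<close>, if \<open>p = 2\<close>.

  Suppose that \<open>G'\<close> is not abelian. It contains an element \<open>x\<close> of prime power order that is not central in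
  \<open>G'\<close>, so \<open>H = \<langle>x\<rangle>\<close> is not normal in \<open>G\<close>. A non-normal cyclic 3-subgroup forces \<open>G'\<close> to be
  abelian, so all elements of odd prime power order generate normal subgroups and commute with \<open>x\<close>.
  Hence \<open>x\<close> is a 2-element and \<open>|G : N|\<close> is a power of 2, namely 2 or 4, and both are excluded.

  The bound is attained by the group \<open>SL(2, 3)\<close>, whose derived subgroup is the quaternion group.\<close>

section \<open>Counting common transversals\<close>

text \<open>The threshold is \<open>(2/9)^2\<close>, the value of P for two double cosets with k = 3
  and all others with k = 1. The strict inequality forbids this pattern, which the subgroups of
  order 3 in SL(2,3) show. The obstacle is that a large P does not make cyclic subgroups normal: S_3
  and A_4 have non-normal ones of order 2 and 3. So each exceptional pattern must itself be shown to
  make G' abelian. The link is a count. With r = |G : N| and m = |N : H|, there are (r - 1)m left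
  cosets of H outside N, and this is the sum of k over the nontrivial double cosets: at most 8 for
  2-groups, and 3 for non-normal 3-groups. The index r is restricted further because N contains a
  Sylow q-subgroup for every odd q, as x in G' commutes with its elements. The hardest case is r = 2
  with all nontrivial k equal to 2. There m may be as large as 8, and small m and large m need
  different arguments.\<close>

definition bitransversals :: "'a set \<Rightarrow> ('a \<Rightarrow> 'l) \<Rightarrow> ('a \<Rightarrow> 'r) \<Rightarrow> 'l set \<Rightarrow> 'r set \<Rightarrow> 'a set set" where
  "bitransversals D l r L R = {T. T \<subseteq> D \<and> bij_betw l T L \<and> bij_betw r T R}"

text \<open>\<open>D\<close> is a k by k grid with \<open>s\<close> elements in each cell, and T
  takes one cell from every row and every column. The induction removes a row \<open>i\<close>: its
  element \<open>x\<close> can be chosen in \<open>Suc k * s\<close> ways and takes the column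
  \<open>r x\<close> with it. No other element of T has label \<open>i\<close>, so T determines
  \<open>x\<close> and nothing is counted twice.\<close>

lemma card_bitransversals:
  assumes "finite D" "finite L" "finite R" "card L = k" "card R = k"
    and "\<And>i j. i \<in> L \<Longrightarrow> j \<in> R \<Longrightarrow> card {x\<in>D. l x = i \<and> r x = j} = s"
  shows "card (bitransversals D l r L R) = fact k * s ^ k"
  using assms
proof (induction k arbitrary: L R)
  case 0
  then have "L = {}" "R = {}" by auto
  then have "bitransversals D l r L R = {{}}"
    by (auto simp: bitransversals_def bij_betw_def)
  then show ?case by simp
next
  case (Suc k)
  then obtain i where i: "i \<in> L" by (metis card.empty ex_in_conv nat.distinct(1))
  define F where "F = {x\<in>D. l x = i \<and> r x \<in> R}"
  let ?B = "\<lambda>x. bitransversals D l r (L - {i}) (R - {r x})"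
  have finF: "finite F" using Suc.prems by (auto simp: F_def)
  have eq: "bitransversals D l r L R = (\<Union>x\<in>F. insert x ` ?B x)"
  proof (intro equalityI subsetI)
    fix T assume "T \<in> bitransversals D l r L R"
    then have T: "T \<subseteq> D" "bij_betw l T L" "bij_betw r T R" by (auto simp: bitransversals_def)
    obtain x where x: "x \<in> T" "l x = i" using T(2) i by (auto simp: bij_betw_def)
    have "x \<in> F" using x T by (auto simp: F_def bij_betw_def)
    moreover have "T - {x} \<in> ?B x"
      using bij_betw_DiffI[OF T(2), of "{x}" "{i}"] bij_betw_DiffI[OF T(3), of "{x}" "{r x}"] T x
      by (auto simp: bitransversals_def bij_betw_def)
    moreover have "T = insert x (T - {x})" using x by auto
    ultimately show "T \<in> (\<Union>x\<in>F. insert x ` ?B x)" by blast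
  next
    fix T assume "T \<in> (\<Union>x\<in>F. insert x ` ?B x)"
    then obtain x S where x: "x \<in> F" and S: "S \<in> ?B x" and T: "T = insert x S" by auto
    have "bij_betw l (S \<union> {x}) (L - {i} \<union> {i})" "bij_betw r (S \<union> {x}) (R - {r x} \<union> {r x})"
      using x S by (intro bij_betw_combine; auto simp: bitransversals_def F_def bij_betw_def)+
    moreover have "L - {i} \<union> {i} = L" "R - {r x} \<union> {r x} = R" using i x by (auto simp: F_def)
    ultimately show "T \<in> bitransversals D l r L R"
      using x S T by (simp add: bitransversals_def F_def)
  qed
  have fin: "finite (?B x)" for x
    using Suc.prems(1) by (auto simp: bitransversals_def intro: finite_subset[of _ "Pow D"])
  have notin: "x \<notin> S" if "x \<in> F" "S \<in> ?B y" for x y S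
    using that by (auto simp: F_def bitransversals_def bij_betw_def)
  have disj: "insert x ` ?B x \<inter> insert y ` ?B y = {}" if "x \<in> F" "y \<in> F" "x \<noteq> y" for x y
    using notin that by auto
  have cardB: "card (insert x ` ?B x) = fact k * s ^ k" if "x \<in> F" for x
  proof -
    have "inj_on (insert x) (?B x)"
      by (rule inj_onI) (use notin[OF that, of _ x] in \<open>simp add: insert_ident\<close>)
    then have "card (insert x ` ?B x) = card (?B x)" by (rule card_image)
    also have "\<dots> = fact k * s ^ k"
    proof (rule Suc.IH)
      show "card (L - {i}) = k" "card (R - {r x}) = k"
        using Suc.prems i that by (auto simp: F_def)
    qed (use Suc.prems in auto)
    finally show ?thesis .
  qed
  have "F = (\<Union>j\<in>R. {x\<in>D. l x = i \<and> r x = j})" by (auto simp: F_def)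
  then have "card F = (\<Sum>j\<in>R. card {x\<in>D. l x = i \<and> r x = j})"
    using Suc.prems by (simp add: card_UN_disjoint disjoint_iff)
  also have "\<dots> = Suc k * s" using Suc.prems i by simp
  finally have cF: "card F = Suc k * s" .
  have "card (bitransversals D l r L R) = (\<Sum>x\<in>F. card (insert x ` ?B x))"
    unfolding eq by (rule card_UN_disjoint) (use finF fin disj in auto)
  also have "\<dots> = card F * (fact k * s ^ k)" using cardB by simp
  finally show ?case using cF by (simp add: algebra_simps)
qed

text \<open>Here \<open>c x\<close> is the block containing \<open>x\<close>. Bijectivity of
  \<open>c\<close> on T is the form of the transversal condition that can be counted.\<close>

lemma ex1_mem_block_iff_bij_betw:
  assumes "T \<subseteq> S" "c ` S = P" and mem: "\<And>x C. x \<in> S \<Longrightarrow> C \<in> P \<Longrightarrow> x \<in> C \<longleftrightarrow> c x = C"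
  shows "(\<forall>C\<in>P. \<exists>!x. x \<in> T \<and> x \<in> C) \<longleftrightarrow> bij_betw c T P"
proof
  assume L: "\<forall>C\<in>P. \<exists>!x. x \<in> T \<and> x \<in> C"
  have "inj_on c T"
  proof (rule inj_onI)
    fix x y assume xy: "x \<in> T" "y \<in> T" "c x = c y"
    then have "c x \<in> P" "x \<in> c x" "y \<in> c x" using assms(1,2) mem[of x "c x"] mem[of y "c x"] by auto
    then show "x = y" using L xy by blast
  qed
  moreover have "P \<subseteq> c ` T"
  proof
    fix C assume "C \<in> P"
    then obtain x where "x \<in> T" "x \<in> C" using L by blast
    then show "C \<in> c ` T" using mem[of x C] \<open>C \<in> P\<close> assms(1) by blast
  qed
  moreover have "c ` T \<subseteq> P" using assms by blast
  ultimately show "bij_betw c T P" by (auto simp: bij_betw_def)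
next
  assume L: "bij_betw c T P"
  show "\<forall>C\<in>P. \<exists>!x. x \<in> T \<and> x \<in> C"
  proof
    fix C assume C: "C \<in> P"
    then obtain x where x: "x \<in> T" "c x = C" using L by (auto simp: bij_betw_def)
    show "\<exists>!x. x \<in> T \<and> x \<in> C"
    proof (rule ex1I)
      show "x \<in> T \<and> x \<in> C" using x mem[of x C] C assms(1) by blast
      fix y assume "y \<in> T \<and> y \<in> C"
      then show "y = x" using x mem[of y C] C assms(1) L by (auto simp: bij_betw_def inj_on_def)
    qed
  qed
qed

context group
begin

lemma inv_mult_cancel: "x \<in> carrier G \<Longrightarrow> y \<in> carrier G \<Longrightarrow> inv x \<otimes> (x \<otimes> y) = y"
  by (simp add: m_assoc[symmetric])

lemma mult_inv_cancel: "x \<in> carrier G \<Longrightarrow> y \<in> carrier G \<Longrightarrow> x \<otimes> (inv x \<otimes> y) = y"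
  by (simp add: m_assoc[symmetric])

text \<open>A rewriting system for free groups: it solves the word problem.\<close>

lemmas group_word_simps = m_assoc inv_mult_group inv_mult_cancel mult_inv_cancel

section \<open>Double cosets as grids of left and right cosets\<close>

definition double_coset :: "'a set \<Rightarrow> 'a \<Rightarrow> 'a set" where
  "double_coset H g = {h \<otimes> g \<otimes> h' | h h'. h \<in> H \<and> h' \<in> H}"

definition double_cosets :: "'a set \<Rightarrow> 'a set set" where
  "double_cosets H = double_coset H ` carrier G"

lemma double_coset_eq:
  assumes H: "subgroup H G" and g: "g \<in> carrier G" and y: "y \<in> double_coset H g"
  shows "double_coset H y = double_coset H g"
proof -
  interpret subgroup H G by fact
  obtain h h' where h: "h \<in> H" "h' \<in> H" "y = h \<otimes> g \<otimes> h'"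
    using y by (auto simp: double_coset_def)
  have gy: "g = inv h \<otimes> y \<otimes> inv h'" using h g by (simp add: group_word_simps)
  show ?thesis
  proof (intro equalityI subsetI)
    fix z assume "z \<in> double_coset H y"
    then obtain a b where ab: "a \<in> H" "b \<in> H" "z = a \<otimes> y \<otimes> b" by (auto simp: double_coset_def)
    then have "z = (a \<otimes> h) \<otimes> g \<otimes> (h' \<otimes> b)" using h g by (simp add: m_assoc)
    then show "z \<in> double_coset H g" using ab h by (auto simp: double_coset_def)
  next
    fix z assume "z \<in> double_coset H g"
    then obtain a b where ab: "a \<in> H" "b \<in> H" "z = a \<otimes> g \<otimes> b" by (auto simp: double_coset_def)
    have "y \<in> carrier G" using h g by simp
    then have "z = (a \<otimes> inv h) \<otimes> y \<otimes> (inv h' \<otimes> b)" using ab h g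
      by (simp add: group_word_simps)
    then show "z \<in> double_coset H y" using ab h by (auto simp: double_coset_def)
  qed
qed

lemma double_coset_self: "subgroup H G \<Longrightarrow> g \<in> carrier G \<Longrightarrow> g \<in> double_coset H g"
  unfolding double_coset_def using subgroup.one_closed[of H G] l_one[of g] r_one[of g]
  by (auto intro!: exI[of _ \<one>])

lemma double_coset_subset: "subgroup H G \<Longrightarrow> g \<in> carrier G \<Longrightarrow> double_coset H g \<subseteq> carrier G"
  by (auto simp: double_coset_def subgroup.mem_carrier)

lemma Union_double_cosets: "subgroup H G \<Longrightarrow> \<Union>(double_cosets H) = carrier G"
  using double_coset_self[of H] double_coset_subset[of H] by (auto simp: double_cosets_def)

lemma double_cosets_disjoint:
  assumes "subgroup H G" "D \<in> double_cosets H" "E \<in> double_cosets H" "D \<noteq> E"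
  shows "D \<inter> E = {}"
proof (rule ccontr)
  assume "D \<inter> E \<noteq> {}"
  then obtain x where x: "x \<in> D" "x \<in> E" by blast
  obtain g g' where "g \<in> carrier G" "D = double_coset H g" "g' \<in> carrier G" "E = double_coset H g'"
    using assms by (auto simp: double_cosets_def)
  then have "D = double_coset H x" "E = double_coset H x"
    using double_coset_eq[OF assms(1), of g x] double_coset_eq[OF assms(1), of g' x] x by auto
  then show False using assms(4) by simp
qed

lemma l_coset_mem_iff:
  assumes "subgroup H G" "x \<in> carrier G" "a \<in> carrier G"
  shows "x \<in> a <# H \<longleftrightarrow> x <# H = a <# H"
proof
  assume "x \<in> a <# H"
  then show "x <# H = a <# H" using l_repr_independence assms by blast
next
  assume "x <# H = a <# H"
  then show "x \<in> a <# H" using lcos_self[of x H] assms by simp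
qed

lemma r_coset_mem_iff:
  assumes "subgroup H G" "x \<in> carrier G" "a \<in> carrier G"
  shows "x \<in> H #> a \<longleftrightarrow> H #> x = H #> a"
proof
  assume "x \<in> H #> a"
  then show "H #> x = H #> a" using repr_independence assms by blast
next
  assume "H #> x = H #> a"
  then show "x \<in> H #> a" using rcos_self[of x H] assms by simp
qed

lemma l_coset_eq_iff:
  assumes "subgroup H G" "x \<in> carrier G" "y \<in> carrier G"
  shows "x <# H = y <# H \<longleftrightarrow> inv x \<otimes> y \<in> H"
proof -
  have "inv x \<otimes> y \<in> H \<longleftrightarrow> y \<in> x <# H"
    using subgroup.lcos_module_imp[OF assms(1) is_group] subgroup.lcos_module_rev[OF assms(1) is_group]
      assms by blast
  then show ?thesis using l_coset_mem_iff[of H y x] assms by metis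
qed

lemma r_coset_eq_iff:
  assumes "subgroup H G" "x \<in> carrier G" "y \<in> carrier G"
  shows "H #> x = H #> y \<longleftrightarrow> y \<otimes> inv x \<in> H"
  using subgroup.rcos_module[OF assms(1) is_group, of x y] r_coset_mem_iff[of H y x] assms by metis

lemma mem_double_coset_l:
  assumes "subgroup H G" "g \<in> carrier G" "x \<in> double_coset H g" "y \<in> carrier G" "x <# H = y <# H"
  shows "y \<in> double_coset H g"
proof -
  interpret subgroup H G by fact
  have x: "x \<in> carrier G" using assms double_coset_subset by blast
  then have "inv x \<otimes> y \<in> H" using assms l_coset_eq_iff by blast
  moreover have "y = \<one> \<otimes> x \<otimes> (inv x \<otimes> y)" using x assms by (simp add: group_word_simps)
  ultimately have "y \<in> double_coset H x" unfolding double_coset_def using one_closed by fast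
  then show ?thesis using double_coset_eq assms by blast
qed

lemma mem_double_coset_r:
  assumes "subgroup H G" "g \<in> carrier G" "x \<in> double_coset H g" "y \<in> carrier G" "H #> x = H #> y"
  shows "y \<in> double_coset H g"
proof -
  interpret subgroup H G by fact
  have x: "x \<in> carrier G" using assms double_coset_subset by blast
  then have "y \<otimes> inv x \<in> H" using assms r_coset_eq_iff by blast
  moreover have "y = (y \<otimes> inv x) \<otimes> x \<otimes> \<one>" using x assms by (simp add: m_assoc)
  ultimately have "y \<in> double_coset H x" unfolding double_coset_def using one_closed by fast
  then show ?thesis using double_coset_eq assms by blast
qed

text \<open>For \<open>g\<close> in the group this is H intersected with its conjugate
  \<open>g H g^(-1)\<close>; its index in H is the number of left cosets in
  \<open>HgH\<close>.\<close>

definition conj_core :: "'a set \<Rightarrow> 'a \<Rightarrow> 'a set" where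
  "conj_core H g = {h\<in>H. inv g \<otimes> h \<otimes> g \<in> H}"

text \<open>If x = a g b and y = c g d, the elements of Hy are those of the form a h g d with h in
  H, and such an element lies in xH exactly when \<open>inv g \<otimes> h \<otimes> g\<close> is in
  H. So every cell of the grid is a two-sided translate of the core.\<close>

lemma card_l_coset_Int_r_coset:
  assumes H: "subgroup H G" and g: "g \<in> carrier G" and x: "x \<in> double_coset H g"
    and y: "y \<in> double_coset H g"
  shows "card {z\<in>double_coset H g. z <# H = x <# H \<and> H #> z = H #> y} = card (conj_core H g)"
proof -
  interpret subgroup H G by fact
  obtain a b where ab: "a \<in> H" "b \<in> H" "x = a \<otimes> g \<otimes> b" using x by (auto simp: double_coset_def)
  obtain c d where cd: "c \<in> H" "d \<in> H" "y = c \<otimes> g \<otimes> d" using y by (auto simp: double_coset_def)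
  let ?S = "{z\<in>double_coset H g. z <# H = x <# H \<and> H #> z = H #> y}"
  have xc: "x \<in> carrier G" and yc: "y \<in> carrier G" using ab cd g by auto
  have "bij_betw (\<lambda>h. a \<otimes> h \<otimes> g \<otimes> d) (conj_core H g) ?S"
  proof (rule bij_betw_imageI)
    show "inj_on (\<lambda>h. a \<otimes> h \<otimes> g \<otimes> d) (conj_core H g)"
      using ab cd g by (auto simp: inj_on_def conj_core_def)
    show "(\<lambda>h. a \<otimes> h \<otimes> g \<otimes> d) ` conj_core H g = ?S"
    proof (intro equalityI subsetI)
      fix z assume "z \<in> (\<lambda>h. a \<otimes> h \<otimes> g \<otimes> d) ` conj_core H g"
      then obtain h where h: "h \<in> H" "inv g \<otimes> h \<otimes> g \<in> H" "z = a \<otimes> h \<otimes> g \<otimes> d"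
        by (auto simp: conj_core_def)
      have zc: "z \<in> carrier G" using h ab cd g by simp
      have "z \<in> double_coset H g" using h ab cd unfolding double_coset_def by blast
      moreover have "inv z \<otimes> x = inv d \<otimes> inv (inv g \<otimes> h \<otimes> g) \<otimes> b"
        using h ab cd g by (simp add: group_word_simps)
      then have "inv z \<otimes> x \<in> H" using h ab cd by simp
      then have "z <# H = x <# H" using l_coset_eq_iff H zc xc by blast
      moreover have "y \<otimes> inv z = c \<otimes> inv h \<otimes> inv a"
        using h ab cd g by (simp add: group_word_simps)
      then have "y \<otimes> inv z \<in> H" using h ab cd by simp
      then have "H #> z = H #> y" using r_coset_eq_iff H zc yc by blast
      ultimately show "z \<in> ?S" by blast
    next
      fix z assume z: "z \<in> ?S"
      then have zc: "z \<in> carrier G" using double_coset_subset H g by blast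
      have p: "inv x \<otimes> z \<in> H" "z \<otimes> inv y \<in> H"
        using z l_coset_eq_iff[of H x z] r_coset_eq_iff[of H y z] H xc yc zc by auto
      define h where "h = inv a \<otimes> (z \<otimes> inv y) \<otimes> c"
      have hH: "h \<in> H" using p ab cd by (simp add: h_def)
      have "inv g \<otimes> h \<otimes> g = b \<otimes> (inv x \<otimes> z) \<otimes> inv d"
        using ab cd g zc by (simp add: h_def group_word_simps)
      then have "inv g \<otimes> h \<otimes> g \<in> H" using p ab cd by simp
      moreover have "z = a \<otimes> h \<otimes> g \<otimes> d"
        using ab cd g zc by (simp add: h_def group_word_simps)
      ultimately show "z \<in> (\<lambda>h. a \<otimes> h \<otimes> g \<otimes> d) ` conj_core H g"
        using hH by (auto simp: conj_core_def)
    qed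
  qed
  then show ?thesis by (rule bij_betw_same_card[symmetric])
qed

text \<open>The right cosets cut one left coset into cells of equal size, and the left cosets do the
  same to one right coset. Hence both kinds are equally numerous in D.\<close>

lemma card_double_coset:
  assumes H: "subgroup H G" and g: "g \<in> carrier G" and fin: "finite (carrier G)"
  defines "D \<equiv> double_coset H g"
  shows "card ((\<lambda>x. x <# H) ` D) * card (conj_core H g) = card H"
    and "card ((\<lambda>x. H #> x) ` D) * card (conj_core H g) = card H"
    and "card D = card ((\<lambda>x. x <# H) ` D) * card H"
proof -
  interpret subgroup H G by fact
  have DG: "D \<subseteq> carrier G" unfolding D_def by (rule double_coset_subset[OF H g])
  have finD: "finite D" using DG fin by (rule finite_subset)
  have gD: "g \<in> D" unfolding D_def by (rule double_coset_self[OF H g])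
  have lmem: "z \<in> x <# H \<longleftrightarrow> z \<in> D \<and> z <# H = x <# H" if x: "x \<in> D" for x z
    using l_coset_mem_iff[OF H, of z x] mem_double_coset_l[OF H g x[unfolded D_def], of z]
      l_coset_carrier[OF _ _ H, of z x] x DG unfolding D_def by auto
  have rmem: "z \<in> H #> x \<longleftrightarrow> z \<in> D \<and> H #> z = H #> x" if x: "x \<in> D" for x z
    using r_coset_mem_iff[OF H, of z x] mem_double_coset_r[OF H g x[unfolded D_def], of z]
      elemrcos_carrier[OF is_group, of x z] x DG unfolding D_def by auto
  have lc: "card (x <# H) = card H" if "x \<in> D" for x
    by (rule l_card_cosets_equal[OF _ subset fin, symmetric]) (use that DG in \<open>auto simp: LCOSETS_def\<close>)
  have rc: "card (H #> x) = card H" if "x \<in> D" for x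
    by (rule card_rcosets_equal[OF _ subset, symmetric]) (use that DG in \<open>auto simp: RCOSETS_def\<close>)
  have fib: "card {z\<in>D. z <# H = x <# H \<and> H #> z = H #> y} = card (conj_core H g)"
    if "x \<in> D" "y \<in> D" for x y
    using card_l_coset_Int_r_coset[OF H g] that unfolding D_def by blast
  have "g <# H = (\<Union>j\<in>(\<lambda>x. H #> x) ` D. {z\<in>D. z <# H = g <# H \<and> H #> z = j})"
    using lmem[OF gD] by auto
  then have "card (g <# H) = card (\<Union>j\<in>(\<lambda>x. H #> x) ` D. {z\<in>D. z <# H = g <# H \<and> H #> z = j})"
    by (rule arg_cong)
  also have "\<dots> = (\<Sum>j\<in>(\<lambda>x. H #> x) ` D. card {z\<in>D. z <# H = g <# H \<and> H #> z = j})"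
    using finD by (intro card_UN_disjoint) auto
  also have "\<dots> = (\<Sum>j\<in>(\<lambda>x. H #> x) ` D. card (conj_core H g))"
    by (rule sum.cong) (auto simp: fib gD)
  finally show "card ((\<lambda>x. H #> x) ` D) * card (conj_core H g) = card H" using lc gD by simp
  have "H #> g = (\<Union>i\<in>(\<lambda>x. x <# H) ` D. {z\<in>D. z <# H = i \<and> H #> z = H #> g})"
    using rmem[OF gD] by auto
  then have "card (H #> g) = card (\<Union>i\<in>(\<lambda>x. x <# H) ` D. {z\<in>D. z <# H = i \<and> H #> z = H #> g})"
    by (rule arg_cong)
  also have "\<dots> = (\<Sum>i\<in>(\<lambda>x. x <# H) ` D. card {z\<in>D. z <# H = i \<and> H #> z = H #> g})"
    using finD by (intro card_UN_disjoint) auto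
  also have "\<dots> = (\<Sum>j\<in>(\<lambda>x. x <# H) ` D. card (conj_core H g))"
    by (rule sum.cong) (auto simp: fib gD)
  finally show "card ((\<lambda>x. x <# H) ` D) * card (conj_core H g) = card H" using rc gD by simp
  have "D = (\<Union>i\<in>(\<lambda>x. x <# H) ` D. {z\<in>D. z <# H = i})" by auto
  moreover have "card (\<Union>i\<in>(\<lambda>x. x <# H) ` D. {z\<in>D. z <# H = i})
      = (\<Sum>i\<in>(\<lambda>x. x <# H) ` D. card {z\<in>D. z <# H = i})"
    using finD by (intro card_UN_disjoint) auto
  moreover have "(\<Sum>i\<in>(\<lambda>x. x <# H) ` D. card {z\<in>D. z <# H = i}) = (\<Sum>i\<in>(\<lambda>x. x <# H) ` D. card H)"
  proof (rule sum.cong[OF refl])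
    fix i assume "i \<in> (\<lambda>x. x <# H) ` D"
    then obtain x where x: "x \<in> D" "i = x <# H" by auto
    then have "{z\<in>D. z <# H = i} = x <# H" using lmem[of x] by blast
    then show "card {z\<in>D. z <# H = i} = card H" using lc x by simp
  qed
  ultimately show "card D = card ((\<lambda>x. x <# H) ` D) * card H" by simp
qed

section \<open>Splitting a common transversal over the double cosets\<close>

lemma left_transversal_iff:
  assumes H: "subgroup H G"
  shows "left_transversal G H T \<longleftrightarrow> T \<subseteq> carrier G \<and> bij_betw (\<lambda>x. x <# H) T (lcosets H)"
proof -
  have "\<And>x C. x \<in> carrier G \<Longrightarrow> C \<in> lcosets H \<Longrightarrow> x \<in> C \<longleftrightarrow> x <# H = C"
    using l_coset_mem_iff[OF H] by (auto simp: LCOSETS_def)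
  moreover have "(\<lambda>x. x <# H) ` carrier G = lcosets H" by (auto simp: LCOSETS_def)
  ultimately show ?thesis
    using ex1_mem_block_iff_bij_betw[of T "carrier G" "\<lambda>x. x <# H" "lcosets H"]
    unfolding left_transversal_def by blast
qed

lemma right_transversal_iff:
  assumes H: "subgroup H G"
  shows "right_transversal G H T \<longleftrightarrow> T \<subseteq> carrier G \<and> bij_betw (\<lambda>x. H #> x) T (rcosets H)"
proof -
  have "\<And>x C. x \<in> carrier G \<Longrightarrow> C \<in> rcosets H \<Longrightarrow> x \<in> C \<longleftrightarrow> H #> x = C"
    using r_coset_mem_iff[OF H] by (auto simp: RCOSETS_def)
  moreover have "(\<lambda>x. H #> x) ` carrier G = rcosets H" by (auto simp: RCOSETS_def)
  ultimately show ?thesis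
    using ex1_mem_block_iff_bij_betw[of T "carrier G" "\<lambda>x. H #> x" "rcosets H"]
    unfolding right_transversal_def by blast
qed

text \<open>Each left or right coset lies inside one double coset, so the pieces
  \<open>T \<inter> D\<close> can be chosen independently: T corresponds to a dependent function on
  the double cosets, and taking the union recovers T.\<close>

lemma card_DT:
  assumes H: "subgroup H G" and fin: "finite (carrier G)"
  shows "card (DT G H) = (\<Prod>D\<in>double_cosets H.
    card (bitransversals D (\<lambda>x. x <# H) (\<lambda>x. H #> x) ((\<lambda>x. x <# H) ` D) ((\<lambda>x. H #> x) ` D)))"
proof -
  define B where "B D = bitransversals D (\<lambda>x. x <# H) (\<lambda>x. H #> x) ((\<lambda>x. x <# H) ` D) ((\<lambda>x. H #> x) ` D)"
    for D
  let ?C = "double_cosets H"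
  have finC: "finite ?C" using fin by (simp add: double_cosets_def)
  have subG: "D \<subseteq> carrier G" if "D \<in> ?C" for D
    using that Union_double_cosets[OF H] by blast
  \<comment> \<open>Collisions on either side stay within one double coset. Surjectivity of the
    restricted pieces and injectivity of the glued set both rest on this.\<close>
  have sep: "D = E" if "D \<in> ?C" "E \<in> ?C" "x \<in> D" "y \<in> E" "x <# H = y <# H \<or> H #> x = H #> y" for D E x y
  proof -
    obtain g where g: "g \<in> carrier G" "D = double_coset H g"
      using \<open>D \<in> ?C\<close> by (auto simp: double_cosets_def)
    have "y \<in> carrier G" using that subG by blast
    then have "y \<in> D" using that g mem_double_coset_l[OF H g(1), of x y] mem_double_coset_r[OF H g(1), of x y]
      by blast
    then show ?thesis using double_cosets_disjoint[OF H that(1,2)] that by blast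
  qed
  have DT_iff: "T \<in> DT G H \<longleftrightarrow> T \<subseteq> carrier G \<and> bij_betw (\<lambda>x. x <# H) T (lcosets H) \<and> bij_betw (\<lambda>x. H #> x) T (rcosets H)" for T
    by (auto simp: DT_def left_transversal_iff[OF H] right_transversal_iff[OF H])
  have "bij_betw (\<lambda>T. \<lambda>D\<in>?C. T \<inter> D) (DT G H) (PiE ?C B)"
  proof (rule bij_betwI[where g = "\<lambda>F. \<Union>D\<in>?C. F D"])
    show "(\<lambda>T. \<lambda>D\<in>?C. T \<inter> D) \<in> DT G H \<rightarrow> PiE ?C B"
    proof (intro funcsetI PiE_I)
      fix T D assume T: "T \<in> DT G H" and D: "D \<in> ?C"
      have TG: "T \<subseteq> carrier G" using T DT_iff by blast
      have l: "inj_on (\<lambda>x. x <# H) T" "(\<lambda>x. x <# H) ` T = lcosets H"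
        and r: "inj_on (\<lambda>x. H #> x) T" "(\<lambda>x. H #> x) ` T = rcosets H"
        using T DT_iff by (auto simp: bij_betw_def)
      have "(\<lambda>x. x <# H) ` (T \<inter> D) = (\<lambda>x. x <# H) ` D"
      proof (intro equalityI subsetI)
        fix C assume "C \<in> (\<lambda>x. x <# H) ` D"
        then obtain x where x: "x \<in> D" "C = x <# H" by blast
        then have "C \<in> (\<lambda>x. x <# H) ` T" using subG[OF D] unfolding l(2) by (auto simp: LCOSETS_def)
        then obtain t where t: "t \<in> T" "t <# H = x <# H" using x by auto
        then obtain E where E: "E \<in> ?C" "t \<in> E" using TG Union_double_cosets[OF H] by blast
        then have "E = D" using sep[OF E(1) D E(2) x(1)] t by blast
        then show "C \<in> (\<lambda>x. x <# H) ` (T \<inter> D)" using t E x by (metis IntI image_eqI)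
      qed blast
      moreover have "(\<lambda>x. H #> x) ` (T \<inter> D) = (\<lambda>x. H #> x) ` D"
      proof (intro equalityI subsetI)
        fix C assume "C \<in> (\<lambda>x. H #> x) ` D"
        then obtain x where x: "x \<in> D" "C = H #> x" by blast
        then have "C \<in> (\<lambda>x. H #> x) ` T" using subG[OF D] unfolding r(2) by (auto simp: RCOSETS_def)
        then obtain t where t: "t \<in> T" "H #> t = H #> x" using x by auto
        then obtain E where E: "E \<in> ?C" "t \<in> E" using TG Union_double_cosets[OF H] by blast
        then have "E = D" using sep[OF E(1) D E(2) x(1)] t by blast
        then show "C \<in> (\<lambda>x. H #> x) ` (T \<inter> D)" using t E x by (metis IntI image_eqI)
      qed blast
      moreover have "inj_on (\<lambda>x. x <# H) (T \<inter> D)" "inj_on (\<lambda>x. H #> x) (T \<inter> D)"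
        using l(1) r(1) by (auto intro: inj_on_subset)
      ultimately show "(\<lambda>D\<in>?C. T \<inter> D) D \<in> B D" using D
        by (simp add: B_def bitransversals_def bij_betw_def)
    qed simp
    show "(\<lambda>F. \<Union>D\<in>?C. F D) \<in> PiE ?C B \<rightarrow> DT G H"
    proof
      fix F assume F: "F \<in> PiE ?C B"
      have FB: "F D \<in> B D" if "D \<in> ?C" for D using F that by blast
      have FD: "F D \<subseteq> D" if "D \<in> ?C" for D
        using FB[OF that] by (auto simp: B_def bitransversals_def)
      have "inj_on (\<lambda>x. x <# H) (\<Union>D\<in>?C. F D)" "inj_on (\<lambda>x. H #> x) (\<Union>D\<in>?C. F D)"
      proof -
        have *: "x \<in> F D \<Longrightarrow> y \<in> F D \<Longrightarrow> x <# H = y <# H \<or> H #> x = H #> y \<Longrightarrow> x = y"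
          if "D \<in> ?C" for x y D
          using FB[OF that] unfolding B_def bitransversals_def bij_betw_def inj_on_def by blast
        have "x = y" if "D \<in> ?C" "E \<in> ?C" "x \<in> F D" "y \<in> F E" "x <# H = y <# H \<or> H #> x = H #> y" for x y D E
        proof -
          have "D = E" using sep[OF that(1,2) _ _ that(5)] FD that by blast
          then show ?thesis using * that by blast
        qed
        then show "inj_on (\<lambda>x. x <# H) (\<Union>D\<in>?C. F D)" "inj_on (\<lambda>x. H #> x) (\<Union>D\<in>?C. F D)"
          unfolding inj_on_def by blast+
      qed
      moreover have "(\<lambda>x. x <# H) ` (\<Union>D\<in>?C. F D) = lcosets H"
      proof -
        have "(\<lambda>x. x <# H) ` (\<Union>D\<in>?C. F D) = (\<Union>D\<in>?C. (\<lambda>x. x <# H) ` D)"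
          using FB by (auto simp: image_UN B_def bitransversals_def bij_betw_def)
        also have "\<dots> = (\<lambda>x. x <# H) ` carrier G" by (simp add: Union_double_cosets[OF H, symmetric] image_Union)
        finally show ?thesis by (auto simp: LCOSETS_def)
      qed
      moreover have "(\<lambda>x. H #> x) ` (\<Union>D\<in>?C. F D) = rcosets H"
      proof -
        have "(\<lambda>x. H #> x) ` (\<Union>D\<in>?C. F D) = (\<Union>D\<in>?C. (\<lambda>x. H #> x) ` D)"
          using FB by (auto simp: image_UN B_def bitransversals_def bij_betw_def)
        also have "\<dots> = (\<lambda>x. H #> x) ` carrier G" by (simp add: Union_double_cosets[OF H, symmetric] image_Union)
        finally show ?thesis by (auto simp: RCOSETS_def)
      qed
      moreover have "(\<Union>D\<in>?C. F D) \<subseteq> carrier G" using FD subG by blast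
      ultimately show "(\<Union>D\<in>?C. F D) \<in> DT G H" unfolding DT_iff bij_betw_def by blast
    qed
    show "(\<Union>D\<in>?C. (\<lambda>D\<in>?C. T \<inter> D) D) = T" if "T \<in> DT G H" for T
    proof -
      have "(\<Union>D\<in>?C. (\<lambda>D\<in>?C. T \<inter> D) D) = T \<inter> \<Union>?C" by auto
      then show ?thesis using that DT_iff Union_double_cosets[OF H] by auto
    qed
    show "(\<lambda>D\<in>?C. (\<Union>E\<in>?C. F E) \<inter> D) = F" if F: "F \<in> PiE ?C B" for F
    proof (rule ext)
      fix D
      have FD: "F E \<subseteq> E" if "E \<in> ?C" for E
        using PiE_mem[OF F that] by (auto simp: B_def bitransversals_def)
      show "(\<lambda>D\<in>?C. (\<Union>E\<in>?C. F E) \<inter> D) D = F D"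
      proof (cases "D \<in> ?C")
        case True
        have "(\<Union>E\<in>?C. F E) \<inter> D = F D"
          using FD True double_cosets_disjoint[OF H True] by blast
        then show ?thesis using True by simp
      next
        case False
        then show ?thesis using PiE_arb[OF F] by simp
      qed
    qed
  qed
  then have "card (DT G H) = card (PiE ?C B)" by (rule bij_betw_same_card)
  then show ?thesis using finC by (simp add: card_PiE B_def)
qed

end

section \<open>The transversal probability as a product over double cosets\<close>

text \<open>The probability that a random self-map of a k-element set is a bijection. The value at 0
  is 1, because \<open>0 ^ 0 = 1\<close>.\<close>

definition fact_ratio :: "nat \<Rightarrow> real" where
  "fact_ratio k = fact k / real k ^ k"

lemma fact_ratio_pos: "0 < fact_ratio k"
  by (cases "k = 0") (auto simp: fact_ratio_def)

text \<open>After cancelling n + 1, the next value is \<open>n! / (n+1)^n\<close>, which differs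
  from \<open>n! / n^n\<close> only by a larger denominator.\<close>

lemma fact_ratio_antimono: "i \<le> j \<Longrightarrow> fact_ratio j \<le> fact_ratio i"
proof (induction rule: dec_induct)
  case (step n)
  have "fact_ratio (Suc n) \<le> fact_ratio n"
  proof (cases "n = 0")
    case False
    have "fact_ratio (Suc n) = fact n / real (Suc n) ^ n"
      by (simp add: fact_ratio_def field_simps del: of_nat_Suc)
    also have "\<dots> \<le> fact n / real n ^ n"
      using False by (intro divide_left_mono power_mono mult_pos_pos) auto
    finally show ?thesis by (simp add: fact_ratio_def)
  qed (simp add: fact_ratio_def)
  then show ?case using step.IH by linarith
qed simp

lemma fact_ratio_small:
  "fact_ratio 1 = 1" "fact_ratio 2 = 1/2" "fact_ratio 3 = 2/9" "fact_ratio 4 = 3/32"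
  "fact_ratio 5 = 24/625"
  by (simp_all add: fact_ratio_def fact_numeral)

lemma fact_ratio_le_one: "fact_ratio k \<le> 1"
  using fact_ratio_antimono[of 0 k] by (simp add: fact_ratio_def)

context group
begin

definition dc_index :: "'a set \<Rightarrow> 'a set \<Rightarrow> nat" where
  "dc_index H D = card ((\<lambda>x. x <# H) ` D)"

definition nontrivial_dcs :: "'a set \<Rightarrow> 'a set set" where
  "nontrivial_dcs H = {D\<in>double_cosets H. dc_index H D \<noteq> 1}"

text \<open>The normaliser of \<open>H\<close>; for infinite \<open>H\<close> the inclusion may be proper and this need not be a subgroup.\<close>

definition nrm :: "'a set \<Rightarrow> 'a set" where
  "nrm H = {g\<in>carrier G. \<forall>h\<in>H. inv g \<otimes> h \<otimes> g \<in> H}"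

context
  fixes H
  assumes H: "subgroup H G" and fin: "finite (carrier G)"
begin

lemma finite_subgroup_carrier: "finite H"
  using H fin by (meson finite_subset subgroup.subset)

lemma card_subgroup_pos: "card H > 0"
  using finite_subgroup_carrier H by (metis card_gt_0_iff empty_iff subgroup.one_closed)

lemma finite_double_cosets: "finite (double_cosets H)"
  using fin by (simp add: double_cosets_def)

lemma card_double_cosets_mem:
  assumes "D \<in> double_cosets H"
  shows "card D = dc_index H D * card H"
  using assms card_double_coset(3)[OF H _ fin] by (auto simp: dc_index_def double_cosets_def)

lemma dc_index_dvd:
  assumes "D \<in> double_cosets H"
  shows "dc_index H D dvd card H"
  using assms card_double_coset(1)[OF H _ fin] unfolding dc_index_def double_cosets_def
  by (metis dvd_triv_left imageE)

lemma dc_index_pos: "D \<in> double_cosets H \<Longrightarrow> dc_index H D > 0"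
  using dc_index_dvd card_subgroup_pos by (metis dvd_0_left gr0I less_not_refl)

lemma dc_index_double_coset:
  assumes "g \<in> carrier G"
  shows "dc_index H (double_coset H g) * card (conj_core H g) = card H"
  using card_double_coset(1)[OF H assms fin] by (simp add: dc_index_def)

lemma dc_index_eq_1_iff:
  assumes g: "g \<in> carrier G"
  shows "dc_index H (double_coset H g) = 1 \<longleftrightarrow> g \<in> nrm H"
proof -
  have "dc_index H (double_coset H g) = 1 \<longleftrightarrow> card (conj_core H g) = card H"
    using dc_index_double_coset[OF g] card_subgroup_pos by auto
  also have "\<dots> \<longleftrightarrow> conj_core H g = H"
    using finite_subgroup_carrier card_subset_eq[of H "conj_core H g"] by (auto simp: conj_core_def)
  also have "\<dots> \<longleftrightarrow> g \<in> nrm H" using g by (auto simp: conj_core_def nrm_def)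
  finally show ?thesis .
qed

lemma sum_dc_index: "(\<Sum>D\<in>double_cosets H. dc_index H D) = card (rcosets H)"
proof -
  have "card (carrier G) = card (\<Union>D\<in>double_cosets H. D)" by (simp add: Union_double_cosets[OF H])
  also have "\<dots> = (\<Sum>D\<in>double_cosets H. card D)"
  proof (rule card_UN_disjoint[OF finite_double_cosets])
    show "\<forall>D\<in>double_cosets H. finite D"
      using Union_double_cosets[OF H] fin by (metis Union_upper finite_subset)
  qed (use double_cosets_disjoint[OF H] in blast)
  also have "\<dots> = (\<Sum>D\<in>double_cosets H. dc_index H D) * card H"
    by (simp add: card_double_cosets_mem sum_distrib_right)
  finally have "(\<Sum>D\<in>double_cosets H. dc_index H D) * card H = card (rcosets H) * card H"
    using lagrange[OF H] unfolding order_def by argo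
  then show ?thesis using card_subgroup_pos by (metis mult_right_cancel less_not_refl)
qed

text \<open>With |H| = k s, the grid count \<open>k! s^k\<close> equals
  \<open>(k!/k^k) |H|^k\<close>. The powers of |H| then multiply to the denominator of P, because
  the k add up to the index of H.\<close>

lemma card_bitransversals_double_coset:
  assumes D: "D \<in> double_cosets H"
  shows "real (card (bitransversals D (\<lambda>x. x <# H) (\<lambda>x. H #> x) ((\<lambda>x. x <# H) ` D) ((\<lambda>x. H #> x) ` D)))
    = fact_ratio (dc_index H D) * real (card H) ^ dc_index H D"
proof -
  obtain g where g: "g \<in> carrier G" "D = double_coset H g" using D by (auto simp: double_cosets_def)
  let ?s = "card (conj_core H g)" and ?k = "dc_index H D"
  have finD: "finite D" using double_coset_subset[OF H g(1)] g(2) fin finite_subset by blast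
  have ks: "?k * ?s = card H" using dc_index_double_coset g by simp
  then have s: "?s > 0" using card_subgroup_pos by (auto intro: gr0I)
  have "card ((\<lambda>x. H #> x) ` D) * ?s = card H" using card_double_coset(2)[OF H g(1) fin] g by simp
  then have kr: "card ((\<lambda>x. H #> x) ` D) = ?k" using ks s by (metis mult_right_cancel less_not_refl)
  have "card (bitransversals D (\<lambda>x. x <# H) (\<lambda>x. H #> x) ((\<lambda>x. x <# H) ` D) ((\<lambda>x. H #> x) ` D))
      = fact ?k * ?s ^ ?k"
  proof (rule card_bitransversals)
    fix i j assume "i \<in> (\<lambda>x. x <# H) ` D" "j \<in> (\<lambda>x. H #> x) ` D"
    then obtain x y where "x \<in> D" "y \<in> D" "i = x <# H" "j = H #> y" by blast
    then show "card {z \<in> D. z <# H = i \<and> H #> z = j} = ?s"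
      using card_l_coset_Int_r_coset[OF H g(1), of x y] g(2) by simp
  qed (use finD kr in \<open>auto simp: dc_index_def\<close>)
  moreover have "real (card H) ^ ?k = real ?k ^ ?k * real ?s ^ ?k"
    by (simp add: ks[symmetric] power_mult_distrib)
  ultimately show ?thesis using dc_index_pos[OF D] by (simp add: fact_ratio_def)
qed

theorem transversal_prob_eq_prod:
  "transversal_prob G H = (\<Prod>D\<in>double_cosets H. fact_ratio (dc_index H D))"
proof -
  have "real (card (DT G H)) = (\<Prod>D\<in>double_cosets H. fact_ratio (dc_index H D) * real (card H) ^ dc_index H D)"
    by (simp add: card_DT[OF H fin] card_bitransversals_double_coset)
  also have "\<dots> = (\<Prod>D\<in>double_cosets H. fact_ratio (dc_index H D)) * real (card H) ^ card (rcosets H)"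
    by (simp add: prod.distrib power_sum[symmetric] sum_dc_index)
  finally show ?thesis using card_subgroup_pos by (simp add: transversal_prob_def)
qed

lemma transversal_prob_le_prod:
  assumes "S \<subseteq> double_cosets H"
  shows "transversal_prob G H \<le> (\<Prod>D\<in>S. fact_ratio (dc_index H D))"
proof -
  have "transversal_prob G H = (\<Prod>D\<in>double_cosets H - S. fact_ratio (dc_index H D)) * (\<Prod>D\<in>S. fact_ratio (dc_index H D))"
    unfolding transversal_prob_eq_prod by (rule prod.subset_diff[OF assms finite_double_cosets])
  also have "\<dots> \<le> 1 * (\<Prod>D\<in>S. fact_ratio (dc_index H D))"
    by (intro mult_right_mono prod_le_1 prod_nonneg) (auto simp: fact_ratio_le_one fact_ratio_pos less_imp_le)
  finally show ?thesis by simp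
qed

lemma Union_nontrivial_dcs: "\<Union>(nontrivial_dcs H) = carrier G - nrm H"
proof (intro equalityI subsetI)
  fix x assume "x \<in> \<Union>(nontrivial_dcs H)"
  then obtain g where g: "g \<in> carrier G" "x \<in> double_coset H g" "dc_index H (double_coset H g) \<noteq> 1"
    by (auto simp: nontrivial_dcs_def double_cosets_def)
  then have x: "x \<in> carrier G" using double_coset_subset[OF H] by blast
  then show "x \<in> carrier G - nrm H" using g dc_index_eq_1_iff[OF x] double_coset_eq[OF H g(1,2)] by simp
next
  fix x assume x: "x \<in> carrier G - nrm H"
  then have "double_coset H x \<in> nontrivial_dcs H"
    using dc_index_eq_1_iff[of x] by (simp add: nontrivial_dcs_def double_cosets_def)
  then show "x \<in> \<Union>(nontrivial_dcs H)" using double_coset_self[OF H, of x] x by blast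
qed

lemma card_Diff_nrm: "card (carrier G - nrm H) = (\<Sum>D\<in>nontrivial_dcs H. dc_index H D) * card H"
proof -
  have sub: "nontrivial_dcs H \<subseteq> double_cosets H" by (auto simp: nontrivial_dcs_def)
  have "card (\<Union>D\<in>nontrivial_dcs H. D) = (\<Sum>D\<in>nontrivial_dcs H. card D)"
  proof (rule card_UN_disjoint)
    show "\<forall>D\<in>nontrivial_dcs H. finite D"
      using Union_nontrivial_dcs fin by (metis Union_upper finite_Diff finite_subset)
  qed (use double_cosets_disjoint[OF H] sub finite_subset[OF sub finite_double_cosets] in blast)+
  also have "\<dots> = (\<Sum>D\<in>nontrivial_dcs H. dc_index H D * card H)"
    using sub card_double_cosets_mem by (intro sum.cong) auto
  finally show ?thesis by (simp add: Union_nontrivial_dcs sum_distrib_right)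
qed

section \<open>Sizes of double cosets when P exceeds 4/81\<close>

context
  assumes P: "transversal_prob G H > 4 / 81"
begin

lemma dc_index_less_5:
  assumes "D \<in> double_cosets H"
  shows "dc_index H D < 5"
proof (rule ccontr)
  assume "\<not> dc_index H D < 5"
  then have "fact_ratio (dc_index H D) \<le> 24/625" using fact_ratio_antimono[of 5] fact_ratio_small by simp
  then show False using P transversal_prob_le_prod[of "{D}"] assms by simp
qed

text \<open>It serves to refute the pairs (3, 3), whose product is exactly 4/81, and (4, 2), whose
  product 3/64 is smaller.\<close>

lemma dc_index_two_large:
  assumes "D \<in> double_cosets H" "E \<in> double_cosets H" "D \<noteq> E"
    "i \<le> dc_index H D" "j \<le> dc_index H E"
  shows "fact_ratio i * fact_ratio j > 4/81"
proof -
  have "4/81 < fact_ratio (dc_index H D) * fact_ratio (dc_index H E)"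
    using P transversal_prob_le_prod[of "{D,E}"] assms by simp
  also have "\<dots> \<le> fact_ratio i * fact_ratio j"
    using assms by (intro mult_mono fact_ratio_antimono) (auto simp: fact_ratio_pos less_imp_le)
  finally show ?thesis .
qed

text \<open>Each nontrivial factor is at most 1/2, and 1/32 < 4/81 < 1/16.\<close>

lemma card_nontrivial_dcs_le: "card (nontrivial_dcs H) \<le> 4"
proof (rule ccontr)
  assume "\<not> card (nontrivial_dcs H) \<le> 4"
  then have c: "5 \<le> card (nontrivial_dcs H)" by simp
  have "transversal_prob G H \<le> (\<Prod>D\<in>nontrivial_dcs H. fact_ratio (dc_index H D))"
    by (rule transversal_prob_le_prod) (auto simp: nontrivial_dcs_def)
  also have "\<dots> \<le> (\<Prod>D\<in>nontrivial_dcs H. 1/2)"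
  proof (rule prod_mono)
    fix D assume "D \<in> nontrivial_dcs H"
    then have "2 \<le> dc_index H D" using dc_index_pos[of D] by (auto simp: nontrivial_dcs_def)
    then show "0 \<le> fact_ratio (dc_index H D) \<and> fact_ratio (dc_index H D) \<le> 1/2"
      using fact_ratio_antimono[of 2 "dc_index H D"] fact_ratio_small fact_ratio_pos[of "dc_index H D"]
      by simp
  qed
  also have "\<dots> = (1/2) ^ card (nontrivial_dcs H)" by simp
  also have "\<dots> \<le> (1/2) ^ 5" using c by (intro power_decreasing) auto
  finally show False using P by (simp add: power_divide)
qed

text \<open>The index is a nontrivial power of p, and 24/625 < 4/81 keeps it below 5.\<close>

lemma dc_index_prime_power:
  assumes "prime p" "card H = p ^ e" "D \<in> nontrivial_dcs H"
  shows "p = 3 \<and> dc_index H D = 3 \<or> p = 2 \<and> dc_index H D \<in> {2, 4}"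
proof -
  have D: "D \<in> double_cosets H" "dc_index H D \<noteq> 1" using assms by (auto simp: nontrivial_dcs_def)
  obtain i where i: "dc_index H D = p ^ i"
    using dc_index_dvd[OF D(1)] assms divides_primepow_nat by metis
  then have i0: "i \<noteq> 0" using D by (auto intro: ccontr)
  have lt: "p ^ i < 5" using dc_index_less_5[OF D(1)] i by simp
  have "p \<le> p ^ i" using i0 prime_ge_1_nat[OF assms(1)] by (simp add: self_le_power)
  then have "p < 5" using lt by linarith
  then have "p \<in> {2, 3, 4}" using prime_ge_2_nat[OF assms(1)] by auto
  moreover have "\<not> prime (4::nat)" using prime_product[of 2 2] by auto
  ultimately have p: "p = 2 \<or> p = 3" using assms(1) by auto
  have "i < 3"
  proof (rule ccontr)
    assume "\<not> i < 3"
    then have "(2::nat) ^ 3 \<le> 2 ^ i" by (intro power_increasing) auto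
    also have "\<dots> \<le> p ^ i" using p by (intro power_mono) auto
    finally show False using lt by simp
  qed
  then have "i = 1 \<or> i = 2" using i0 by linarith
  then show ?thesis using p lt i by auto
qed

lemma three_group_spectrum:
  assumes "card H = 3 ^ e" "carrier G \<noteq> nrm H"
  obtains g where "g \<in> carrier G" "carrier G - nrm H = double_coset H g"
    "card (double_coset H g) = 3 * card H"
proof -
  have "carrier G - nrm H \<noteq> {}" using assms(2) by (auto simp: nrm_def)
  then obtain D where D: "D \<in> nontrivial_dcs H" using Union_nontrivial_dcs by blast
  have k: "dc_index H E = 3" if "E \<in> nontrivial_dcs H" for E
    using dc_index_prime_power[OF _ assms(1) that] by simp
  have "E = D" if "E \<in> nontrivial_dcs H" for E
    using dc_index_two_large[of D E 3 3] k[OF D] k[OF that] that D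
    by (auto simp: nontrivial_dcs_def fact_ratio_small)
  then have "nontrivial_dcs H = {D}" using D by blast
  moreover obtain g where "g \<in> carrier G" "D = double_coset H g"
    using D by (auto simp: nontrivial_dcs_def double_cosets_def)
  ultimately show ?thesis
    using that[of g] Union_nontrivial_dcs card_double_cosets_mem[of D] k[OF D] D
    by (auto simp: nontrivial_dcs_def)
qed

text \<open>A double coset with k = 4 tolerates no second nontrivial one, so otherwise every
  nontrivial k is 2. The second alternative records the index of the cores, since a core of index 2
  in a cyclic group contains the square of its generator.\<close>

lemma two_group_spectrum:
  assumes "card H = 2 ^ e" "carrier G \<noteq> nrm H"
  shows "(\<exists>g\<in>carrier G. carrier G - nrm H = double_coset H g \<and> card (double_coset H g) = 4 * card H) \<or>
    (\<exists>a\<in>{1..4}. card (carrier G - nrm H) = 2 * a * card H \<and>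
      (\<forall>g\<in>carrier G - nrm H. 2 * card (conj_core H g) = card H))"
proof -
  have "carrier G - nrm H \<noteq> {}" using assms(2) by (auto simp: nrm_def)
  then have ne: "nontrivial_dcs H \<noteq> {}" using Union_nontrivial_dcs by blast
  have k: "dc_index H E \<in> {2, 4}" if "E \<in> nontrivial_dcs H" for E
    using dc_index_prime_power[OF _ assms(1) that] by simp
  show ?thesis
  proof (cases "\<exists>D\<in>nontrivial_dcs H. dc_index H D = 4")
    case True
    then obtain D where D: "D \<in> nontrivial_dcs H" "dc_index H D = 4" by blast
    have "E = D" if "E \<in> nontrivial_dcs H" for E
    proof (rule ccontr)
      assume "E \<noteq> D"
      moreover have "2 \<le> dc_index H E" using k[OF that] by auto
      ultimately have "fact_ratio 4 * fact_ratio 2 > 4/81"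
        using dc_index_two_large[of D E 4 2] D that by (simp add: nontrivial_dcs_def)
      then show False by (simp add: fact_ratio_small)
    qed
    then have "nontrivial_dcs H = {D}" using D by blast
    moreover obtain g where "g \<in> carrier G" "D = double_coset H g"
      using D by (auto simp: nontrivial_dcs_def double_cosets_def)
    ultimately have "g \<in> carrier G" "carrier G - nrm H = double_coset H g"
      "card (double_coset H g) = 4 * card H"
      using Union_nontrivial_dcs card_double_cosets_mem[of D] D
      by (auto simp: nontrivial_dcs_def)
    then show ?thesis by blast
  next
    case False
    then have k2: "dc_index H E = 2" if "E \<in> nontrivial_dcs H" for E using k[OF that] that by auto
    have "card (carrier G - nrm H) = 2 * card (nontrivial_dcs H) * card H"
      using card_Diff_nrm k2 by simp
    moreover have "card (nontrivial_dcs H) \<in> {1..4}"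
      using card_nontrivial_dcs_le ne finite_double_cosets
      by (simp add: nontrivial_dcs_def Suc_leI card_gt_0_iff)
    moreover have "2 * card (conj_core H g) = card H" if "g \<in> carrier G - nrm H" for g
    proof -
      have "double_coset H g \<in> nontrivial_dcs H"
        using that dc_index_eq_1_iff[of g] by (simp add: nontrivial_dcs_def double_cosets_def)
      then show ?thesis using k2[of "double_coset H g"] dc_index_double_coset[of g] that by simp
    qed
    ultimately show ?thesis by blast
  qed
qed

lemma two_group_card_Diff_nrm_le:
  assumes "card H = 2 ^ e"
  shows "card (carrier G - nrm H) \<le> 8 * card H"
proof (cases "carrier G = nrm H")
  case False
  from two_group_spectrum[OF assms False] show ?thesis by auto
qed simp

end

end

section \<open>Conjugation and the derived subgroup\<close>

text \<open>This is a right action: by \<open>cj_cj\<close>, acting with h and then with g is acting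
  with \<open>h \<otimes> g\<close>.\<close>

definition cj :: "'a \<Rightarrow> 'a \<Rightarrow> 'a" where
  "cj g x = inv g \<otimes> x \<otimes> g"

abbreviation cyc :: "'a \<Rightarrow> 'a set" where
  "cyc x \<equiv> generate G {x}"

abbreviation comms :: "'a set" where
  "comms \<equiv> derived G (carrier G)"

lemma cj_closed [simp]: "g \<in> carrier G \<Longrightarrow> x \<in> carrier G \<Longrightarrow> cj g x \<in> carrier G"
  by (simp add: cj_def)

lemma cj_mult: "g \<in> carrier G \<Longrightarrow> x \<in> carrier G \<Longrightarrow> y \<in> carrier G \<Longrightarrow> cj g (x \<otimes> y) = cj g x \<otimes> cj g y"
  by (simp add: cj_def group_word_simps)

lemma cj_inv: "g \<in> carrier G \<Longrightarrow> x \<in> carrier G \<Longrightarrow> cj g (inv x) = inv (cj g x)"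
  by (simp add: cj_def group_word_simps)

lemma cj_one [simp]: "g \<in> carrier G \<Longrightarrow> cj g \<one> = \<one>" "x \<in> carrier G \<Longrightarrow> cj \<one> x = x"
  by (simp_all add: cj_def)

lemma cj_cj: "g \<in> carrier G \<Longrightarrow> h \<in> carrier G \<Longrightarrow> x \<in> carrier G \<Longrightarrow> cj g (cj h x) = cj (h \<otimes> g) x"
  by (simp add: cj_def group_word_simps)

lemma cj_pow: "g \<in> carrier G \<Longrightarrow> x \<in> carrier G \<Longrightarrow> cj g (x [^] (n::nat)) = cj g x [^] n"
  by (induction n) (simp_all add: cj_mult)

lemma cj_inj: "g \<in> carrier G \<Longrightarrow> x \<in> carrier G \<Longrightarrow> y \<in> carrier G \<Longrightarrow> cj g x = cj g y \<Longrightarrow> x = y"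
  by (simp add: cj_def)

lemma cj_eq_self_iff: "g \<in> carrier G \<Longrightarrow> x \<in> carrier G \<Longrightarrow> cj g x = x \<longleftrightarrow> x \<otimes> g = g \<otimes> x"
  by (metis cj_def inv_solve_left m_assoc m_closed inv_closed)

lemma cj_inv_eq:
  "g \<in> carrier G \<Longrightarrow> x \<in> carrier G \<Longrightarrow> y \<in> carrier G \<Longrightarrow> cj g x = y \<longleftrightarrow> x = cj (inv g) y"
  by (auto simp: cj_def group_word_simps)

lemma cyc_subgroup: "x \<in> carrier G \<Longrightarrow> subgroup (cyc x) G"
  by (simp add: generate_is_subgroup)

lemma cyc_self: "x \<in> cyc x"
  by (simp add: generate.incl)

lemma cyc_subset: "x \<in> B \<Longrightarrow> subgroup B G \<Longrightarrow> cyc x \<subseteq> B"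
  by (simp add: generate_subgroup_incl)

lemma cyc_commute: "x \<in> carrier G \<Longrightarrow> a \<in> cyc x \<Longrightarrow> b \<in> cyc x \<Longrightarrow> a \<otimes> b = b \<otimes> a"
  by (auto simp: generate_pow int_pow_mult[symmetric] add.commute)

text \<open>It reduces inclusions between conjugates of generated subgroups to a check on
  generators.\<close>

lemma cj_subgroup_preimage:
  assumes B: "subgroup B G" and a: "a \<in> carrier G"
  shows "subgroup {x\<in>carrier G. cj a x \<in> B} G"
proof -
  interpret subgroup B G by fact
  show ?thesis using a by unfold_locales (auto simp: cj_mult cj_inv)
qed

lemma nrm_iff: "a \<in> nrm H \<longleftrightarrow> a \<in> carrier G \<and> (\<forall>h\<in>H. cj a h \<in> H)"
  by (simp add: nrm_def cj_def)

lemma nrm_generate: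
  assumes "S \<subseteq> carrier G" "a \<in> carrier G" "\<And>s. s \<in> S \<Longrightarrow> cj a s \<in> generate G S"
  shows "a \<in> nrm (generate G S)"
proof -
  have "generate G S \<subseteq> {x\<in>carrier G. cj a x \<in> generate G S}"
    using assms by (intro generate_subgroup_incl cj_subgroup_preimage generate_is_subgroup) auto
  then show ?thesis using assms by (auto simp: nrm_iff)
qed

lemma nrm_cyc_iff: "x \<in> carrier G \<Longrightarrow> a \<in> nrm (cyc x) \<longleftrightarrow> a \<in> carrier G \<and> cj a x \<in> cyc x"
  using nrm_generate[of "{x}" a] cyc_self by (auto simp: nrm_iff)

text \<open>An injective self-map of a finite set is onto. This is what gives
  \<open>nrm_subgroup\<close> its inverses.\<close>

lemma cj_image_eq:
  assumes "finite (carrier G)" "H \<subseteq> carrier G" "a \<in> nrm H"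
  shows "cj a ` H = H"
proof -
  have "a \<in> carrier G" using assms by (simp add: nrm_iff)
  then have "inj_on (cj a) H" using assms(2) by (intro inj_onI) (rule cj_inj[of a], auto)
  moreover have "cj a ` H \<subseteq> H" using assms by (auto simp: nrm_iff)
  ultimately show ?thesis using assms by (meson endo_inj_surj finite_subset)
qed

lemma nrm_subgroup:
  assumes fin: "finite (carrier G)" and H: "H \<subseteq> carrier G"
  shows "subgroup (nrm H) G"
proof
  show "nrm H \<subseteq> carrier G" by (auto simp: nrm_def)
  show "\<one> \<in> nrm H" using H by (auto simp: nrm_iff)
  fix a b assume a: "a \<in> nrm H"
  then have ac: "a \<in> carrier G" by (simp add: nrm_iff)
  { assume b: "b \<in> nrm H"
    show "a \<otimes> b \<in> nrm H" using a b H by (auto simp: nrm_iff cj_cj[symmetric] subsetD) }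
  show "inv a \<in> nrm H"
    unfolding nrm_iff
  proof (intro conjI ballI)
    fix h assume h: "h \<in> H"
    then have "h \<in> cj a ` H" using cj_image_eq[OF fin H a] by simp
    then obtain k where k: "k \<in> H" "h = cj a k" by blast
    then have "cj (inv a) h = k" using ac H by (simp add: cj_def group_word_simps subsetD)
    then show "cj (inv a) h \<in> H" using k by simp
  qed (use ac in simp)
qed

lemma comms_carrier: "c \<in> comms \<Longrightarrow> c \<in> carrier G"
  using derived_in_carrier[of "carrier G"] by blast

text \<open>A commutator in the shape \<open>(a \<otimes> b) \<otimes> inv (b \<otimes> a)\<close>
  lies in A exactly when ab and ba have the same right coset, so it suits arguments modulo
  A.\<close>

lemma comms_subset:
  assumes "subgroup A G" "\<And>a b. a \<in> carrier G \<Longrightarrow> b \<in> carrier G \<Longrightarrow> (a \<otimes> b) \<otimes> inv (b \<otimes> a) \<in> A"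
  shows "comms \<subseteq> A"
proof -
  have "derived_set G (carrier G) \<subseteq> A"
  proof clarify
    fix a b assume ab: "a \<in> carrier G" "b \<in> carrier G"
    have "a \<otimes> b \<otimes> inv a \<otimes> inv b = (a \<otimes> b) \<otimes> inv (b \<otimes> a)" using ab by (simp add: group_word_simps)
    then show "a \<otimes> b \<otimes> inv a \<otimes> inv b \<in> A" using assms(2)[OF ab] by simp
  qed
  then show ?thesis unfolding derived_def by (rule generate_subgroup_incl[OF _ assms(1)])
qed

lemma centralizer_subgroup: "x \<in> carrier G \<Longrightarrow> subgroup {c\<in>carrier G. cj c x = x} G"
proof
  fix c assume x: "x \<in> carrier G" and "c \<in> {c\<in>carrier G. cj c x = x}"
  then show "inv c \<in> {c\<in>carrier G. cj c x = x}" using cj_inv_eq[of c x x] by simp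
qed (auto simp: cj_cj[symmetric])

text \<open>If conjugation induces an abelian group on the orbit of \<open>x\<close>, then \<open>G'\<close> centralises \<open>x\<close>.\<close>

lemma comms_centralize:
  assumes x: "x \<in> carrier G"
    and eq: "\<And>a b. a \<in> carrier G \<Longrightarrow> b \<in> carrier G \<Longrightarrow> cj (a \<otimes> b) x = cj (b \<otimes> a) x"
    and c: "c \<in> comms"
  shows "cj c x = x"
proof -
  have "comms \<subseteq> {c\<in>carrier G. cj c x = x}"
  proof (rule comms_subset[OF centralizer_subgroup[OF x]])
    fix a b assume ab: "a \<in> carrier G" "b \<in> carrier G"
    have "cj ((a \<otimes> b) \<otimes> inv (b \<otimes> a)) x = cj (inv (b \<otimes> a)) (cj (a \<otimes> b) x)" using ab x by (simp only: cj_cj m_closed inv_closed)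
    also have "\<dots> = cj (inv (b \<otimes> a)) (cj (b \<otimes> a) x)" using eq ab by simp
    also have "\<dots> = x" using ab x by (simp only: cj_cj m_closed inv_closed r_inv cj_one)
    finally show "(a \<otimes> b) \<otimes> inv (b \<otimes> a) \<in> {c\<in>carrier G. cj c x = x}" using ab by simp
  qed
  then show ?thesis using c by blast
qed

lemma cyc_nat: "finite (carrier G) \<Longrightarrow> x \<in> carrier G \<Longrightarrow> z \<in> cyc x \<longleftrightarrow> (\<exists>n::nat. z = x [^] n)"
  by (auto simp: generate_pow_on_finite_carrier)

text \<open>Conjugation acts on a normal cyclic subgroup by power maps, and power maps commute with
  each other.\<close>

lemma comms_centralize_cyc_normal:
  assumes fin: "finite (carrier G)" and x: "x \<in> carrier G"
    and norm: "\<And>a. a \<in> carrier G \<Longrightarrow> cj a x \<in> cyc x" and c: "c \<in> comms"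
  shows "cj c x = x"
proof (rule comms_centralize[OF x _ c])
  fix a b assume ab: "a \<in> carrier G" "b \<in> carrier G"
  obtain i j :: nat where i: "cj a x = x [^] i" and j: "cj b x = x [^] j"
    using norm[OF ab(1)] norm[OF ab(2)] cyc_nat[OF fin x] by auto
  have "cj (a \<otimes> b) x = x [^] (j * i)"
    using ab x i j cj_cj[of b a x] by (simp add: cj_pow nat_pow_pow)
  moreover have "cj (b \<otimes> a) x = x [^] (i * j)"
    using ab x i j cj_cj[of a b x] by (simp add: cj_pow nat_pow_pow)
  ultimately show "cj (a \<otimes> b) x = cj (b \<otimes> a) x" by (simp add: mult.commute)
qed

lemma generate_commute:
  assumes S: "S \<subseteq> carrier G" and comm: "\<And>s t. s \<in> S \<Longrightarrow> t \<in> S \<Longrightarrow> s \<otimes> t = t \<otimes> s"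
    and "a \<in> generate G S" "b \<in> generate G S"
  shows "a \<otimes> b = b \<otimes> a"
proof -
  have sub: "generate G S \<subseteq> {c\<in>carrier G. cj c s = s}" if "s \<in> carrier G" "\<And>t. t \<in> S \<Longrightarrow> s \<otimes> t = t \<otimes> s" for s
    using that S by (intro generate_subgroup_incl centralizer_subgroup) (auto simp: cj_eq_self_iff)
  have gc: "z \<in> carrier G" if "z \<in> generate G S" for z using that generate_in_carrier[OF S] by blast
  have "s \<otimes> b = b \<otimes> s" if "s \<in> S" for s
    using sub[of s] that comm S assms(4) by (auto simp: cj_eq_self_iff subsetD)
  then have "b \<otimes> a = a \<otimes> b"
    using sub[of b] gc assms(3,4) by (fastforce simp: cj_eq_self_iff)
  then show ?thesis by simp
qed

text \<open>G/A is abelian if its generators commute, phrased without quotients. By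
  \<open>[ac, b] = (a [c, b] a^(-1)) [a, b]\<close> the elements commuting with b modulo A form a
  subgroup; this is applied first to generators b and then to arbitrary b.\<close>

lemma comms_subset_of_commuting_generators:
  assumes A: "subgroup A G" "nrm A = carrier G" and S: "S \<subseteq> carrier G" "generate G S = carrier G"
    and comm: "\<And>s t. s \<in> S \<Longrightarrow> t \<in> S \<Longrightarrow> (s \<otimes> t) \<otimes> inv (t \<otimes> s) \<in> A"
  shows "comms \<subseteq> A"
proof -
  interpret subgroup A G by fact
  have nA: "cj a k \<in> A" if "a \<in> carrier G" "k \<in> A" for a k
    using A(2) that nrm_iff[of a A] by simp
  have nA': "a \<otimes> k \<otimes> inv a \<in> A" if "a \<in> carrier G" "k \<in> A" for a k
    using nA[of "inv a" k] that by (simp add: cj_def)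
  let ?Z = "\<lambda>b. {a\<in>carrier G. (a \<otimes> b) \<otimes> inv (b \<otimes> a) \<in> A}"
  have sg: "subgroup (?Z b) G" if b: "b \<in> carrier G" for b
  proof
    fix a c assume a: "a \<in> ?Z b"
    { assume c: "c \<in> ?Z b"
      have "(a \<otimes> c \<otimes> b) \<otimes> inv (b \<otimes> (a \<otimes> c)) = (a \<otimes> (c \<otimes> b \<otimes> inv (b \<otimes> c)) \<otimes> inv a) \<otimes> (a \<otimes> b \<otimes> inv (b \<otimes> a))"
        using a b c by (simp add: group_word_simps)
      also have "\<dots> \<in> A" using a c nA' by blast
      finally show "a \<otimes> c \<in> ?Z b" using a c by simp }
    have "(inv a \<otimes> b) \<otimes> inv (b \<otimes> inv a) = cj a (inv (a \<otimes> b \<otimes> inv (b \<otimes> a)))"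
      using a b by (simp add: cj_def group_word_simps)
    also have "\<dots> \<in> A" using a by (intro nA) auto
    finally show "inv a \<in> ?Z b" using a by simp
  qed (use b in auto)
  have sym: "(b \<otimes> a) \<otimes> inv (a \<otimes> b) \<in> A" if "a \<in> carrier G" "b \<in> carrier G" "(a \<otimes> b) \<otimes> inv (b \<otimes> a) \<in> A" for a b
    using m_inv_closed[OF that(3)] that(1,2) by (simp add: group_word_simps)
  have "carrier G \<subseteq> ?Z s" if "s \<in> S" for s
  proof -
    have "generate G S \<subseteq> ?Z s"
      using that S(1) comm by (intro generate_subgroup_incl[OF _ sg]) auto
    then show ?thesis using S by simp
  qed
  then have *: "(a \<otimes> s) \<otimes> inv (s \<otimes> a) \<in> A" if "a \<in> carrier G" "s \<in> S" for a s
    using that by blast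
  have "carrier G \<subseteq> ?Z b" if b: "b \<in> carrier G" for b
  proof -
    have "generate G S \<subseteq> ?Z b"
      using S(1) sym *[OF b] b by (intro generate_subgroup_incl[OF _ sg]) auto
    then show ?thesis using S by simp
  qed
  then show ?thesis using comms_subset[OF A(1)] by blast
qed

text \<open>A group with fewer than five elements is abelian: if a and b do not commute modulo A,
  then 1, a, b, ab and ba represent five different cosets.\<close>

lemma comms_subset_of_small_index:
  assumes fin: "finite (carrier G)" and A: "subgroup A G" "nrm A = carrier G" and small: "order G < 5 * card A"
  shows "comms \<subseteq> A"
proof (rule comms_subset[OF A(1)], rule ccontr)
  fix a b assume ab: "a \<in> carrier G" "b \<in> carrier G" and n: "a \<otimes> b \<otimes> inv (b \<otimes> a) \<notin> A"
  interpret subgroup A G by fact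
  have nA: "a \<otimes> k \<otimes> inv a \<in> A" if "a \<in> carrier G" "k \<in> A" for a k
    using A(2) that nrm_iff[of "inv a" A] by (simp add: cj_def)
  have neq: "A #> u \<noteq> A #> v" if "u \<in> carrier G" "v \<in> carrier G" "v \<otimes> inv u \<notin> A" for u v
    using r_coset_eq_iff[OF A(1)] that by blast
  have a: "a \<notin> A"
  proof
    assume "a \<in> A"
    then have "a \<otimes> (b \<otimes> inv a \<otimes> inv b) \<in> A" using nA[OF ab(2), of "inv a"] by simp
    then show False using n ab by (simp add: group_word_simps)
  qed
  have b: "b \<notin> A"
  proof
    assume "b \<in> A"
    then have "(a \<otimes> b \<otimes> inv a) \<otimes> inv b \<in> A" using nA[OF ab(1), of "b"] by simp
    then show False using n ab by (simp add: group_word_simps)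
  qed
  have c: "a \<otimes> inv b \<notin> A"
  proof
    assume h: "a \<otimes> inv b \<in> A"
    have "a \<otimes> b \<otimes> inv (b \<otimes> a) = (a \<otimes> inv b) \<otimes> (b \<otimes> inv (a \<otimes> inv b) \<otimes> inv b)"
      using ab by (simp add: group_word_simps)
    also have "\<dots> \<in> A" by (rule m_closed[OF h nA[OF ab(2) m_inv_closed[OF h]]])
    finally show False using n by simp
  qed
  have d: "a \<otimes> b \<notin> A"
  proof
    assume h: "a \<otimes> b \<in> A"
    have "a \<otimes> b \<otimes> inv (b \<otimes> a) = (a \<otimes> b) \<otimes> (b \<otimes> inv (a \<otimes> b) \<otimes> inv b)"
      using ab by (simp add: group_word_simps)
    also have "\<dots> \<in> A" by (rule m_closed[OF h nA[OF ab(2) m_inv_closed[OF h]]])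
    finally show False using n by simp
  qed
  have e: "b \<otimes> a \<notin> A"
  proof
    assume h: "b \<otimes> a \<in> A"
    have "a \<otimes> b \<otimes> inv (b \<otimes> a) = (a \<otimes> (b \<otimes> a) \<otimes> inv a) \<otimes> inv (b \<otimes> a)"
      using ab by (simp add: group_word_simps)
    also have "\<dots> \<in> A" by (rule m_closed[OF nA[OF ab(1) h] m_inv_closed[OF h]])
    finally show False using n by simp
  qed
  have "distinct [A #> \<one>, A #> a, A #> b, A #> (a \<otimes> b), A #> (b \<otimes> a)]"
  proof -
    have "A #> \<one> \<noteq> A #> a" "A #> \<one> \<noteq> A #> b" "A #> \<one> \<noteq> A #> (a \<otimes> b)" "A #> \<one> \<noteq> A #> (b \<otimes> a)"
      using a b d e ab by (simp_all add: neq)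
    moreover have "A #> b \<noteq> A #> a" using c ab by (simp_all add: neq)
    moreover have "A #> a \<noteq> A #> (b \<otimes> a)" "A #> b \<noteq> A #> (a \<otimes> b)"
      using a b ab by (simp_all add: neq group_word_simps)
    moreover have "A #> b \<noteq> A #> (b \<otimes> a)" "A #> a \<noteq> A #> (a \<otimes> b)"
    proof -
      have "b \<otimes> a \<otimes> inv b \<notin> A" using a nA[of "inv b" "b \<otimes> a \<otimes> inv b"] ab by (auto simp: group_word_simps)
      moreover have "a \<otimes> b \<otimes> inv a \<notin> A" using b nA[of "inv a" "a \<otimes> b \<otimes> inv a"] ab by (auto simp: group_word_simps)
      ultimately show "A #> b \<noteq> A #> (b \<otimes> a)" "A #> a \<noteq> A #> (a \<otimes> b)" using ab by (simp_all add: neq)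
    qed
    moreover have "A #> (b \<otimes> a) \<noteq> A #> (a \<otimes> b)" using n ab by (simp_all add: neq)
    ultimately show ?thesis by auto
  qed
  then have "card (set [A #> \<one>, A #> a, A #> b, A #> (a \<otimes> b), A #> (b \<otimes> a)]) = 5"
    by (subst distinct_card) auto
  moreover have "set [A #> \<one>, A #> a, A #> b, A #> (a \<otimes> b), A #> (b \<otimes> a)] \<subseteq> rcosets A"
    using ab by (auto simp: RCOSETS_def)
  moreover have "finite (rcosets A)" using fin by (simp add: RCOSETS_def)
  ultimately have "5 \<le> card (rcosets A)" using card_mono by metis
  then have "5 * card A \<le> card (rcosets A) * card A" by simp
  then show False using small lagrange[OF A(1)] by simp
qed

section \<open>Subgroups with few double cosets\<close>

lemma index_two_mult:
  assumes fin: "finite (carrier G)" and N: "subgroup N G" "order G = 2 * card N"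
    and a: "a \<in> carrier G" "a \<notin> N" and b: "b \<in> carrier G" "b \<notin> N"
  shows "a \<otimes> b \<in> N"
proof (rule ccontr)
  assume n: "a \<otimes> b \<notin> N"
  have bi: "inv b \<notin> N" using b N(1) by (metis inv_inv subgroup.m_inv_closed)
  have "N #> inv b \<noteq> N #> a" using r_coset_eq_iff[OF N(1), of "inv b" a] a b n by simp
  moreover have "N #> \<one> \<noteq> N #> a" using r_coset_eq_iff[OF N(1), of \<one> a] a by simp
  moreover have "N #> \<one> \<noteq> N #> inv b" using r_coset_eq_iff[OF N(1), of \<one> "inv b"] b bi by simp
  ultimately have "card {N #> \<one>, N #> a, N #> inv b} = 3" by simp
  moreover have "{N #> \<one>, N #> a, N #> inv b} \<subseteq> rcosets N" using a b by (auto simp: RCOSETS_def)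
  moreover have "finite (rcosets N)" using fin by (simp add: RCOSETS_def)
  ultimately have "3 \<le> card (rcosets N)" using card_mono by metis
  moreover have "card (rcosets N) * card N = 2 * card N" using lagrange[OF N(1)] N(2) by simp
  moreover have "card N > 0" using card_subgroup_pos[OF N(1) fin] .
  ultimately show False by simp
qed

text \<open>Put \<open>y = x\<^sup>g\<close> and \<open>K = \<langle>x\<rangle> \<inter> \<langle>y\<rangle>\<close>. The hypotheses give \<open>N = \<langle>y\<rangle>\<langle>x\<rangle>\<close>, so \<open>N/K\<close> is abelian and
  \<open>g\<close> swaps \<open>x\<close> and \<open>y\<close> modulo \<open>K\<close>. Hence \<open>G'\<close> lies in \<open>\<langle>x\<^sup>-\<^sup>1y\<rangle>K\<close>, where \<open>K\<close> is central in \<open>N\<close>.\<close>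

lemma comms_commute_of_index_two_double_coset:
  assumes fin: "finite (carrier G)" and x: "x \<in> carrier G" and g: "g \<in> carrier G"
    and ind: "order G = 2 * card (nrm (cyc x))"
    and dc: "carrier G - nrm (cyc x) = double_coset (cyc x) g"
    and c: "c \<in> comms" and d: "d \<in> comms"
  shows "c \<otimes> d = d \<otimes> c"
proof -
  define N where "N = nrm (cyc x)"
  define y where "y = cj g x"
  define w where "w = inv x \<otimes> y"
  define K where "K = cyc x \<inter> cyc y"
  define A where "A = generate G (insert w K)"
  have y: "y \<in> carrier G" and w: "w \<in> carrier G" using x g by (simp_all add: y_def w_def)
  interpret Hx: subgroup "cyc x" G by (rule cyc_subgroup[OF x])
  interpret Hy: subgroup "cyc y" G by (rule cyc_subgroup[OF y])
  have Nsg: "subgroup N G" unfolding N_def by (rule nrm_subgroup[OF fin Hx.subset])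
  interpret N: subgroup N G by fact
  have gN: "g \<notin> N" using dc double_coset_self[OF cyc_subgroup[OF x] g] by (auto simp: N_def)
  have two: "a \<otimes> b \<in> N" if "a \<in> carrier G" "a \<notin> N" "b \<in> carrier G" "b \<notin> N" for a b
    using index_two_mult[OF fin Nsg] ind that by (simp add: N_def)
  have xN: "x \<in> N" unfolding N_def using nrm_cyc_iff[OF x, of x] x by (simp add: cj_def m_assoc[symmetric] cyc_self)
  have giN: "inv g \<notin> N" using gN N.m_inv_closed[of "inv g"] g by auto
  have Nnorm: "g \<otimes> n \<otimes> inv g \<in> N" if n: "n \<in> N" for n
  proof -
    have "g \<otimes> n \<notin> N"
    proof
      assume "g \<otimes> n \<in> N"
      then have "(g \<otimes> n) \<otimes> inv n \<in> N" using n N.m_inv_closed N.m_closed by blast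
      then show False using gN n g by (simp add: group_word_simps)
    qed
    then show ?thesis using two[of "g \<otimes> n" "inv g"] n g giN by simp
  qed
  have Nx: "cj n x \<in> cyc x" if "n \<in> N" for n using that nrm_cyc_iff[OF x] by (simp add: N_def)
  have cjg: "cj g z \<in> cyc y" if z: "z \<in> cyc x" for z
  proof -
    have "cyc x \<subseteq> {z\<in>carrier G. cj g z \<in> cyc y}"
      by (rule cyc_subset[OF _ cj_subgroup_preimage[OF cyc_subgroup[OF y] g]])
        (use x cyc_self[of y] in \<open>simp add: y_def\<close>)
    then show ?thesis using z by blast
  qed
  have Ny: "cj n y \<in> cyc y" if n: "n \<in> N" for n
  proof -
    have "cj n y = cj g (cj (g \<otimes> n \<otimes> inv g) x)"
      using n g x by (simp add: y_def cj_cj) (simp add: group_word_simps)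
    then show ?thesis using cjg Nx Nnorm[OF n] by simp
  qed
  have yN: "y \<in> N"
  proof -
    have "inv g \<otimes> x \<notin> N"
    proof
      assume "inv g \<otimes> x \<in> N"
      then have "(inv g \<otimes> x) \<otimes> inv x \<in> N" using xN N.m_inv_closed N.m_closed by blast
      then show False using giN x g by (simp add: group_word_simps)
    qed
    then show ?thesis using two[of "inv g \<otimes> x" g] x g gN by (simp add: y_def cj_def)
  qed
  \<comment> \<open>N normalises both <x> and <y>, so a commutator of elements of the two lies in
    each of them.\<close>
  have comK: "inv a \<otimes> inv b \<otimes> a \<otimes> b \<in> K" if a: "a \<in> cyc x" and b: "b \<in> cyc y" for a b
  proof -
    have ac: "a \<in> carrier G" and bc: "b \<in> carrier G" using a b by auto
    have bN: "b \<in> N" using cyc_subset[OF yN Nsg] b by blast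
    have aN: "a \<in> N" using cyc_subset[OF xN Nsg] a by blast
    have "cj b a \<in> cyc x" using bN a unfolding N_def nrm_iff by blast
    then have "inv a \<otimes> cj b a \<in> cyc x" using a by blast
    moreover have "a \<in> nrm (cyc y)" using Ny[OF aN] nrm_cyc_iff[OF y] ac by blast
    then have "cj a (inv b) \<in> cyc y" using b unfolding nrm_iff by blast
    then have "cj a (inv b) \<otimes> b \<in> cyc y" using b by blast
    ultimately show ?thesis using ac bc by (simp add: K_def cj_def group_word_simps)
  qed
  have Kx: "k \<otimes> x = x \<otimes> k" if "k \<in> K" for k
    using that cyc_commute[OF x _ cyc_self] by (simp add: K_def)
  have Ky: "k \<otimes> y = y \<otimes> k" if "k \<in> K" for k
    using that cyc_commute[OF y _ cyc_self] by (simp add: K_def)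
  have Kc: "k \<in> carrier G" if "k \<in> K" for k using that by (auto simp: K_def)
  have Kw: "k \<otimes> w = w \<otimes> k" if k: "k \<in> K" for k
  proof -
    have "k \<otimes> inv x = inv x \<otimes> k" using Kx[OF k] Kc[OF k] x by (metis inv_closed inv_solve_left' inv_solve_right' m_closed m_assoc)
    then show ?thesis using Ky[OF k] Kc[OF k] x y unfolding w_def by (metis inv_closed m_assoc)
  qed
  have KK: "k \<otimes> l = l \<otimes> k" if "k \<in> K" "l \<in> K" for k l
    using that cyc_commute[OF x] by (auto simp: K_def)
  \<comment> \<open>As g n lies outside N, it lies in the single double coset \<open>HgH\<close>.
    Cancelling g writes n as an element of <y> times an element of <x>.\<close>
  have N_form: "\<exists>a\<in>cyc x. \<exists>b\<in>cyc y. n = b \<otimes> a" if n: "n \<in> N" for n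
  proof -
    have "g \<otimes> n \<notin> N"
    proof
      assume "g \<otimes> n \<in> N"
      then have "(g \<otimes> n) \<otimes> inv n \<in> N" using n N.m_inv_closed N.m_closed by blast
      then show False using gN n g by (simp add: group_word_simps)
    qed
    then have "g \<otimes> n \<in> double_coset (cyc x) g"
      unfolding dc[symmetric] N_def[symmetric] using n g by simp
    then obtain h h' where h: "h \<in> cyc x" "h' \<in> cyc x" "g \<otimes> n = h \<otimes> g \<otimes> h'"
      by (auto simp: double_coset_def)
    then have "n = inv g \<otimes> (h \<otimes> g \<otimes> h')" using n g inv_mult_cancel[of g n] by simp
    also have "\<dots> = cj g h \<otimes> h'" using h g by (simp add: cj_def group_word_simps)
    finally show ?thesis using cjg h by blast
  qed
  \<comment> \<open>Write n = b a. Conjugation by b changes x by a commutator in K, and a fixes both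
    x and that commutator because all three lie in <x>.\<close>
  have Nx_mod: "\<exists>k\<in>K. cj n x = x \<otimes> k" if n: "n \<in> N" for n
  proof -
    obtain a b where ab: "a \<in> cyc x" "b \<in> cyc y" "n = b \<otimes> a" using N_form[OF n] by blast
    let ?k = "inv x \<otimes> inv b \<otimes> x \<otimes> b"
    have k: "?k \<in> K" using comK[OF cyc_self ab(2)] .
    then have "?k \<otimes> a = a \<otimes> ?k" using cyc_commute[OF x _ ab(1)] by (simp add: K_def)
    then have "cj a ?k = ?k" using cj_eq_self_iff[of a ?k] ab Kc[OF k] by auto
    have "cj n x = cj a (x \<otimes> ?k)" using ab x y by (simp add: cj_def group_word_simps)
    also have "\<dots> = cj a x \<otimes> cj a ?k" using ab x Kc[OF k] by (simp add: cj_mult)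
    also have "cj a x = x" using cyc_commute[OF x cyc_self ab(1)] ab x cj_eq_self_iff[of a x] by auto
    finally show ?thesis using k \<open>cj a ?k = ?k\<close> by auto
  qed
  have KA: "k \<in> A" if "k \<in> K" for k using that by (simp add: A_def generate.incl)
  have wA: "w \<in> A" by (simp add: A_def generate.incl)
  have SA: "insert w K \<subseteq> carrier G" using w Kc by blast
  have Asg: "subgroup A G" unfolding A_def by (rule generate_is_subgroup[OF SA])
  interpret A: subgroup A G by fact
  \<comment> \<open>Conjugating y by g conjugates x by \<open>g \<otimes> g\<close>, an element of
    N, so the result is x modulo K.\<close>
  have g2: "g \<otimes> g \<in> N" using two g gN by simp
  have cjgy: "\<exists>k\<in>K. cj g y = x \<otimes> k" using Nx_mod[OF g2] g x by (simp add: y_def cj_cj)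
  have xA: "x \<in> nrm A"
    unfolding A_def
  proof (rule nrm_generate[OF SA x], fold A_def)
    fix s assume s: "s \<in> insert w K"
    show "cj x s \<in> A"
    proof (cases "s = w")
      case True
      have "cj x w = w \<otimes> inv (inv x \<otimes> inv y \<otimes> x \<otimes> y)"
        using x y by (simp add: cj_def w_def group_word_simps)
      then show ?thesis using KA[OF comK[OF cyc_self cyc_self]] wA True by simp
    next
      case False
      then have "s \<in> K" using s by simp
      then have "cj x s = s" using Kx x Kc cj_eq_self_iff[of x s] by simp
      then show ?thesis using KA \<open>s \<in> K\<close> by simp
    qed
  qed
  have gA: "g \<in> nrm A"
    unfolding A_def
  proof (rule nrm_generate[OF SA g], fold A_def)
    fix s assume s: "s \<in> insert w K"
    obtain k where k: "k \<in> K" "cj g y = x \<otimes> k" using cjgy by blast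
    show "cj g s \<in> A"
    proof (cases "s = w")
      case True
      have "cj g w = inv y \<otimes> (x \<otimes> k)" using x y g k by (simp add: w_def cj_mult cj_inv y_def[symmetric])
      also have "\<dots> = inv w \<otimes> k" using x y Kc[OF k(1)] by (simp add: w_def group_word_simps)
      finally show ?thesis using wA KA[OF k(1)] True by simp
    next
      case False
      then have sK: "s \<in> K" using s by simp
      have "cj g s \<in> cyc y" using sK cjg by (simp add: K_def)
      moreover have "cj g s \<in> cyc x"
      proof -
        have "cyc y \<subseteq> {z\<in>carrier G. cj g z \<in> cyc x}"
        proof (rule cyc_subset)
          have "cj g y \<in> cyc x" using k cyc_self[of x] by (auto simp: K_def)
          then show "y \<in> {z\<in>carrier G. cj g z \<in> cyc x}" using y by simp
        qed (rule cj_subgroup_preimage[OF cyc_subgroup[OF x] g])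
        then show ?thesis using sK by (auto simp: K_def)
      qed
      ultimately show ?thesis using KA by (simp add: K_def)
    qed
  qed
  \<comment> \<open>N is the product of <y> and <x>, and its complement is the double coset of g; so
    the commutator condition needs checking only for x and g.\<close>
  have gen: "generate G {x, g} = carrier G"
  proof
    show "generate G {x, g} \<subseteq> carrier G" using x g by (intro generate_incl) auto
    interpret B: subgroup "generate G {x, g}" G using x g by (intro generate_is_subgroup) auto
    have xB: "x \<in> generate G {x,g}" and gB: "g \<in> generate G {x,g}" by (auto intro: generate.incl)
    have "cyc x \<subseteq> generate G {x,g}" by (rule cyc_subset[OF xB B.subgroup_axioms])
    moreover have "y \<in> generate G {x,g}" using xB gB by (simp add: y_def cj_def)
    then have "cyc y \<subseteq> generate G {x,g}" by (rule cyc_subset[OF _ B.subgroup_axioms])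
    ultimately have "N \<subseteq> generate G {x,g}" using N_form by blast
    moreover have "carrier G - N \<subseteq> generate G {x,g}"
      using dc \<open>cyc x \<subseteq> generate G {x,g}\<close> gB unfolding N_def dc
      by (auto simp: double_coset_def intro!: B.m_closed)
    ultimately show "carrier G \<subseteq> generate G {x,g}" by blast
  qed
  have nA: "nrm A = carrier G"
  proof
    have "generate G {x, g} \<subseteq> nrm A"
      using xA gA by (intro generate_subgroup_incl nrm_subgroup[OF fin A.subset]) auto
    then show "carrier G \<subseteq> nrm A" using gen by simp
  qed (auto simp: nrm_def)
  have xg: "(x \<otimes> g) \<otimes> inv (g \<otimes> x) \<in> A"
  proof -
    have "(x \<otimes> g) \<otimes> inv (g \<otimes> x) = cj (inv (g \<otimes> x)) w"
      unfolding w_def y_def cj_def using x g by (simp add: group_word_simps)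
    moreover have "inv (g \<otimes> x) \<in> nrm A" using nA x g by simp
    ultimately show ?thesis using wA by (simp add: nrm_iff)
  qed
  have "comms \<subseteq> A"
  proof (rule comms_subset_of_commuting_generators[OF Asg nA _ gen])
    have "(g \<otimes> x) \<otimes> inv (x \<otimes> g) = inv ((x \<otimes> g) \<otimes> inv (g \<otimes> x))" using x g by (simp add: group_word_simps)
    then have gx: "(g \<otimes> x) \<otimes> inv (x \<otimes> g) \<in> A" using xg by simp
    fix s t assume "s \<in> {x, g}" "t \<in> {x, g}"
    then show "(s \<otimes> t) \<otimes> inv (t \<otimes> s) \<in> A" using xg gx x g by auto
  qed (use x g in auto)
  then have cd: "c \<in> generate G (insert w K)" "d \<in> generate G (insert w K)"
    using c d unfolding A_def by auto
  have st: "s \<otimes> t = t \<otimes> s" if "s \<in> insert w K" "t \<in> insert w K" for s t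
    using that Kw[of s] Kw[of t] KK[of s t] by (elim insertE) simp_all
  show ?thesis using generate_commute[OF SA st cd] .
qed

lemma odd_pow_generates:
  assumes w: "w \<in> carrier G" and o: "ord w = 2 ^ f" and j: "odd (j::nat)"
  shows "w \<in> cyc (w [^] j)"
proof -
  have "coprime (int j) (int (2 ^ f))" using j by simp
  then obtain s t where st: "s * int j + t * int (2 ^ f) = 1" by (metis coprime_iff_gcd_eq_1 bezout_int)
  have "w = w [^] (s * int j + t * int (2 ^ f))" using w st by simp
  also have "\<dots> = w [^] (int j * s) \<otimes> w [^] (int (2 ^ f) * t)" using w by (simp add: int_pow_mult mult.commute)
  also have "w [^] (int (2 ^ f) * t) = \<one>"
    using w o pow_ord_eq_1[OF w] int_pow_pow[OF w, of "int (2^f)" t] by (metis int_pow_int int_pow_one)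
  also have "w [^] (int j * s) = (w [^] j) [^] s" using int_pow_pow[OF w, of "int j" s] by (simp add: int_pow_int)
  finally have "w = (w [^] j) [^] s" using w by simp
  then show ?thesis using generate_pow[of "w [^] j"] w by blast
qed

text \<open>The group \<open>\<langle>u, w\<rangle>\<close> is abelian, and either \<open>\<langle>u\<rangle>\<close> contains \<open>w\<close> or some \<open>t \<in> u\<langle>w\<rangle>\<close> has \<open>t\<^sup>2 = 1\<close>;
  in both cases the automorphisms induced by \<open>G\<close> commute with each other.\<close>

lemma comms_centralize_of_coset_invariant:
  assumes fin: "finite (carrier G)" and w: "w \<in> carrier G" and u: "u \<in> carrier G"
    and o: "ord w = 2 ^ f" and wn: "\<And>a. a \<in> carrier G \<Longrightarrow> cj a w \<in> cyc w"
    and comm: "u \<otimes> w = w \<otimes> u" and sq: "u \<otimes> u \<in> cyc w"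
    and un: "\<And>a. a \<in> carrier G \<Longrightarrow> \<exists>k\<in>cyc w. cj a u = u \<otimes> k"
    and c: "c \<in> comms"
  shows "cj c u = u"
proof -
  interpret K: subgroup "cyc w" G by (rule cyc_subgroup[OF w])
  obtain j :: nat where j: "u \<otimes> u = w [^] j" using sq cyc_nat[OF fin w] by blast
  show ?thesis
  proof (cases "odd j")
    case True
    interpret U: subgroup "cyc u" G by (rule cyc_subgroup[OF u])
    \<comment> \<open>The odd power \<open>w [^] j\<close>, being the square of u, generates <w> and
      lies in <u>. Thus <u> contains <w> and is normal.\<close>
    have "w [^] j \<in> cyc u" using cyc_self[of u] j[symmetric] by simp
    then have "cyc (w [^] j) \<subseteq> cyc u" by (rule cyc_subset[OF _ U.subgroup_axioms])
    then have "w \<in> cyc u" using odd_pow_generates[OF w o True] by blast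
    then have wu: "cyc w \<subseteq> cyc u" by (rule cyc_subset[OF _ U.subgroup_axioms])
    show ?thesis
    proof (rule comms_centralize_cyc_normal[OF fin u _ c])
      fix a assume "a \<in> carrier G"
      then obtain k where "k \<in> cyc w" "cj a u = u \<otimes> k" using un by blast
      then show "cj a u \<in> cyc u" using wu cyc_self[of u] by auto
    qed
  next
    case False
    then obtain i where i: "j = i + i" by (metis evenE mult_2)
    \<comment> \<open>Halving the exponent gives a square root v of \<open>u \<otimes> u\<close>
      inside <w>, so \<open>t = u \<otimes> inv v\<close> squares to 1.\<close>
    define v where "v = w [^] i"
    have v: "v \<in> cyc w" "v \<in> carrier G" using w K.subgroup_axioms cyc_nat[OF fin w] by (auto simp: v_def)
    have ucomm: "u \<otimes> k = k \<otimes> u" if "k \<in> cyc w" for k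
    proof -
      have "cyc w \<subseteq> {c\<in>carrier G. cj c u = u}"
        using comm u w by (intro cyc_subset centralizer_subgroup) (auto simp: cj_eq_self_iff)
      then show ?thesis using that u cj_eq_self_iff[of k u] by auto
    qed
    define t where "t = u \<otimes> inv v"
    have t: "t \<in> carrier G" using u v by (simp add: t_def)
    have uu: "u \<otimes> u = v \<otimes> v" using j i w by (simp add: v_def nat_pow_mult)
    have "t \<otimes> t = (u \<otimes> inv v) \<otimes> (inv v \<otimes> u)" using ucomm[of "inv v"] v by (simp add: t_def)
    also have "\<dots> = u \<otimes> (inv v \<otimes> inv v) \<otimes> u" using u v by (simp add: group_word_simps)
    also have "\<dots> = (inv v \<otimes> inv v) \<otimes> (u \<otimes> u)" using ucomm[of "inv v \<otimes> inv v"] u v by (simp add: m_assoc)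
    also have "\<dots> = \<one>" unfolding uu using v by (simp add: group_word_simps)
    finally have tt: "t \<otimes> t = \<one>" .
    have tcomm: "t \<otimes> k = k \<otimes> t" if k: "k \<in> cyc w" for k
    proof -
      have "t \<otimes> k = u \<otimes> (inv v \<otimes> k)" using u v k by (simp add: t_def m_assoc)
      also have "inv v \<otimes> k = k \<otimes> inv v" using cyc_commute[OF w, of "inv v" k] v k by simp
      also have "u \<otimes> (k \<otimes> inv v) = (u \<otimes> k) \<otimes> inv v" using u v k by (simp add: m_assoc)
      also have "\<dots> = k \<otimes> t" using ucomm[OF k] u v k by (simp add: t_def m_assoc)
      finally show ?thesis .
    qed
    have wn': "cj a k \<in> cyc w" if "a \<in> carrier G" "k \<in> cyc w" for a k
      using nrm_cyc_iff[OF w, of a] wn[of a] that by (auto simp: nrm_iff)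
    have tk: "\<exists>k\<in>cyc w. cj a t = t \<otimes> k \<and> k \<otimes> k = \<one>" if a: "a \<in> carrier G" for a
    proof -
      obtain k where k: "k \<in> cyc w" "cj a u = u \<otimes> k" using un[OF a] by blast
      define l where "l = k \<otimes> cj a (inv v) \<otimes> v"
      have lw: "l \<in> cyc w" using k v wn'[OF a] by (simp add: l_def)
      have "cj a t = u \<otimes> k \<otimes> cj a (inv v)" using a u v k by (simp add: t_def cj_mult)
      also have "\<dots> = u \<otimes> (k \<otimes> cj a (inv v) \<otimes> v) \<otimes> inv v" using a u v k wn'[OF a, of "inv v"]
        by (simp add: group_word_simps)
      also have "\<dots> = u \<otimes> (inv v \<otimes> l)" using cyc_commute[OF w lw, of "inv v"] v u lw by (simp add: m_assoc l_def[symmetric])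
      finally have e: "cj a t = t \<otimes> l" using u v lw by (simp add: t_def m_assoc)
      have "\<one> = cj a (t \<otimes> t)" using tt a by simp
      also have "\<dots> = (t \<otimes> l) \<otimes> (t \<otimes> l)" using a t e by (simp add: cj_mult)
      also have "\<dots> = t \<otimes> (l \<otimes> t) \<otimes> l" using t lw by (simp add: m_assoc)
      also have "\<dots> = (t \<otimes> t) \<otimes> (l \<otimes> l)" using t lw tcomm[OF lw, symmetric] by (simp add: m_assoc)
      finally have "l \<otimes> l = \<one>" using tt lw by simp
      then show ?thesis using e lw by blast
    qed
    \<comment> \<open>Conjugation by b raises k to some power, which is 1 or k, and it cannot send a
      nontrivial element to 1. Hence the factors by which conjugation changes t are themselves
      fixed, and the action on t is abelian.\<close>
    have kfix: "cj b k = k" if b: "b \<in> carrier G" and k: "k \<in> cyc w" "k \<otimes> k = \<one>" for b k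
    proof -
      obtain m :: nat where m: "k = w [^] m" using k cyc_nat[OF fin w] by blast
      obtain s :: nat where s: "cj b w = w [^] s" using wn[OF b] cyc_nat[OF fin w] by blast
      have "cj b k = k [^] s" using m s b w by (simp add: cj_pow nat_pow_pow mult.commute)
      moreover have "k [^] s = \<one> \<or> k [^] s = k"
        using k by (induction s) auto
      moreover have "k = \<one>" if "cj b k = \<one>" using cj_inj[OF b, of k \<one>] that k b by simp
      ultimately show ?thesis using b by auto
    qed
    have "cj c t = t"
    proof (rule comms_centralize[OF t _ c])
      fix a b assume ab: "a \<in> carrier G" "b \<in> carrier G"
      obtain k where k: "k \<in> cyc w" "cj a t = t \<otimes> k" "k \<otimes> k = \<one>" using tk[OF ab(1)] by blast
      obtain l where l: "l \<in> cyc w" "cj b t = t \<otimes> l" "l \<otimes> l = \<one>" using tk[OF ab(2)] by blast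
      have "cj (a \<otimes> b) t = t \<otimes> l \<otimes> k"
        using ab t k l kfix[OF ab(2) k(1,3)] by (simp add: cj_cj[symmetric] cj_mult)
      moreover have "cj (b \<otimes> a) t = t \<otimes> k \<otimes> l"
        using ab t k l kfix[OF ab(1) l(1,3)] by (simp add: cj_cj[symmetric] cj_mult)
      ultimately show "cj (a \<otimes> b) t = cj (b \<otimes> a) t" using cyc_commute[OF w k(1) l(1)] t k l by (simp add: m_assoc)
    qed
    moreover have "cj c v = v"
      unfolding v_def using comms_centralize_cyc_normal[OF fin w wn c] comms_carrier[OF c] w by (simp add: cj_pow)
    moreover have "u = t \<otimes> v" using u v by (simp add: t_def m_assoc)
    ultimately show ?thesis using comms_carrier[OF c] t v by (simp add: cj_mult)
  qed
qed

text \<open>Take a noncentral element of least order. If its order had two coprime nontrivial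
  factors, Bezout would write it as a product of powers of elements of smaller order; these commute
  with b by minimality, and so would x.\<close>

lemma exists_prime_power_noncentral:
  assumes fin: "finite (carrier G)" and B: "subgroup B G" and nc: "a \<in> B" "b \<in> B" "a \<otimes> b \<noteq> b \<otimes> a"
  obtains x p e where "x \<in> B" "prime (p::nat)" "ord x = p ^ e" "\<exists>b\<in>B. cj b x \<noteq> x"
proof -
  interpret subgroup B G by fact
  let ?P = "\<lambda>x. x \<in> B \<and> (\<exists>b\<in>B. cj b x \<noteq> x)"
  have "?P a" using nc cj_eq_self_iff[of b a] by auto
  then obtain x where x: "?P x" and min: "\<And>z. ?P z \<Longrightarrow> ord x \<le> ord z"
    using ex_has_least_nat[of ?P a ord] by blast
  then obtain b where b: "b \<in> B" "cj b x \<noteq> x" by blast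
  have xc: "x \<in> carrier G" and bc: "b \<in> carrier G" using x b by auto
  have "x \<noteq> \<one>" using b by auto
  then have "ord x \<noteq> 1" using xc ord_eq_1 by blast
  then obtain p where p: "prime p" "p dvd ord x" using prime_factor_nat by blast
  have o0: "ord x > 0" using ord_ge_1[OF fin xc] by simp
  obtain q where q: "ord x = p ^ multiplicity p (ord x) * q" "\<not> p dvd q"
    using multiplicity_decompose'[of "ord x" p] o0 p by (metis not_prime_unit less_not_refl)
  define m where "m = multiplicity p (ord x)"
  have q': "ord x = p ^ m * q" using q by (simp add: m_def)
  have m0: "m \<noteq> 0" using q' q(2) p(2) by (metis mult_1 power_0)
  have "q = 1"
  proof (rule ccontr)
    assume "q \<noteq> 1"
    then have q1: "q > 1" using o0 q' by (cases q) auto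
    have p1: "p ^ m > 1" using m0 prime_gt_1_nat[OF p(1)] one_less_power[of p m] by simp
    let ?C = "{z\<in>carrier G. cj b z = z}"
    have Cint: "z [^] (s::int) \<in> ?C" if "z \<in> ?C" for z s
    proof -
      have "subgroup {z\<in>carrier G. cj z b = b} G" by (rule centralizer_subgroup[OF bc])
      moreover have "{z\<in>carrier G. cj z b = b} = ?C" using bc by (auto simp: cj_eq_self_iff)
      ultimately show ?thesis using subgroup_int_pow_closed that by metis
    qed
    have "ord (x [^] p ^ m) < ord x" "ord (x [^] q) < ord x"
    proof -
      have "ord (x [^] p ^ m) = q" using ord_pow[OF xc, of "p ^ m"] q' p1 o0 by simp
      then show "ord (x [^] p ^ m) < ord x" using q' p1 q1 by simp
      have "ord (x [^] q) = p ^ m" using ord_pow[OF xc, of q] q' q1 o0 by simp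
      then show "ord (x [^] q) < ord x" using q' p1 q1 prime_gt_0_nat[OF p(1)] by simp
    qed
    moreover have "x [^] p ^ m \<in> B" "x [^] q \<in> B" 
      using subgroup_int_pow_closed[OF B, of x "int (p ^ m)"] subgroup_int_pow_closed[OF B, of x "int q"] x
      by (simp_all only: int_pow_int)
    ultimately have "x [^] p ^ m \<in> ?C" "x [^] q \<in> ?C" using min b(1) xc by (auto simp: not_le[symmetric])
    then have C: "(x [^] p ^ m) [^] (s::int) \<in> ?C" "(x [^] q) [^] (s::int) \<in> ?C" for s using Cint by blast+
    have "coprime p q" using p(1) q(2) by (simp add: prime_imp_coprime)
    then have "coprime (int (p ^ m)) (int q)" by simp
    then obtain s t where st: "s * int (p ^ m) + t * int q = 1" by (metis coprime_iff_gcd_eq_1 bezout_int)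
    have "x = x [^] (int (p ^ m) * s + int q * t)" using st xc by (simp add: mult.commute)
    also have "\<dots> = x [^] (int (p ^ m) * s) \<otimes> x [^] (int q * t)" using xc by (simp add: int_pow_mult)
    also have "\<dots> = (x [^] p ^ m) [^] s \<otimes> (x [^] q) [^] t"
      using int_pow_pow[OF xc, of "int (p ^ m)" s] int_pow_pow[OF xc, of "int q" t] by (simp only: int_pow_int)
    finally have xe: "x = (x [^] p ^ m) [^] s \<otimes> (x [^] q) [^] t" .
    have "cj b x = x" using C[of s] C[of t] bc by (subst (1 2) xe) (simp add: cj_mult)
    then show False using b by simp
  qed
  then have "ord x = p ^ m" using q' by simp
  then show ?thesis using that[of x p m] x p by blast
qed

section \<open>Index arithmetic for normalisers\<close>

lemma card_subgroup_dvd: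
  assumes "subgroup I G" "subgroup J G" "I \<subseteq> J"
  shows "card I dvd card J"
proof -
  have "subgroup I (G\<lparr>carrier := J\<rparr>)" using assms by (intro subgroup_incl)
  then have "card (rcosets\<^bsub>G\<lparr>carrier := J\<rparr>\<^esub> I) * card I = card J"
    using group.lagrange[OF subgroup_imp_group[OF assms(2)]] by (simp add: order_def)
  then show ?thesis by (metis dvd_triv_right)
qed

lemma ord_dvd_card_subgroup:
  assumes "subgroup B G" "z \<in> B"
  shows "ord z dvd card B"
  using card_subgroup_dvd[OF cyc_subgroup assms(1) cyc_subset[OF assms(2,1)]] assms
  by (simp add: generate_pow_card subgroup.mem_carrier)

lemma subgroup_subset_nrm: "subgroup H G \<Longrightarrow> H \<subseteq> nrm H"
  by (auto simp: nrm_def subgroup.mem_carrier subgroup.m_closed subgroup.m_inv_closed)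

text \<open>The number (r - 1)m of left cosets of H outside the normaliser is what the bounds on
  double cosets control.\<close>

lemma card_Diff_nrm_factor:
  assumes fin: "finite (carrier G)" and H: "subgroup H G" and nn: "nrm H \<noteq> carrier G"
  obtains r m where "order G = r * card (nrm H)" "card (nrm H) = m * card H" "r \<ge> 2" "m \<ge> 1"
    "card (carrier G - nrm H) = (r - 1) * m * card H"
proof -
  have N: "subgroup (nrm H) G" by (rule nrm_subgroup[OF fin subgroup.subset[OF H]])
  have finN: "finite (nrm H)" and sub: "nrm H \<subseteq> carrier G"
    using subgroup.subset[OF N] fin finite_subset by auto
  obtain m where m: "card (nrm H) = m * card H"
    using card_subgroup_dvd[OF H N subgroup_subset_nrm[OF H]] by (metis dvdE mult.commute)
  obtain r where r: "order G = r * card (nrm H)" using lagrange[OF N] by metis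
  have pos: "card (nrm H) > 0" by (rule card_subgroup_pos[OF N fin])
  have "card (nrm H) < order G" unfolding order_def using nn sub fin by (simp add: psubset_card_mono psubsetI)
  then have "r \<ge> 2" using r pos by (cases r; cases "r - 1") auto
  moreover have "m \<ge> 1" using m pos by (cases m) auto
  moreover have "card (carrier G - nrm H) = (r - 1) * m * card H"
    using card_Diff_subset[OF finN sub] r m by (simp add: order_def[symmetric] diff_mult_distrib)
  ultimately show ?thesis using that r m by blast
qed

section \<open>Groups of order 12 with a self-normalising subgroup of order 3\<close>

lemma small_subgroup_commute:
  assumes Q: "subgroup Q G" "finite Q" "card Q < 5" and ab: "a \<in> Q" "b \<in> Q"
  shows "a \<otimes> b = b \<otimes> a"
proof (rule ccontr)
  assume n: "a \<otimes> b \<noteq> b \<otimes> a"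
  interpret subgroup Q G by fact
  have c: "a \<in> carrier G" "b \<in> carrier G" using ab by auto
  have "a \<noteq> \<one>" "b \<noteq> \<one>" "a \<noteq> b" using n c by auto
  moreover have "a \<otimes> b \<noteq> \<one>" "b \<otimes> a \<noteq> \<one>" using n c by (metis inv_comm)+
  moreover have "a \<otimes> b \<noteq> a" "a \<otimes> b \<noteq> b" "b \<otimes> a \<noteq> a" "b \<otimes> a \<noteq> b"
    using calculation c by (auto simp: r_cancel_one l_cancel_one)
  ultimately have "card {\<one>, a, b, a \<otimes> b, b \<otimes> a} = 5" using n by auto
  moreover have "{\<one>, a, b, a \<otimes> b, b \<otimes> a} \<subseteq> Q" using ab by auto
  ultimately show False using card_mono[OF Q(2)] Q(3) by (metis not_le)
qed

text \<open>The conjugates of \<open>x\<close> and of its inverse are eight elements of order 3, so a Sylow 2-subgroup is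
  exactly the set of the other four elements and therefore normal.\<close>

lemma comms_commute_order_12:
  assumes o: "order G = 12" and x: "x \<in> carrier G" and ox: "ord x = 3" and self: "nrm (cyc x) = cyc x"
    and c: "c \<in> comms" and d: "d \<in> comms"
  shows "c \<otimes> d = d \<otimes> c"
proof -
  have fin: "finite (carrier G)" using o by (metis card.infinite order_def zero_neq_numeral)
  have card3: "card (cyc x) = 3" using generate_pow_card[OF x] ox by simp
  obtain Q where Q: "subgroup Q G" "card Q = 4"
    using sylow_thm[of 2 G 2 3] o fin is_group by auto
  have finQ: "finite Q" using Q fin by (meson finite_subset subgroup.subset)
  have cent: "a \<in> cyc x" if "a \<in> carrier G" "cj a x = x" for a
    using that self nrm_cyc_iff[OF x, of a] cyc_self[of x] by simp
  have cent': "a \<in> cyc x" if "a \<in> carrier G" "cj a (inv x) = inv x" for a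
    using that cent[of a] x by (metis cj_closed cj_inv inv_inv)
  define T where "T v = (\<lambda>g. cj g v) ` carrier G" for v
  \<comment> \<open>The stabiliser of v lies in <x>, so the fibres of \<open>cj g v\<close> have at
    most 3 elements and the class has at least 12/3.\<close>
  have four: "4 \<le> card (T v)" if v: "v \<in> carrier G" and vc: "\<And>a. a \<in> carrier G \<Longrightarrow> cj a v = v \<Longrightarrow> a \<in> cyc x" for v
  proof -
    have fib: "card {g\<in>carrier G. cj g v = z} \<le> 3" if z: "z \<in> T v" for z
    proof -
      obtain g0 where g0: "g0 \<in> carrier G" "z = cj g0 v" using z by (auto simp: T_def)
      have sub: "{g\<in>carrier G. cj g v = z} \<subseteq> (\<lambda>h. h \<otimes> g0) ` cyc x"
      proof
        fix g assume g: "g \<in> {g\<in>carrier G. cj g v = z}"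
        then have "cj (g \<otimes> inv g0) v = v" using g0 v cj_inv_eq[of g0 v z] by (simp add: cj_cj[symmetric])
        then have "g \<otimes> inv g0 \<in> cyc x" using vc g g0 by simp
        moreover have "g = (g \<otimes> inv g0) \<otimes> g0" using g g0 by (simp add: group_word_simps)
        ultimately show "g \<in> (\<lambda>h. h \<otimes> g0) ` cyc x" by blast
      qed
      have finc: "finite (cyc x)" using card3 by (intro card_ge_0_finite) simp
      show ?thesis
        using card_mono[OF finite_imageI[OF finc] sub] card_image_le[OF finc, of "\<lambda>h. h \<otimes> g0"] card3
        by linarith
    qed
    have finT: "finite (T v)" using fin by (simp add: T_def)
    have "carrier G = (\<Union>z\<in>T v. {g\<in>carrier G. cj g v = z})" by (auto simp: T_def)
    then have "card (carrier G) \<le> (\<Sum>z\<in>T v. card {g\<in>carrier G. cj g v = z})"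
      using card_UN_le[OF finT, of "\<lambda>z. {g\<in>carrier G. cj g v = z}"] by simp
    also have "\<dots> \<le> (\<Sum>z\<in>T v. 3)" by (intro sum_mono fib)
    finally show ?thesis using o by (simp add: order_def)
  qed
  have x2: "x \<noteq> inv x"
  proof
    assume "x = inv x"
    then have "x \<otimes> x = \<one>" using x by (metis r_inv)
    then have "x [^] (2::nat) = \<one>" using x by (simp add: numeral_2_eq_2)
    then show False using pow_eq_id[OF x, of 2] ox by simp
  qed
  \<comment> \<open>An element conjugating x to its inverse would normalise <x>, hence lie in <x>
    and fix x, although x differs from its inverse.\<close>
  have disj: "T x \<inter> T (inv x) = {}"
  proof (rule ccontr)
    assume "T x \<inter> T (inv x) \<noteq> {}"
    then obtain g h where gh: "g \<in> carrier G" "h \<in> carrier G" "cj g x = cj h (inv x)" by (auto simp: T_def)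
    have e: "cj (g \<otimes> inv h) x = inv x" using gh x cj_inv_eq[of h "inv x" "cj g x"] by (simp add: cj_cj[symmetric])
    have "inv x \<in> cyc x" using subgroup.m_inv_closed[OF cyc_subgroup[OF x] cyc_self] .
    then have "g \<otimes> inv h \<in> cyc x" using e nrm_cyc_iff[OF x, of "g \<otimes> inv h"] gh self by simp
    then have "cj (g \<otimes> inv h) x = x"
      using cyc_commute[OF x cyc_self] gh x cj_eq_self_iff[of "g \<otimes> inv h" x] by simp
    then show False using e x2 by simp
  qed
  have notQ: "z \<notin> Q" if z: "z \<in> T x \<union> T (inv x)" for z
  proof
    assume zQ: "z \<in> Q"
    obtain g v where g: "g \<in> carrier G" "v \<in> {x, inv x}" "z = cj g v" using z by (auto simp: T_def)
    have "inv x \<noteq> \<one>" "x \<noteq> \<one>" using x2 x inv_eq_1_iff[OF x] by auto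
    then have "v \<noteq> \<one>" using g(2) by (metis insertE singletonD)
    moreover have "x [^] (3::nat) = \<one>" "inv x [^] (3::nat) = \<one>"
      using x ox pow_ord_eq_1[OF x] by (simp_all add: nat_pow_inv)
    ultimately have v: "v \<in> carrier G" "v \<noteq> \<one>" "v [^] (3::nat) = \<one>"
      using g(2) x by (metis insertE singletonD inv_closed)+
    have "z [^] (3::nat) = \<one>" using g v cj_pow[of g v 3] by simp
    then have "ord z dvd 3" using pow_eq_id[of z 3] g v by simp
    moreover have "ord z dvd 4" using ord_dvd_card_subgroup[OF Q(1) zQ] Q by simp
    ultimately have "ord z dvd (4 - 3 :: nat)" by (intro dvd_diff_nat)
    then have "z = \<one>" using ord_eq_1[of z] g v by simp
    then show False using cj_inj[of g v \<one>] g v by simp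
  qed
  have Qeq: "Q = carrier G - (T x \<union> T (inv x))"
  proof (rule card_seteq)
    show "Q \<subseteq> carrier G - (T x \<union> T (inv x))" using notQ subgroup.subset[OF Q(1)] by blast
    have TT: "T x \<union> T (inv x) \<subseteq> carrier G" using x by (auto simp: T_def)
    have "8 \<le> card (T x) + card (T (inv x))" using four[OF x cent] four[OF inv_closed[OF x] cent'] by simp
    also have "\<dots> = card (T x \<union> T (inv x))" using disj fin by (subst card_Un_disjoint) (auto simp: T_def)
    finally have "card (carrier G - (T x \<union> T (inv x))) \<le> 12 - 8"
      using o TT fin by (subst card_Diff_subset) (auto simp: order_def finite_subset)
    then show "card (carrier G - (T x \<union> T (inv x))) \<le> card Q" using Q by simp
  qed (use fin in simp)
  have nQ: "nrm Q = carrier G"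
  proof
    show "carrier G \<subseteq> nrm Q"
    proof
      fix a assume a: "a \<in> carrier G"
      have "cj a q \<in> Q" if q: "q \<in> Q" for q
      proof (rule ccontr)
        assume "cj a q \<notin> Q"
        have qc: "q \<in> carrier G" using q Q by (simp add: subgroup.mem_carrier)
        then obtain g v where g: "g \<in> carrier G" "v \<in> {x, inv x}" "cj a q = cj g v"
          using \<open>cj a q \<notin> Q\<close> a unfolding Qeq by (auto simp: T_def)
        have "v \<in> carrier G" using g x by auto
        then have "q = cj (g \<otimes> inv a) v" using g a qc cj_inv_eq[of a q "cj g v"] by (simp add: cj_cj)
        then have "q \<in> T x \<union> T (inv x)" using g a by (auto simp: T_def)
        then show False using notQ q by blast
      qed
      then show "a \<in> nrm Q" using a by (simp add: nrm_iff)
    qed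
  qed (auto simp: nrm_def)
  have "comms \<subseteq> Q" using comms_subset_of_small_index[OF fin Q(1) nQ] o Q by simp
  then show ?thesis using small_subgroup_commute[OF Q(1) finQ] Q c d by auto
qed

end

section \<open>Groups of large transversal probability\<close>

locale high_tp_group = group +
  assumes fin: "finite (carrier G)" and high_tp: "tp G > 4 / 81"
begin

lemma transversal_prob_gt:
  assumes "subgroup H G"
  shows "transversal_prob G H > 4 / 81"
proof -
  have "finite {H. subgroup H G}"
    using fin by (auto intro!: finite_subset[of _ "Pow (carrier G)"] dest: subgroup.subset)
  then have "tp G \<le> transversal_prob G H" unfolding tp_def using assms by (intro Min_le) auto
  then show ?thesis using high_tp by simp
qed

text \<open>If H is not normal, then (r - 1)m is at most 8; since r is at least 2, the index r m of
  H is at most 16.\<close>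

lemma two_subgroup_normal_if_large:
  assumes H: "subgroup H G" "card H = 2 ^ e" and big: "order G > 16 * card H"
  shows "nrm H = carrier G"
proof (rule ccontr)
  assume nn: "nrm H \<noteq> carrier G"
  obtain r m where rm: "order G = r * card (nrm H)" "card (nrm H) = m * card H" "r \<ge> 2" "m \<ge> 1"
    "card (carrier G - nrm H) = (r - 1) * m * card H"
    by (rule card_Diff_nrm_factor[OF fin H(1) nn])
  have "(r - 1) * m * card H \<le> 8 * card H"
    using two_group_card_Diff_nrm_le[OF H(1) fin transversal_prob_gt[OF H(1)] H(2)] rm by simp
  then have "(r - 1) * m \<le> 8" using card_subgroup_pos[OF H(1) fin] by simp
  moreover have "r * m \<le> 2 * ((r - 1) * m)"
  proof -
    have "r \<le> 2 * (r - 1)" using rm by simp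
    then have "r * m \<le> 2 * (r - 1) * m" by (rule mult_le_mono1)
    then show ?thesis by (simp add: mult.assoc)
  qed
  ultimately have "r * m \<le> 16" by linarith
  then have "r * m * card H \<le> 16 * card H" by (rule mult_le_mono1)
  then show False using big rm by (simp add: mult.assoc)
qed

text \<open>The bound 32 is 16 times the order of <t>, and a normal subgroup of order 2 is
  central.\<close>

lemma involution_central_if_large:
  assumes t: "t \<in> carrier G" "t \<noteq> \<one>" "t \<otimes> t = \<one>" and big: "order G > 32" and a: "a \<in> carrier G"
  shows "cj a t = t"
proof -
  have pw: "t [^] (n::nat) = \<one> \<or> t [^] n = t" for n using t by (induction n) auto
  have "t [^] (2::nat) = \<one>" using t by (simp add: numeral_2_eq_2)
  then have "ord t dvd 2" using pow_eq_id[OF t(1), of 2] by simp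
  moreover have "ord t \<noteq> 1" using t ord_eq_1 by blast
  ultimately have "card (cyc t) = 2 ^ 1"
    using generate_pow_card[OF t(1)] by (metis prime_nat_iff power_one_right two_is_prime_nat)
  then have "nrm (cyc t) = carrier G"
    using two_subgroup_normal_if_large[OF cyc_subgroup[OF t(1)], of 1] big by simp
  then have "cj a t \<in> cyc t" using nrm_cyc_iff[OF t(1), of a] a by simp
  then have "cj a t = \<one> \<or> cj a t = t" using pw cyc_nat[OF fin t(1)] by metis
  then show ?thesis using cj_inj[OF a t(1), of \<one>] a t by auto
qed

text \<open>Here (r - 1)m = 3. For r = 2 the lemma on index two applies. For r = 4 and m = 1 the
  subgroup <y> is self-normalising and |G| = 4 times 3^e; the bound on non-central involutions then
  leaves only order 12.\<close>

lemma comms_commute_of_three_element: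
  assumes y: "y \<in> carrier G" and o: "ord y = 3 ^ e" and nn: "nrm (cyc y) \<noteq> carrier G"
    and c: "c \<in> comms" and d: "d \<in> comms"
  shows "c \<otimes> d = d \<otimes> c"
proof -
  have H: "subgroup (cyc y) G" by (rule cyc_subgroup[OF y])
  have cH: "card (cyc y) = 3 ^ e" using generate_pow_card[OF y] o by simp
  obtain g where g: "g \<in> carrier G" "carrier G - nrm (cyc y) = double_coset (cyc y) g"
    "card (double_coset (cyc y) g) = 3 * card (cyc y)"
    using three_group_spectrum[OF H fin transversal_prob_gt[OF H] cH nn[symmetric]] .
  obtain r m where rm: "order G = r * card (nrm (cyc y))" "card (nrm (cyc y)) = m * card (cyc y)" "r \<ge> 2" "m \<ge> 1"
    "card (carrier G - nrm (cyc y)) = (r - 1) * m * card (cyc y)"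
    by (rule card_Diff_nrm_factor[OF fin H nn])
  have "(r - 1) * m = 3" using rm g card_subgroup_pos[OF H fin] by simp
  then have "r - 1 dvd 3" by (metis dvd_triv_left)
  then have "r - 1 = 1 \<or> r - 1 = 3" using prime_nat_iff[of 3] by auto
  then consider "r = 2" | "r = 4" "m = 1" using \<open>(r - 1) * m = 3\<close> by fastforce
  then show ?thesis
  proof cases
    case 1
    then show ?thesis using comms_commute_of_index_two_double_coset[OF fin y g(1) _ g(2) c d] rm by simp
  next
    case 2
    have self: "nrm (cyc y) = cyc y"
      using card_subset_eq[of "nrm (cyc y)" "cyc y"] subgroup_subset_nrm[OF H] rm(2) 2 fin
      by (auto simp: nrm_def)
    have oG: "order G = 4 * 3 ^ e" using rm 2 cH by simp
    have "order G \<le> 32"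
    proof (rule ccontr)
      assume big: "\<not> order G \<le> 32"
      obtain I where I: "subgroup I G" "card I = 2"
        using sylow_thm[of 2 G 1 "2 * 3 ^ e"] oG fin is_group by auto
      have "I \<noteq> {\<one>}" using I by auto
      then obtain t where t: "t \<in> I" "t \<noteq> \<one>" using subgroup.one_closed[OF I(1)] by blast
      have tc: "t \<in> carrier G" using t I by (simp add: subgroup.mem_carrier)
      have ot: "ord t dvd 2" using ord_dvd_card_subgroup[OF I(1) t(1)] I by simp
      then have "t [^] (2::nat) = \<one>" using pow_eq_id[OF tc, of 2] by simp
      then have "t \<otimes> t = \<one>" using tc by (simp add: numeral_2_eq_2)
      \<comment> \<open>A central involution commutes with y, hence normalises <y> and so lies in
        it, against the odd order of <y>.\<close>
      then have "cj y t = t" using involution_central_if_large[OF tc t(2) _ _ y] big by simp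
      then have "cj t y = y" using tc y by (simp add: cj_eq_self_iff)
      then have "t \<in> cyc y" using self nrm_cyc_iff[OF y, of t] cyc_self tc by simp
      then have "ord t dvd 3 ^ e" using ord_dvd_card_subgroup[OF H] cH by simp
      moreover have "coprime (2::nat) (3 ^ e)" by simp
      ultimately have "ord t = 1" using ot by (meson coprime_common_divisor_nat coprime_def nat_dvd_1_iff_1)
      then show False using ord_eq_1[OF tc] t by simp
    qed
    then have "3 ^ e \<le> (8::nat)" using oG by simp
    have "e < 2"
    proof (rule ccontr)
      assume "\<not> e < 2"
      then have "(3::nat) ^ 2 \<le> 3 ^ e" by (intro power_increasing) auto
      then show False using \<open>3 ^ e \<le> (8::nat)\<close> by simp
    qed
    moreover have "e \<noteq> 0"
    proof
      assume "e = 0"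
      then have "y = \<one>" using o y ord_eq_1 by simp
      then have "a \<in> nrm (cyc y)" if "a \<in> carrier G" for a
        using that nrm_cyc_iff[OF y, of a] cyc_self[of y] by simp
      then have "nrm (cyc y) = carrier G" unfolding nrm_def by blast
      then show False using nn by simp
    qed
    ultimately have "e = 1" by simp
    then show ?thesis using comms_commute_order_12[OF _ y _ self c d] oG o by simp
  qed
qed

text \<open>A normal <y> is centralised by G'. A non-normal one forces q = 3, and then G' is
  abelian, which the hypotheses on c and d exclude.\<close>

lemma comms_centralize_odd_prime_power:
  assumes nc: "c \<in> comms" "d \<in> comms" "c \<otimes> d \<noteq> d \<otimes> c"
    and y: "y \<in> carrier G" "ord y = q ^ e" "prime q" "q \<noteq> 2" and a: "a \<in> comms"
  shows "cj a y = y"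
proof -
  have H: "subgroup (cyc y) G" by (rule cyc_subgroup[OF y(1)])
  have cH: "card (cyc y) = q ^ e" using generate_pow_card[OF y(1)] y by simp
  have "nrm (cyc y) = carrier G"
  proof (rule ccontr)
    assume nn: "nrm (cyc y) \<noteq> carrier G"
    then have "\<Union>(nontrivial_dcs (cyc y)) \<noteq> {}" using Union_nontrivial_dcs[OF H fin] by (auto simp: nrm_def)
    then obtain D where "D \<in> nontrivial_dcs (cyc y)" by blast
    then have "q = 3" using dc_index_prime_power[OF H fin transversal_prob_gt[OF H] y(3) cH] y(4) by blast
    then show False using comms_commute_of_three_element[OF y(1) _ nn nc(1,2)] y nc(3) by simp
  qed
  then show ?thesis
    using comms_centralize_cyc_normal[OF fin y(1) _ a] nrm_cyc_iff[OF y(1)] by blast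
qed

text \<open>For odd q, every element of a Sylow q-subgroup commutes with x because x is in G'. So
  the normaliser contains a full Sylow q-subgroup and q cannot divide its index.\<close>

lemma prime_divisor_index_nrm_eq_2:
  assumes nc: "c \<in> comms" "d \<in> comms" "c \<otimes> d \<noteq> d \<otimes> c" and x: "x \<in> comms"
    and r: "order G = r * card (nrm (cyc x))" and q: "prime q" "q dvd r"
  shows "q = 2"
proof (rule ccontr)
  assume q2: "q \<noteq> 2"
  have xc: "x \<in> carrier G" using x comms_carrier by blast
  have N: "subgroup (nrm (cyc x)) G" using nrm_subgroup[OF fin] cyc_subgroup[OF xc] subgroup.subset by blast
  have "order G \<noteq> 0" using fin order_gt_0_iff_finite by simp
  then obtain m where m: "order G = q ^ multiplicity q (order G) * m" "\<not> q dvd m"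
    using multiplicity_decompose'[of "order G" q] q by (metis not_prime_unit)
  define a where "a = multiplicity q (order G)"
  obtain Q where Q: "subgroup Q G" "card Q = q ^ a"
    using sylow_thm[OF q(1) is_group _ fin, of a m] m by (auto simp: a_def)
  have "Q \<subseteq> nrm (cyc x)"
  proof
    fix y assume yQ: "y \<in> Q"
    then have yc: "y \<in> carrier G" using Q by (simp add: subgroup.mem_carrier)
    have "ord y dvd q ^ a" using ord_dvd_card_subgroup[OF Q(1) yQ] Q by simp
    then obtain e where "ord y = q ^ e" using divides_primepow_nat q by blast
    then have "cj x y = y" using comms_centralize_odd_prime_power[OF nc yc _ q(1) q2 x] by simp
    then have "cj y x = x" using xc yc by (simp add: cj_eq_self_iff)
    then show "y \<in> nrm (cyc x)" using nrm_cyc_iff[OF xc] yc cyc_self by simp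
  qed
  then have "q ^ a dvd card (nrm (cyc x))" using card_subgroup_dvd[OF Q(1) N] Q by simp
  then have "q * q ^ a dvd q ^ a * m" using q(2) m(1) r unfolding a_def by (metis mult_dvd_mono)
  moreover have "q ^ a \<noteq> 0" using q(1) by (simp add: prime_gt_0_nat)
  ultimately have "q dvd m" by (metis dvd_times_left_cancel_iff mult.commute)
  then show False using m by simp
qed

section \<open>Cyclic 2-subgroups\<close>

text \<open>The core has index 2 in <x> and does not contain x, so it contains the product of x with
  itself.\<close>

lemma sq_mem_of_conj_core_index_two:
  assumes fin: "finite (carrier G)" and x: "x \<in> carrier G" and g: "g \<in> carrier G - nrm (cyc x)"
    and ind: "2 * card (conj_core (cyc x) g) = card (cyc x)"
  shows "cj g (x \<otimes> x) \<in> cyc x"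
proof -
  let ?H = "cyc x" and ?B = "conj_core (cyc x) g"
  have H: "subgroup ?H G" by (rule cyc_subgroup[OF x])
  have gc: "g \<in> carrier G" using g by simp
  have B: "?B = ?H \<inter> {z\<in>carrier G. cj g z \<in> ?H}"
    using subgroup.subset[OF H] by (auto simp: conj_core_def cj_def)
  have Bsg: "subgroup ?B G" unfolding B by (intro subgroups_Inter_pair H cj_subgroup_preimage gc)
  have "subgroup ?B (G\<lparr>carrier := ?H\<rparr>)" using B by (intro subgroup_incl Bsg H) auto
  moreover have "x \<notin> ?B" using g nrm_cyc_iff[OF x, of g] by (simp add: conj_core_def cj_def)
  moreover have "finite ?H" using finite_subset[OF subgroup.subset[OF H] fin] .
  ultimately have "x \<otimes> x \<in> ?B"
    using group.index_two_mult[OF subgroup_imp_group[OF H], of ?B x x] ind cyc_self[of x] by (simp add: order_def)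
  then show ?thesis using B by blast
qed

lemma ord_cj_dvd: "a \<in> carrier G \<Longrightarrow> z \<in> carrier G \<Longrightarrow> ord (cj a z) dvd ord z"
  using pow_eq_id[of "cj a z" "ord z"] cj_pow[of a z "ord z"] by simp

text \<open>The last hypothesis below holds when every double coset of \<open>\<langle>x\<rangle>\<close> outside the normaliser
  consists of two left cosets; then \<open>\<langle>x\<^sup>2\<rangle>\<close> is normal in \<open>G\<close>.\<close>

context
  fixes x e
  assumes fin: "finite (carrier G)" and x: "x \<in> carrier G" and o: "ord x = 2 ^ e"
    and nn: "nrm (cyc x) \<noteq> carrier G"
    and sq: "\<And>g. g \<in> carrier G - nrm (cyc x) \<Longrightarrow> cj g (x \<otimes> x) \<in> cyc x"
begin

lemma two_cyc_ord_sq: "2 * ord (x \<otimes> x) = ord x"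
proof -
  have "e \<noteq> 0"
  proof
    assume "e = 0"
    then have "x = \<one>" using o x ord_eq_1 by simp
    then have "a \<in> nrm (cyc x)" if "a \<in> carrier G" for a
      using that nrm_cyc_iff[OF x, of a] cyc_self[of x] by simp
    then show False using nn unfolding nrm_def by blast
  qed
  then have "ord (x [^] (2::nat)) = ord x div 2" "even (ord x)" using ord_pow[OF x, of 2] o by simp_all
  moreover have "x [^] (2::nat) = x \<otimes> x" using x by (simp add: numeral_2_eq_2)
  ultimately show ?thesis by simp
qed

lemma two_cyc_card_sq: "2 * card (cyc (x \<otimes> x)) = card (cyc x)"
  using two_cyc_ord_sq generate_pow_card x by simp

lemma two_cyc_notin_sq: "x \<notin> cyc (x \<otimes> x)"
proof
  assume "x \<in> cyc (x \<otimes> x)"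
  then have "ord x dvd ord (x \<otimes> x)"
    using ord_dvd_card_subgroup[OF cyc_subgroup[of "x \<otimes> x"]] generate_pow_card[of "x \<otimes> x"] x by simp
  moreover have "ord (x \<otimes> x) > 0" using ord_ge_1[OF fin, of "x \<otimes> x"] x by simp
  ultimately show False using two_cyc_ord_sq dvd_imp_le by fastforce
qed

lemma two_cyc_even_pow: "x [^] (i + i :: nat) \<in> cyc (x \<otimes> x)"
proof -
  have "x [^] (i + i) = (x [^] (2::nat)) [^] i" using x by (simp add: nat_pow_pow mult_2)
  also have "\<dots> = (x \<otimes> x) [^] i" using x by (simp add: numeral_2_eq_2)
  finally show ?thesis using cyc_nat[OF fin, of "x \<otimes> x"] x by blast
qed

lemma two_cyc_split: "z \<in> cyc x \<Longrightarrow> z \<in> cyc (x \<otimes> x) \<or> (\<exists>k\<in>cyc (x \<otimes> x). z = x \<otimes> k)"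
proof -
  assume "z \<in> cyc x"
  then obtain n :: nat where n: "z = x [^] n" using cyc_nat[OF fin x] by blast
  show ?thesis
  proof (cases "even n")
    case True
    then obtain i where "n = i + i" by (metis evenE mult_2)
    then show ?thesis using n two_cyc_even_pow by blast
  next
    case False
    then obtain i where "n = Suc (i + i)" by (metis oddE mult_2 Suc_eq_plus1)
    then have "z = x \<otimes> x [^] (i + i)" using n x nat_pow_Suc2 by simp
    then show ?thesis using two_cyc_even_pow by blast
  qed
qed

lemma two_cyc_sq_subset: "cyc (x \<otimes> x) \<subseteq> cyc x"
  using x cyc_self[of x] cyc_subgroup[OF x] by (intro cyc_subset) (auto intro: subgroup.m_closed)

text \<open>Outside the normaliser the hypothesis only yields some power \<open>x [^] j\<close>. If
  j were odd, this power would generate <x>, but as a conjugate of the square of x it has order at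
  most half of \<open>ord x\<close>.\<close>

lemma two_cyc_sq_normal_gen:
  assumes a: "a \<in> carrier G"
  shows "cj a (x \<otimes> x) \<in> cyc (x \<otimes> x)"
proof (cases "a \<in> nrm (cyc x)")
  case True
  then obtain i :: nat where "cj a x = x [^] i" using nrm_cyc_iff[OF x] cyc_nat[OF fin x] by blast
  then show ?thesis using a x two_cyc_even_pow[of i] by (simp add: cj_mult nat_pow_mult)
next
  case False
  then obtain j :: nat where j: "cj a (x \<otimes> x) = x [^] j" using sq[of a] a cyc_nat[OF fin x] by blast
  have "even j"
  proof (rule ccontr)
    assume "odd j"
    then have "x \<in> cyc (x [^] j)" by (rule odd_pow_generates[OF x o])
    then have "ord x dvd ord (x [^] j)"
      using ord_dvd_card_subgroup[OF cyc_subgroup[of "x [^] j"]] generate_pow_card[of "x [^] j"] x by simp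
    also have "\<dots> dvd ord (x \<otimes> x)" using ord_cj_dvd[OF a, of "x \<otimes> x"] x j by simp
    finally have "ord x dvd ord (x \<otimes> x)" .
    moreover have "ord (x \<otimes> x) > 0" using ord_ge_1[OF fin, of "x \<otimes> x"] x by simp
    ultimately show False using two_cyc_ord_sq dvd_imp_le by fastforce
  qed
  then obtain i where "j = i + i" by (metis evenE mult_2)
  then show ?thesis using j two_cyc_even_pow by simp
qed

lemma two_cyc_sq_normal:
  assumes a: "a \<in> carrier G" and k: "k \<in> cyc (x \<otimes> x)"
  shows "cj a k \<in> cyc (x \<otimes> x)"
  using two_cyc_sq_normal_gen[OF a] nrm_cyc_iff[of "x \<otimes> x" a] x a k by (simp add: nrm_iff)

lemma two_cyc_conj_notin_sq:
  assumes a: "a \<in> carrier G"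
  shows "cj a x \<notin> cyc (x \<otimes> x)"
proof
  assume "cj a x \<in> cyc (x \<otimes> x)"
  then have "cj (inv a) (cj a x) \<in> cyc (x \<otimes> x)" by (rule two_cyc_sq_normal[OF inv_closed[OF a]])
  then show False using a x two_cyc_notin_sq by (simp add: cj_cj)
qed

text \<open>The part of <x> outside the subgroup of squares is a single coset, and a conjugate of x
  never falls into that normal subgroup.\<close>

lemma two_cyc_nrm_coset:
  assumes a: "a \<in> nrm (cyc x)"
  shows "\<exists>k\<in>cyc (x \<otimes> x). cj a x = x \<otimes> k"
proof -
  have "a \<in> carrier G" "cj a x \<in> cyc x" using a nrm_cyc_iff[OF x] by blast+
  then show ?thesis using two_cyc_split two_cyc_conj_notin_sq by blast
qed

text \<open>Since \<open>x\<close> lies in \<open>G'\<close>, it acts on the four cosets of the normaliser as an even permutation.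
  It fixes one coset and its square acts trivially, so it acts trivially.\<close>

lemma two_cyc_conj_in_nrm:
  assumes xM: "x \<in> comms" and ind: "order G = 4 * card (nrm (cyc x))" and a: "a \<in> carrier G"
  shows "cj a x \<in> nrm (cyc x)"
proof -
  define N where "N = nrm (cyc x)"
  \<comment> \<open>Right multiplication on the right cosets of N, made the identity elsewhere so
    that \<open>permutes\<close> and \<open>sign\<close> apply. Composition is reversed, which signs
    do not see.\<close>
  define \<pi> where "\<pi> g = (\<lambda>C. if C \<in> rcosets N then C #> g else C)" for g
  have Nsg: "subgroup N G" unfolding N_def by (rule nrm_subgroup[OF fin subgroup.subset[OF cyc_subgroup[OF x]]])
  interpret N: subgroup N G by fact
  have finR: "finite (rcosets N)" using fin by (simp add: RCOSETS_def)
  have cardR: "card (rcosets N) = 4"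
    using lagrange[OF Nsg] ind card_subgroup_pos[OF Nsg fin] by (simp add: N_def)
  have RG: "C \<subseteq> carrier G" if "C \<in> rcosets N" for C using that N.rcosets_carrier[OF is_group] by blast
  have act: "C #> g \<in> rcosets N" if "C \<in> rcosets N" "g \<in> carrier G" for C g
    using that coset_mult_assoc[OF N.subset] by (auto simp: RCOSETS_def)
  have act_inv: "C #> g #> inv g = C" "C #> inv g #> g = C" if "C \<in> rcosets N" "g \<in> carrier G" for C g
    using that RG[of C] by (simp_all add: coset_mult_assoc)
  have perm: "\<pi> g permutes rcosets N" if g: "g \<in> carrier G" for g
  proof (rule bij_imp_permutes)
    show "bij_betw (\<pi> g) (rcosets N) (rcosets N)"
      by (rule bij_betw_byWitness[where f' = "\<pi> (inv g)"])
        (use g act act_inv in \<open>auto simp: \<pi>_def\<close>)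
  qed (simp add: \<pi>_def)
  have permu: "permutation (\<pi> g)" if "g \<in> carrier G" for g
    using perm[OF that] finR permutation_permutes by blast
  have comp: "\<pi> (g \<otimes> h) = \<pi> h \<circ> \<pi> g" if "g \<in> carrier G" "h \<in> carrier G" for g h
    using that act RG by (auto simp: \<pi>_def fun_eq_iff coset_mult_assoc)
  have sgn: "sign (\<pi> (g \<otimes> h)) = sign (\<pi> g) * sign (\<pi> h)" if "g \<in> carrier G" "h \<in> carrier G" for g h
    using that by (simp add: comp sign_compose permu)
  have sq1: "sign (\<pi> g) * sign (\<pi> g) = 1" for g by (simp add: sign_def)
  have one: "sign (\<pi> \<one>) = 1" using sgn[of \<one> \<one>] sq1[of \<one>] by simp
  have sinv: "sign (\<pi> (inv g)) = sign (\<pi> g)" if g: "g \<in> carrier G" for g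
  proof -
    have "sign (\<pi> g) * sign (\<pi> (inv g)) = 1" using sgn[of g "inv g"] g one by simp
    then show ?thesis by (auto simp: sign_def split: if_splits)
  qed
  \<comment> \<open>The sign is a homomorphism into an abelian group, so its kernel contains
    G'.\<close>
  have "comms \<subseteq> {g\<in>carrier G. sign (\<pi> g) = 1}"
  proof (rule comms_subset)
    show "subgroup {g\<in>carrier G. sign (\<pi> g) = 1} G"
      by (rule subgroup.intro) (auto simp: sgn one sinv)
    fix a b assume ab: "a \<in> carrier G" "b \<in> carrier G"
    have "sign (\<pi> (a \<otimes> b \<otimes> inv (b \<otimes> a))) = (sign (\<pi> a) * sign (\<pi> a)) * (sign (\<pi> b) * sign (\<pi> b))"
      using ab by (simp add: sgn sinv mult_ac)
    then show "a \<otimes> b \<otimes> inv (b \<otimes> a) \<in> {g\<in>carrier G. sign (\<pi> g) = 1}" using ab sq1 by simp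
  qed
  then have sx: "sign (\<pi> x) = 1" using xM by blast
  have xN: "x \<in> N" using subgroup_subset_nrm[OF cyc_subgroup[OF x]] cyc_self by (auto simp: N_def)
  have NR: "N \<in> rcosets N" by (rule N.subgroup_in_rcosets[OF is_group])
  have Nx: "N #> x = N" by (rule N.rcos_const[OF is_group xN])
  have sqfix: "C #> x #> x = C" if C: "C \<in> rcosets N" for C
  proof -
    obtain g where g: "g \<in> carrier G" "C = N #> g" using C by (auto simp: RCOSETS_def)
    have "cj (inv g) (x \<otimes> x) \<in> N"
      using two_cyc_sq_normal_gen[of "inv g"] two_cyc_sq_subset subgroup_subset_nrm[OF cyc_subgroup[OF x]] g
      by (auto simp: N_def)
    then have "N #> (g \<otimes> (x \<otimes> x)) = N #> g"
      using r_coset_eq_iff[OF Nsg, of g "g \<otimes> (x \<otimes> x)"] g x by (simp add: cj_def m_assoc)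
    moreover have "C #> x #> x = N #> (g \<otimes> (x \<otimes> x))"
      using g x N.subset by (simp add: coset_mult_assoc m_assoc)
    ultimately show ?thesis using g by simp
  qed
  have inj: "C = D" if "C \<in> rcosets N" "D \<in> rcosets N" "C #> x = D #> x" for C D
    using act_inv(1)[OF that(1) x] act_inv(1)[OF that(2) x] that(3) by metis
  have fixall: "C #> x = C" if C1: "C \<in> rcosets N" for C
  proof (rule ccontr)
    assume ne: "C #> x \<noteq> C"
    define D where "D = C #> x"
    have DR: "D \<in> rcosets N" using act[OF C1 x] by (simp add: D_def)
    have Dx: "D #> x = C" using sqfix[OF C1] by (simp add: D_def)
    have CN: "C \<noteq> N" using ne Nx by auto
    have DN: "D \<noteq> N" using inj[OF C1 NR] Nx CN by (auto simp: D_def)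
    have DC: "D \<noteq> C" using ne by (simp add: D_def)
    \<comment> \<open>x fixes N and swaps C and D, so the one remaining coset has nowhere else to
      go. This makes x a transposition, which is odd.\<close>
    have other: "E #> x = E" if E: "E \<in> rcosets N" "E \<noteq> C" "E \<noteq> D" for E
    proof (cases "E = N")
      case False
      have "{N, C, D, E} \<subseteq> rcosets N" using NR C1 DR E by simp
      moreover have "card {N, C, D, E} = 4" using CN DN DC E False by auto
      ultimately have R: "rcosets N = {N, C, D, E}" using cardR finR card_subset_eq by metis
      have "E #> x \<noteq> N" using inj[OF E(1) NR] Nx False by auto
      moreover have "E #> x \<noteq> C" using inj[OF E(1) DR] Dx E by auto
      moreover have "E #> x \<noteq> D" using inj[OF E(1) C1] E by (auto simp: D_def)
      moreover have "E #> x \<in> {N, C, D, E}" using act[OF E(1) x] R by simp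
      ultimately show ?thesis by blast
    qed (use Nx in simp)
    have "\<pi> x = transpose C D"
    proof
      fix E show "\<pi> x E = transpose C D E"
        using C1 DR Dx other[of E] by (auto simp: \<pi>_def transpose_def D_def)
    qed
    then have "sign (\<pi> x) = -1" using DC sign_swap_id[of C D] by auto
    then show False using sx by simp
  qed
  have "N #> inv a #> x = N #> inv a" using a by (intro fixall) (auto simp: RCOSETS_def)
  then have "N #> inv a = N #> (inv a \<otimes> x)" using a x N.subset by (simp add: coset_mult_assoc)
  then have "inv a \<otimes> x \<otimes> inv (inv a) \<in> N" using r_coset_eq_iff[OF Nsg, of "inv a" "inv a \<otimes> x"] a x by blast
  then show ?thesis using a by (simp add: cj_def N_def)
qed

text \<open>Let K be generated by the square of x. If conjugates of x by a and b agree modulo K,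
  then a and b differ by an element of N; hence the conjugates meet at least |G : N| = 4 cosets of
  K. By \<open>two_cyc_conj_in_nrm\<close> they all lie in N but not in K, and N has only 3 such
  cosets because |N : K| = 4.\<close>

lemma two_cyc_no_index_four:
  assumes xM: "x \<in> comms" and ind: "order G = 4 * card (nrm (cyc x))"
    and ind2: "card (nrm (cyc x)) = 2 * card (cyc x)"
  shows False
proof -
  define N where "N = nrm (cyc x)"
  define K where "K = cyc (x \<otimes> x)"
  define Cs where "Cs = (\<lambda>a. K #> cj a x) ` carrier G"
  have Nsg: "subgroup N G" unfolding N_def by (rule nrm_subgroup[OF fin subgroup.subset[OF cyc_subgroup[OF x]]])
  interpret N: subgroup N G by fact
  have Ksg: "subgroup K G" unfolding K_def using x by (intro cyc_subgroup) simp
  interpret K: subgroup K G by fact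
  have KN: "K \<subseteq> N" using two_cyc_sq_subset subgroup_subset_nrm[OF cyc_subgroup[OF x]] by (auto simp: K_def N_def)
  have cN: "card N = 4 * card K" using ind2 two_cyc_card_sq by (simp add: N_def K_def)
  have finN: "finite N" using finite_subset[OF N.subset fin] .
  have finC: "finite Cs" using fin by (simp add: Cs_def)
  have fib: "card {a\<in>carrier G. K #> cj a x = C} \<le> card N" if C: "C \<in> Cs" for C
  proof -
    obtain b where b: "b \<in> carrier G" "C = K #> cj b x" using C by (auto simp: Cs_def)
    have sub: "{a\<in>carrier G. K #> cj a x = C} \<subseteq> (\<lambda>n. n \<otimes> b) ` N"
    proof
      fix a assume a: "a \<in> {a\<in>carrier G. K #> cj a x = C}"
      then have ac: "a \<in> carrier G" by simp
      have "cj a x \<otimes> inv (cj b x) \<in> K"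
        using r_coset_eq_iff[OF Ksg, of "cj b x" "cj a x"] a b x by simp
      then have "cj (inv b) (cj a x \<otimes> inv (cj b x)) \<in> K"
        unfolding K_def by (rule two_cyc_sq_normal[OF inv_closed[OF b(1)]])
      then have "cj (a \<otimes> inv b) x \<otimes> inv x \<in> K" using ac b x by (simp add: cj_mult cj_inv cj_cj)
      then have "cj (a \<otimes> inv b) x \<otimes> inv x \<in> cyc x" using two_cyc_sq_subset by (auto simp: K_def)
      then have "cj (a \<otimes> inv b) x \<otimes> inv x \<otimes> x \<in> cyc x"
        using subgroup.m_closed[OF cyc_subgroup[OF x] _ cyc_self] by blast
      then have "cj (a \<otimes> inv b) x \<in> cyc x" using ac b x by (simp add: m_assoc)
      then have "a \<otimes> inv b \<in> N" unfolding N_def using nrm_cyc_iff[OF x] ac b by simp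
      moreover have "a = (a \<otimes> inv b) \<otimes> b" using ac b by (simp add: m_assoc)
      ultimately show "a \<in> (\<lambda>n. n \<otimes> b) ` N" by blast
    qed
    show ?thesis
      using card_mono[OF finite_imageI[OF finN] sub] card_image_le[OF finN, of "\<lambda>n. n \<otimes> b"] by linarith
  qed
  have "carrier G = (\<Union>C\<in>Cs. {a\<in>carrier G. K #> cj a x = C})" by (auto simp: Cs_def)
  then have "card (carrier G) \<le> (\<Sum>C\<in>Cs. card {a\<in>carrier G. K #> cj a x = C})"
    using card_UN_le[OF finC, of "\<lambda>C. {a\<in>carrier G. K #> cj a x = C}"] by simp
  also have "\<dots> \<le> (\<Sum>C\<in>Cs. card N)" by (intro sum_mono fib)
  finally have "4 * card N \<le> card Cs * card N" using ind by (simp add: order_def N_def)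
  then have four: "4 \<le> card Cs" using card_subgroup_pos[OF Nsg fin] by simp
  have CR: "C \<in> rcosets K" if "C \<in> Cs" for C using that x by (auto simp: Cs_def RCOSETS_def)
  have CNK: "C \<subseteq> N - K" if C: "C \<in> Cs" for C
  proof
    fix z assume z: "z \<in> C"
    obtain a where a: "a \<in> carrier G" "C = K #> cj a x" using C by (auto simp: Cs_def)
    obtain k where k: "k \<in> K" "z = k \<otimes> cj a x" using z a by (auto simp: r_coset_def)
    have "cj a x \<in> N" using two_cyc_conj_in_nrm[OF xM ind a(1)] by (simp add: N_def)
    then have "z \<in> N" using k KN by auto
    moreover have "z \<notin> K"
    proof
      assume "z \<in> K"
      then have "inv k \<otimes> z \<in> K" using k by simp
      then have "cj a x \<in> K" using k a x by (simp add: inv_mult_cancel)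
      then show False using two_cyc_conj_notin_sq[OF a(1)] by (simp add: K_def)
    qed
    ultimately show "z \<in> N - K" by blast
  qed
  have "card (\<Union>C\<in>Cs. C) = (\<Sum>C\<in>Cs. card C)"
  proof (rule card_UN_disjoint[OF finC])
    show "\<forall>C\<in>Cs. finite C" using CNK finN by (meson finite_Diff finite_subset)
    show "\<forall>C\<in>Cs. \<forall>D\<in>Cs. C \<noteq> D \<longrightarrow> C \<inter> D = {}"
      using rcos_disjoint[OF Ksg] CR by (auto simp: pairwise_def disjnt_def)
  qed
  also have "\<dots> = (\<Sum>C\<in>Cs. card K)"
    using CR card_rcosets_equal[OF _ K.subset, symmetric] by (intro sum.cong) auto
  finally have "card Cs * card K = card (\<Union>C\<in>Cs. C)" by simp
  also have "\<dots> \<le> card (N - K)" using CNK finN by (intro card_mono) auto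
  also have "\<dots> = 3 * card K" using card_Diff_subset[OF finite_subset[OF KN finN] KN] cN by simp
  finally have "card Cs \<le> 3" using card_subgroup_pos[OF Ksg fin] by simp
  then show False using four by simp
qed

end

end

section \<open>Normalisers of index two, and the commutativity of G'\<close>

context high_tp_group
begin

text \<open>With \<open>y = x\<^sup>g\<close> for \<open>g\<close> outside the normaliser, \<open>G'\<close> centralises \<open>xy\<close>, so \<open>x\<close> and \<open>y\<close> commute. If \<open>m \<le> 4\<close>
  then \<open>G'\<close> lies in the abelian group \<open>\<langle>x, y\<rangle>\<close>. Otherwise \<open>G\<close> is large, so the involution
  \<open>t \<in> \<langle>x\<rangle>y\<close> is central; then \<open>\<langle>x\<rangle>\<close> is normal modulo \<open>t\<close>, which forces \<open>G'\<close> to centralise \<open>x\<close>.\<close>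

lemma comms_commute_of_two_cyc_index_two:
  assumes x: "x \<in> comms" and o: "ord x = 2 ^ e" and nn: "nrm (cyc x) \<noteq> carrier G"
    and sq: "\<And>g. g \<in> carrier G - nrm (cyc x) \<Longrightarrow> cj g (x \<otimes> x) \<in> cyc x"
    and ind: "order G = 2 * card (nrm (cyc x))"
    and m: "card (nrm (cyc x)) = m * card (cyc x)"
    and b: "b \<in> comms" "cj b x \<noteq> x"
    and cd: "c \<in> comms" "d \<in> comms"
  shows "c \<otimes> d = d \<otimes> c"
proof -
  have xc: "x \<in> carrier G" using x comms_carrier by blast
  define N where "N = nrm (cyc x)"
  define K where "K = cyc (x \<otimes> x)"
  note two_cyc = fin xc o nn sq
  have Hsg: "subgroup (cyc x) G" by (rule cyc_subgroup[OF xc])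
  interpret H: subgroup "cyc x" G by fact
  have Nsg: "subgroup N G" unfolding N_def by (rule nrm_subgroup[OF fin H.subset])
  interpret N: subgroup N G by fact
  have Ksg: "subgroup K G" unfolding K_def using xc by (intro cyc_subgroup) simp
  interpret K: subgroup K G by fact
  have KH: "K \<subseteq> cyc x" unfolding K_def using two_cyc_sq_subset[OF two_cyc] .
  have Kn: "cj a k \<in> K" if "a \<in> carrier G" "k \<in> K" for a k
    using two_cyc_sq_normal[OF two_cyc] that by (simp add: K_def)
  have two: "a \<otimes> b \<in> N" if "a \<in> carrier G" "a \<notin> N" "b \<in> carrier G" "b \<notin> N" for a b
    using index_two_mult[OF fin Nsg] ind that by (simp add: N_def)
  have Nx: "\<exists>k\<in>K. cj a x = x \<otimes> k" if "a \<in> N" for a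
    using two_cyc_nrm_coset[OF two_cyc] that by (simp add: N_def K_def)
  obtain g where g: "g \<in> carrier G" "g \<notin> N" using nn N.subset by (auto simp: N_def)
  have giN: "inv g \<notin> N" using g N.m_inv_closed[of "inv g"] by auto
  have coset: "inv g \<otimes> a \<in> N" if "a \<in> carrier G" "a \<notin> N" for a using two[of "inv g" a] g giN that by simp
  define y where "y = cj g x"
  have y: "y \<in> carrier G" using g xc by (simp add: y_def)
  have yH: "y \<notin> cyc x" using g nrm_cyc_iff[OF xc] by (simp add: y_def N_def)
  have xN: "x \<in> N" using subgroup_subset_nrm[OF Hsg] cyc_self by (auto simp: N_def)
  have Nnorm: "g \<otimes> n \<otimes> inv g \<in> N" if n: "n \<in> N" for n
  proof -
    have "g \<otimes> n \<notin> N"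
    proof
      assume "g \<otimes> n \<in> N"
      then have "(g \<otimes> n) \<otimes> inv n \<in> N" using n N.m_inv_closed N.m_closed by blast
      then show False using g n by (simp add: group_word_simps)
    qed
    then show ?thesis using two[of "g \<otimes> n" "inv g"] n g giN by simp
  qed
  have Ny: "\<exists>k\<in>K. cj n y = y \<otimes> k" if n: "n \<in> N" for n
  proof -
    obtain k where k: "k \<in> K" "cj (g \<otimes> n \<otimes> inv g) x = x \<otimes> k" using Nx[OF Nnorm[OF n]] by blast
    have "cj n y = cj g (cj (g \<otimes> n \<otimes> inv g) x)"
      using n g xc by (simp add: y_def cj_cj) (simp add: group_word_simps)
    also have "\<dots> = y \<otimes> cj g k" using k g xc by (simp add: cj_mult y_def)
    finally show ?thesis using Kn[OF g(1) k(1)] by blast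
  qed
  have cjgy: "\<exists>k\<in>K. cj g y = x \<otimes> k" using Nx[OF two[OF g g]] g xc by (simp add: y_def cj_cj)
  have yyK: "y \<otimes> y \<in> K"
    using Kn[OF g(1), of "x \<otimes> x"] cyc_self[of "x \<otimes> x"] g xc by (simp add: y_def K_def cj_mult)
  have xcomm: "k \<otimes> x = x \<otimes> k" if "k \<in> K" for k using that KH cyc_commute[OF xc _ cyc_self] by blast
  \<comment> \<open>Conjugation by g carries K onto itself and x to y, and x centralises K.\<close>
  have ycomm: "k \<otimes> y = y \<otimes> k" if k: "k \<in> K" for k
  proof -
    have "g \<in> nrm K" using Kn g by (simp add: nrm_iff)
    then have "k \<in> cj g ` K" using cj_image_eq[OF fin K.subset] k by simp
    then obtain l where l: "l \<in> K" "k = cj g l" by blast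
    then show ?thesis using xcomm[OF l(1)] g xc K.mem_carrier[OF l(1)] by (simp add: y_def cj_mult[symmetric])
  qed
  \<comment> \<open>Elements of N fix x and y modulo K and g swaps them, so the coset of their
    product is invariant under all of G.\<close>
  define u where "u = x \<otimes> y"
  have u: "u \<in> carrier G" using xc y by (simp add: u_def)
  obtain k0 where k0: "k0 \<in> K" "cj x y = y \<otimes> k0" using Ny[OF xN] by blast
  have yx: "y \<otimes> x = x \<otimes> y \<otimes> k0"
  proof -
    have "y \<otimes> x = x \<otimes> cj x y" using xc y by (simp add: cj_def group_word_simps)
    then show ?thesis using k0 xc y by (simp add: m_assoc)
  qed
  have uN: "\<exists>k\<in>K. cj n u = u \<otimes> k" if n: "n \<in> N" for n
  proof -
    obtain k where k: "k \<in> K" "cj n x = x \<otimes> k" using Nx[OF n] by blast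
    obtain l where l: "l \<in> K" "cj n y = y \<otimes> l" using Ny[OF n] by blast
    have kc: "k \<in> carrier G" "l \<in> carrier G" using k l by auto
    have "cj n u = x \<otimes> (k \<otimes> y) \<otimes> l" using n k l kc xc y by (simp add: u_def cj_mult m_assoc)
    also have "\<dots> = u \<otimes> (k \<otimes> l)" using ycomm[OF k(1)] kc xc y by (simp add: u_def m_assoc)
    finally show ?thesis using k l by blast
  qed
  have ug: "\<exists>k\<in>K. cj g u = u \<otimes> k"
  proof -
    obtain k where k: "k \<in> K" "cj g y = x \<otimes> k" using cjgy by blast
    have "cj g u = y \<otimes> x \<otimes> k" using g xc y k by (simp add: u_def cj_mult y_def[symmetric] m_assoc)
    also have "\<dots> = u \<otimes> (k0 \<otimes> k)" using yx k0 k xc y by (simp add: u_def m_assoc)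
    finally show ?thesis using k k0 by blast
  qed
  have uall: "\<exists>k\<in>cyc (x \<otimes> x). cj a u = u \<otimes> k" if a: "a \<in> carrier G" for a
  proof (cases "a \<in> N")
    case True
    then show ?thesis using uN by (simp add: K_def)
  next
    case False
    obtain k where k: "k \<in> K" "cj g u = u \<otimes> k" using ug by blast
    obtain l where l: "l \<in> K" "cj (inv g \<otimes> a) u = u \<otimes> l" using uN[OF coset[OF a False]] by blast
    have "cj a u = cj (inv g \<otimes> a) (cj g u)" using a g u by (simp add: cj_cj mult_inv_cancel)
    also have "\<dots> = u \<otimes> (l \<otimes> cj (inv g \<otimes> a) k)"
      using a g u k l by (simp add: cj_mult m_assoc)
    moreover have "l \<otimes> cj (inv g \<otimes> a) k \<in> K" using l(1) Kn[OF _ k(1), of "inv g \<otimes> a"] a g by simp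
    ultimately show ?thesis by (auto simp: K_def)
  qed
  \<comment> \<open>Here x enters as an element of G': it fixes u = xy, and an element commuting
    with xy commutes with y. The normal cyclic group is the one generated by the square of
    x.\<close>
  have "cj x u = u"
  proof (rule comms_centralize_of_coset_invariant[OF fin _ u _ _ _ _ uall x])
    show "x \<otimes> x \<in> carrier G" using xc by simp
    show "cj a (x \<otimes> x) \<in> cyc (x \<otimes> x)" if "a \<in> carrier G" for a
      using two_cyc_sq_normal_gen[OF two_cyc that] .
    have xx: "x \<otimes> x \<in> K" using cyc_self by (simp add: K_def)
    have "u \<otimes> (x \<otimes> x) = x \<otimes> ((x \<otimes> x) \<otimes> y)" using ycomm[OF xx] xc y by (simp add: u_def m_assoc)
    then show "u \<otimes> (x \<otimes> x) = x \<otimes> x \<otimes> u" using xc y by (simp add: u_def m_assoc)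
    have "u \<otimes> u = x \<otimes> (y \<otimes> x) \<otimes> y" using xc y by (simp add: u_def m_assoc)
    also have "\<dots> = x \<otimes> x \<otimes> (y \<otimes> (k0 \<otimes> y))" unfolding yx using k0 xc y by (simp add: m_assoc)
    also have "\<dots> = (x \<otimes> x) \<otimes> (y \<otimes> y) \<otimes> k0" using ycomm[OF k0(1)] k0 xc y by (simp add: m_assoc)
    also have "\<dots> \<in> K" using xx yyK k0 by blast
    finally show "u \<otimes> u \<in> cyc (x \<otimes> x)" by (simp add: K_def)
    have "2 * ord (x \<otimes> x) = 2 ^ e" using two_cyc_ord_sq[OF two_cyc] o by simp
    then show "ord (x \<otimes> x) = 2 ^ (e - 1)" by (cases e) auto
  qed
  then have "u \<otimes> x = x \<otimes> u" using cj_eq_self_iff[OF xc u] by simp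
  then have xy: "x \<otimes> y = y \<otimes> x" using xc y by (simp add: u_def m_assoc)
  have cardN: "order G = 2 * m * card (cyc x)" using ind m by simp
  show ?thesis
  proof (cases "m \<le> 4")
    case m4: True
    define E where "E = generate G {x, y}"
    have Esg: "subgroup E G" unfolding E_def using xc y by (intro generate_is_subgroup) auto
    have xE: "x \<in> E" and yE: "y \<in> E" by (auto simp: E_def intro: generate.incl)
    have HE: "cyc x \<subseteq> E" by (rule cyc_subset[OF xE Esg])
    have KE: "K \<subseteq> E" using KH HE by blast
    have finE: "finite E" using finite_subset[OF subgroup.subset[OF Esg] fin] .
    obtain q where q: "card E = card (cyc x) * q" using card_subgroup_dvd[OF Hsg Esg HE] by blast
    have "card (cyc x) < card E" using HE yE yH finE by (intro psubset_card_mono) auto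
    then have "q \<noteq> 0" "q \<noteq> 1" using q by auto
    then have "2 \<le> q" by linarith
    then have cE: "2 * card (cyc x) \<le> card E" unfolding q by (subst mult.commute) (rule mult_le_mono2)
    have genE: "a \<in> nrm E" if a: "a \<in> carrier G" "cj a x \<in> E" "cj a y \<in> E" for a
      unfolding E_def using a xc y by (intro nrm_generate) (auto simp: E_def)
    have NE: "N \<subseteq> nrm E"
    proof
      fix n assume n: "n \<in> N"
      obtain k where k: "k \<in> K" "cj n x = x \<otimes> k" using Nx[OF n] by blast
      obtain l where l: "l \<in> K" "cj n y = y \<otimes> l" using Ny[OF n] by blast
      show "n \<in> nrm E" using n k l xE yE KE Esg by (intro genE) (auto intro: subgroup.m_closed)
    qed
    have gE: "g \<in> nrm E"
    proof -
      obtain k where k: "k \<in> K" "cj g y = x \<otimes> k" using cjgy by blast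
      show ?thesis using g k xE yE KE Esg by (intro genE) (auto simp: y_def[symmetric] intro: subgroup.m_closed)
    qed
    have nE: "nrm E = carrier G"
    proof
      have sg: "subgroup (nrm E) G" by (rule nrm_subgroup[OF fin subgroup.subset[OF Esg]])
      show "carrier G \<subseteq> nrm E"
      proof
        fix a assume a: "a \<in> carrier G"
        show "a \<in> nrm E"
        proof (cases "a \<in> N")
          case False
          have "g \<otimes> (inv g \<otimes> a) \<in> nrm E" using subgroup.m_closed[OF sg gE] NE coset[OF a False] by blast
          then show ?thesis using a g by (simp add: mult_inv_cancel)
        qed (use NE in blast)
      qed
    qed (auto simp: nrm_def)
    \<comment> \<open>Since y is not in <x>, E is at least twice as large as <x>. So |G| = 2m|<x>|
      is at most 4|E|, which makes the quotient by E abelian.\<close>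
    have "2 * m * card (cyc x) \<le> 2 * 4 * card (cyc x)" using m4 by (intro mult_le_mono) auto
    then have "order G < 5 * card E" using cardN cE card_subgroup_pos[OF Esg fin] by linarith
    then have "comms \<subseteq> E" by (rule comms_subset_of_small_index[OF fin Esg nE])
    then have "c \<in> generate G {x, y}" "d \<in> generate G {x, y}" using cd by (auto simp: E_def)
    moreover have "s \<otimes> t = t \<otimes> s" if "s \<in> {x, y}" "t \<in> {x, y}" for s t using that xy by auto
    ultimately show ?thesis using generate_commute[of "{x, y}" c d] xc y by simp
  next
    case False
    then have m5: "4 < m" by simp
    have MN: "comms \<subseteq> N"
    proof -
      have "nrm N = carrier G"
      proof
        show "carrier G \<subseteq> nrm N"
        proof
          fix a assume a: "a \<in> carrier G"
          have "cj a n \<in> N" if n: "n \<in> N" for n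
          proof (cases "a \<in> N")
            case False
            have "inv a \<otimes> n \<notin> N"
            proof
              assume "inv a \<otimes> n \<in> N"
              then have "inv (inv a \<otimes> n \<otimes> inv n) \<in> N" using n N.m_closed N.m_inv_closed by blast
              then show False using a n False by (simp add: group_word_simps)
            qed
            then show ?thesis unfolding cj_def using two[of "inv a \<otimes> n" a] a n False by simp
          qed (use n in \<open>simp add: cj_def\<close>)
          then show "a \<in> nrm N" using a by (simp add: nrm_iff)
        qed
      qed (auto simp: nrm_def)
      then show ?thesis
        using comms_subset_of_small_index[OF fin Nsg] ind card_subgroup_pos[OF Nsg fin] by (simp add: N_def)
    qed
    \<comment> \<open>If the square of x were trivial, so would be K, and then N, which contains G',
      would fix x, against the choice of b. So <x> has at least 4 elements and |G| is at least 2
      times 5 times 4.\<close>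
    have "x \<otimes> x \<noteq> \<one>"
    proof
      assume "x \<otimes> x = \<one>"
      then have "K = {\<one>}" by (simp add: K_def generate_one)
      then show False using Nx[of b] b MN xc by auto
    qed
    then have "ord (x \<otimes> x) \<noteq> 1" using ord_eq_1[of "x \<otimes> x"] xc by simp
    moreover have "ord (x \<otimes> x) \<ge> 1" using ord_ge_1[OF fin, of "x \<otimes> x"] xc by simp
    ultimately have "ord x \<ge> 4" using two_cyc_ord_sq[OF two_cyc] by linarith
    then have "card (cyc x) \<ge> 4" using generate_pow_card[OF xc] by simp
    then have "2 * 5 * 4 \<le> 2 * m * card (cyc x)" using m5 by (intro mult_le_mono) auto
    then have big: "order G > 32" using cardN by simp
    obtain j :: nat where j: "y \<otimes> y = (x \<otimes> x) [^] j"
      using yyK cyc_nat[OF fin, of "x \<otimes> x"] xc by (auto simp: K_def)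
    \<comment> \<open>\<open>y \<otimes> y\<close> is an even power of x, so it has a square root v
      in <x>; the quotient t of y by v is then an involution outside <x>.\<close>
    define v where "v = x [^] j"
    have v: "v \<in> carrier G" "v \<in> cyc x" using xc cyc_nat[OF fin xc] by (auto simp: v_def)
    have vv: "y \<otimes> y = v \<otimes> v" unfolding j v_def using xc by (simp add: pow_mult_distrib)
    have vy: "v \<otimes> y = y \<otimes> v"
    proof -
      have "cyc x \<subseteq> {c\<in>carrier G. cj c y = y}"
        using xy xc y by (intro cyc_subset centralizer_subgroup) (auto simp: cj_eq_self_iff)
      then show ?thesis using v y cj_eq_self_iff[of v y] by auto
    qed
    define t where "t = inv v \<otimes> y"
    have t: "t \<in> carrier G" using v y by (simp add: t_def)
    have yt: "y = v \<otimes> t" using v y by (simp add: t_def mult_inv_cancel)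
    have tH: "t \<notin> cyc x"
    proof
      assume "t \<in> cyc x"
      then have "v \<otimes> t \<in> cyc x" using v by blast
      then show False using yt yH by simp
    qed
    then have t1: "t \<noteq> \<one>" using H.one_closed by auto
    have yv: "y \<otimes> inv v = inv v \<otimes> y" using vy v y by (metis inv_closed inv_solve_left' inv_solve_right' m_closed m_assoc)
    have "t \<otimes> t = inv v \<otimes> (y \<otimes> inv v) \<otimes> y" using v y by (simp add: t_def m_assoc)
    also have "\<dots> = inv v \<otimes> (inv v \<otimes> y) \<otimes> y" by (simp only: yv)
    also have "\<dots> = inv v \<otimes> inv v \<otimes> (v \<otimes> v)" using v y vv by (simp add: m_assoc)
    also have "\<dots> = \<one>" using v by (simp add: group_word_simps)
    finally have tt: "t \<otimes> t = \<one>" .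
    have tc: "cj a t = t" if "a \<in> carrier G" for a
      using involution_central_if_large[OF t t1 tt big that] .
    have form: "\<exists>i::nat. \<exists>s\<in>{\<one>, t}. cj a x = x [^] i \<otimes> s" if a: "a \<in> carrier G" for a
    proof (cases "a \<in> N")
      case True
      then obtain i :: nat where "cj a x = x [^] i"
        using nrm_cyc_iff[OF xc] cyc_nat[OF fin xc] unfolding N_def by blast
      then have "cj a x = x [^] i \<otimes> \<one>" using xc by simp
      then show ?thesis by blast
    next
      case False
      let ?n = "inv g \<otimes> a"
      have nc: "?n \<in> carrier G" using a g by simp
      obtain i :: nat where i: "cj ?n x = x [^] i"
        using coset[OF a False] nrm_cyc_iff[OF xc] cyc_nat[OF fin xc] unfolding N_def by blast
      have "cj a x = cj ?n (cj g x)" using a g xc by (simp add: cj_cj mult_inv_cancel)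
      also have "\<dots> = cj ?n v \<otimes> cj ?n t" using yt v t nc by (simp add: y_def cj_mult)
      also have "\<dots> = x [^] (i * j) \<otimes> t" using tc[OF nc] nc xc i by (simp add: v_def cj_pow nat_pow_pow)
      finally show ?thesis by blast
    qed
    \<comment> \<open>Modulo the central t, conjugations act on x as power maps, which commute. A
      commutator can therefore change x only by 1 or t.\<close>
    have "comms \<subseteq> {c\<in>carrier G. cj c x \<in> {x, x \<otimes> t}}"
    proof (rule comms_subset)
      have tinv: "inv t = t" using tt t by (metis inv_equality)
      show "subgroup {c\<in>carrier G. cj c x \<in> {x, x \<otimes> t}} G"
      proof
        fix a b assume a: "a \<in> {c\<in>carrier G. cj c x \<in> {x, x \<otimes> t}}"
        { assume b: "b \<in> {c\<in>carrier G. cj c x \<in> {x, x \<otimes> t}}"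
          show "a \<otimes> b \<in> {c\<in>carrier G. cj c x \<in> {x, x \<otimes> t}}"
            using a b xc t tc tt by (auto simp: cj_cj[symmetric] cj_mult m_assoc) }
        have ac: "a \<in> carrier G" using a by simp
        have "x = cj (inv a) (cj a x)" using ac xc by (simp add: cj_cj)
        then have "x = cj (inv a) x \<or> x = cj (inv a) x \<otimes> t" using a ac xc t tc[of "inv a"] by (auto simp: cj_mult)
        moreover have "cj (inv a) x = x \<otimes> t" if "x = cj (inv a) x \<otimes> t"
          using that ac xc t tt by (metis cj_closed inv_closed m_assoc r_one)
        ultimately show "inv a \<in> {c\<in>carrier G. cj c x \<in> {x, x \<otimes> t}}" using ac by auto
      qed (use xc in auto)
      fix a b assume ab: "a \<in> carrier G" "b \<in> carrier G"
      obtain i s where i: "s \<in> {\<one>, t}" "cj a x = x [^] (i::nat) \<otimes> s" using form[OF ab(1)] by blast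
      obtain k r where k: "r \<in> {\<one>, t}" "cj b x = x [^] (k::nat) \<otimes> r" using form[OF ab(2)] by blast
      have scr: "s \<in> carrier G" "r \<in> carrier G" using i k t by auto
      have powt: "\<exists>w\<in>{\<one>, t}. (x [^] p \<otimes> z) [^] (q::nat) = x [^] (p * q) \<otimes> w"
        if z: "z \<in> {\<one>, t}" for z and p q :: nat
      proof -
        have "t [^] n \<in> {\<one>, t}" for n :: nat using t tt by (induction n) auto
        then have zq: "z [^] q \<in> {\<one>, t}" using z by auto
        have "t \<otimes> x [^] p = x [^] p \<otimes> t"
        proof -
          have "cj (x [^] p) t = t" using tc xc by simp
          then show ?thesis using cj_eq_self_iff[of "x [^] p" t] xc t by simp
        qed
        then have "x [^] p \<otimes> z = z \<otimes> x [^] p" using z xc by auto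
        moreover have "z \<in> carrier G" using z t by auto
        ultimately have "(x [^] p \<otimes> z) [^] q = (x [^] p) [^] q \<otimes> z [^] q" using xc by (intro pow_mult_distrib) auto
        then show ?thesis using zq xc by (auto simp: nat_pow_pow)
      qed
      have fix_s: "cj a r = r" "cj b s = s" using i k tc ab by auto
      have "cj (a \<otimes> b) x = (x [^] k \<otimes> r) [^] i \<otimes> s"
        using ab xc i k scr fix_s by (simp add: cj_cj[symmetric] cj_mult cj_pow)
      then obtain w1 where w1: "w1 \<in> {\<one>, t}" "cj (a \<otimes> b) x = x [^] (k * i) \<otimes> w1 \<otimes> s"
        using powt[OF k(1), of k i] by metis
      have "cj (b \<otimes> a) x = (x [^] i \<otimes> s) [^] k \<otimes> r"
        using ab xc i k scr fix_s by (simp add: cj_cj[symmetric] cj_mult cj_pow)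
      then obtain w2 where w2: "w2 \<in> {\<one>, t}" "cj (b \<otimes> a) x = x [^] (k * i) \<otimes> w2 \<otimes> r"
        using powt[OF i(1), of i k] mult.commute[of i k] by metis
      have "\<exists>w\<in>{\<one>, t}. cj (a \<otimes> b) x = cj (b \<otimes> a) x \<otimes> w"
        using w1 w2 i(1) k(1) xc t tt by (auto simp: m_assoc)
      then obtain w where w: "w \<in> {\<one>, t}" "cj (a \<otimes> b) x = cj (b \<otimes> a) x \<otimes> w" by blast
      have wc: "w \<in> carrier G" using w t by auto
      have ci: "inv (b \<otimes> a) \<in> carrier G" using ab by simp
      have "cj (a \<otimes> b \<otimes> inv (b \<otimes> a)) x = cj (inv (b \<otimes> a)) (cj (a \<otimes> b) x)"
        using ab xc ci by (simp only: cj_cj m_closed)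
      also have "\<dots> = cj (inv (b \<otimes> a)) (cj (b \<otimes> a) x) \<otimes> cj (inv (b \<otimes> a)) w"
        using w wc ab xc ci by (simp only: cj_mult cj_closed m_closed)
      also have "\<dots> = x \<otimes> w"
      proof -
        have "cj (inv (b \<otimes> a)) w = w" using w(1) tc[OF ci] ci by auto
        moreover have "cj (inv (b \<otimes> a)) (cj (b \<otimes> a) x) = x"
          using ab xc ci by (simp only: cj_cj m_closed r_inv cj_one)
        ultimately show ?thesis by simp
      qed
      finally show "a \<otimes> b \<otimes> inv (b \<otimes> a) \<in> {c\<in>carrier G. cj c x \<in> {x, x \<otimes> t}}"
        using w(1) xc ab by auto
    qed
    \<comment> \<open>As b moves x, it must multiply it by t. But b is in N, so this would put t
      into <x>.\<close>
    then have "cj b x = x \<otimes> t" using b by auto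
    moreover have "cj b x \<in> cyc x" using b MN nrm_cyc_iff[OF xc] by (auto simp: N_def)
    ultimately have "inv x \<otimes> (x \<otimes> t) \<in> cyc x" using cyc_self[of x] by auto
    then show ?thesis using tH xc t by (simp add: inv_mult_cancel)
  qed
qed

theorem comms_commute:
  assumes cd: "c \<in> comms" "d \<in> comms"
  shows "c \<otimes> d = d \<otimes> c"
proof (rule ccontr)
  assume nc: "c \<otimes> d \<noteq> d \<otimes> c"
  have Msg: "subgroup comms G" by (rule derived_is_subgroup) simp
  obtain x p e where x: "x \<in> comms" "prime (p::nat)" "ord x = p ^ e" "\<exists>b\<in>comms. cj b x \<noteq> x"
    using exists_prime_power_noncentral[OF fin Msg cd nc] .
  have xc: "x \<in> carrier G" using x comms_carrier by blast
  obtain b where b: "b \<in> comms" "cj b x \<noteq> x" using x by blast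
  have p: "p = 2" using comms_centralize_odd_prime_power[OF cd nc xc x(3) x(2) _ b(1)] b(2) by blast
  have o: "ord x = 2 ^ e" using x p by simp
  have nn: "nrm (cyc x) \<noteq> carrier G"
    using comms_centralize_cyc_normal[OF fin xc _ b(1)] nrm_cyc_iff[OF xc] b(2) by blast
  have H: "subgroup (cyc x) G" by (rule cyc_subgroup[OF xc])
  have cH: "card (cyc x) = 2 ^ e" using generate_pow_card[OF xc] o by simp
  have Hpos: "card (cyc x) > 0" by (rule card_subgroup_pos[OF H fin])
  obtain r m where rm: "order G = r * card (nrm (cyc x))" "card (nrm (cyc x)) = m * card (cyc x)" "r \<ge> 2" "m \<ge> 1"
    "card (carrier G - nrm (cyc x)) = (r - 1) * m * card (cyc x)"
    by (rule card_Diff_nrm_factor[OF fin H nn])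
  have rprime: "\<not> q dvd r" if "prime q" "q \<noteq> 2" for q
    using prime_divisor_index_nrm_eq_2[OF cd nc x(1) rm(1)] that by blast
  \<comment> \<open>Below r is at most 9, so these three primes suffice to leave only powers of
    2.\<close>
  have r3: "\<not> 3 dvd r" and r5: "\<not> 5 dvd r" and r7: "\<not> 7 dvd r"
    using rprime[of 3] rprime[of 5] rprime[of 7] by simp_all
  from two_group_spectrum[OF H fin transversal_prob_gt[OF H] cH nn[symmetric]]
  show False
  proof (elim disjE bexE conjE)
    fix g assume g: "g \<in> carrier G" "carrier G - nrm (cyc x) = double_coset (cyc x) g"
      "card (double_coset (cyc x) g) = 4 * card (cyc x)"
    have e4: "(r - 1) * m = 4" using rm(5) g Hpos by simp
    have "r - 1 \<le> (r - 1) * m" using rm(4) by simp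
    then have "r - 1 \<le> 4" using e4 by linarith
    then have "r \<in> {2, 3, 4, 5}" using rm(3) by auto
    moreover have "r \<noteq> 4"
    proof
      assume "r = 4"
      then have "3 * m = 4" using e4 by simp
      then show False by presburger
    qed
    ultimately have "r = 2" using r3 r5 by auto
    then show False using comms_commute_of_index_two_double_coset[OF fin xc g(1) _ g(2) cd] rm(1) nc by simp
  next
    fix a :: nat assume a: "a \<in> {1..4}" "card (carrier G - nrm (cyc x)) = 2 * a * card (cyc x)"
      and core: "\<forall>g\<in>carrier G - nrm (cyc x). 2 * card (conj_core (cyc x) g) = card (cyc x)"
    have sq: "cj g (x \<otimes> x) \<in> cyc x" if "g \<in> carrier G - nrm (cyc x)" for g
      using sq_mem_of_conj_core_index_two[OF fin xc that] core that by blast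
    have ea: "(r - 1) * m = 2 * a" using rm(5) a Hpos by simp
    have a4: "1 \<le> a" "a \<le> 4" using a(1) by auto
    have "r - 1 \<le> (r - 1) * m" using rm(4) by simp
    then have "r - 1 \<le> 8" using ea a4 by linarith
    then have "r \<le> 9" by simp
    then have "r \<in> {2, 3, 4, 5, 6, 7, 8, 9}" using rm(3) by auto
    \<comment> \<open>As a power of 2 this value survives the prime condition; but 7m = 2a would
      make 7 divide a, and a is at most 4.\<close>
    moreover have "r \<noteq> 8"
    proof
      assume "r = 8"
      then have "7 * m = 2 * a" using ea by simp
      then show False using a4 rm(4) by presburger
    qed
    ultimately have "r = 2 \<or> r = 4" using r3 r5 r7 by auto
    then show False
    proof
      assume r: "r = 2"
      then show False
        using comms_commute_of_two_cyc_index_two[OF x(1) o nn sq _ rm(2) b cd] rm(1) nc by simp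
    next
      assume r: "r = 4"
      then have "3 * m = 2 * a" using ea by simp
      \<comment> \<open>3 divides a, and a lies between 1 and 4, so a = 3.\<close>
      then have "m = 2" using a4 by presburger
      then show False using two_cyc_no_index_four[OF fin xc o nn sq x(1)] rm r by simp
    qed
  qed
qed

end

section \<open>Sharpness\<close>

lemma fact_ratio_Suc_0 [simp]: "fact_ratio (Suc 0) = 1"
  by (simp add: fact_ratio_def)

section \<open>Lower bounds for P in groups of order 24\<close>

context group
begin

text \<open>Subgroups of order 1 and 2 are normal. For order 3, the seven left cosets other than H
  leave room for at most two double cosets with k = 3, which gives exactly the bound. For order at
  least 4, at most five left cosets remain besides H.\<close>

lemma transversal_prob_ge_order_24:
  assumes o: "order G = 24" and H: "subgroup H G"
    and inv: "\<And>t a. t \<in> carrier G \<Longrightarrow> t \<otimes> t = \<one> \<Longrightarrow> a \<in> carrier G \<Longrightarrow> cj a t = t"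
  shows "transversal_prob G H \<ge> 4 / 81"
proof -
  have fin: "finite (carrier G)" using o by (metis card.infinite order_def zero_neq_numeral)
  let ?C = "double_cosets H" and ?k = "dc_index H"
  have finC: "finite ?C" by (rule finite_double_cosets[OF H fin])
  have dvd: "?k D dvd card H" and pos: "?k D > 0" if "D \<in> ?C" for D
    using dc_index_dvd[OF H fin that] dc_index_pos[OF H fin that] .
  have trivial: "transversal_prob G H \<ge> 4 / 81" if "\<And>D. D \<in> ?C \<Longrightarrow> ?k D = 1"
    unfolding transversal_prob_eq_prod[OF H fin] using that by simp
  have D0: "double_coset H \<one> \<in> ?C" "?k (double_coset H \<one>) = 1"
    using dc_index_eq_1_iff[OF H fin, of \<one>] subgroup.subset[OF H] by (auto simp: double_cosets_def nrm_def)
  define n where "n = card (rcosets H)"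
  have nH: "n * card H = 24" using lagrange[OF H] o by (simp add: n_def)
  have sum: "(\<Sum>D\<in>?C - {double_coset H \<one>}. ?k D) = n - 1"
    using sum.remove[OF finC D0(1), of ?k] D0(2) sum_dc_index[OF H fin] by (simp add: n_def)
  have prod: "transversal_prob G H = (\<Prod>D\<in>?C - {double_coset H \<one>}. fact_ratio (?k D))"
    unfolding transversal_prob_eq_prod[OF H fin]
    using prod.remove[OF finC D0(1), of "\<lambda>D. fact_ratio (?k D)"] D0(2) fact_ratio_small by simp
  consider "card H = 1" | "card H = 2" | "card H = 3" | "card H \<ge> 4"
    using nH by (cases "card H = 0") (auto, linarith)
  then show ?thesis
  proof cases
    case 1
    then show ?thesis using dvd by (intro trivial) auto
  next
    case 2
    have "carrier G = nrm H"
    proof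
      show "carrier G \<subseteq> nrm H"
      proof
        fix a assume a: "a \<in> carrier G"
        have "cj a h \<in> H" if h: "h \<in> H" for h
        proof -
          have hc: "h \<in> carrier G" using subgroup.mem_carrier[OF H h] .
          have "ord h dvd 2" using ord_dvd_card_subgroup[OF H h] 2 by simp
          then have "h [^] (2::nat) = \<one>" using pow_eq_id[OF hc, of 2] by simp
          then have "h \<otimes> h = \<one>" using hc by (simp add: numeral_2_eq_2)
          then show ?thesis using inv[OF hc _ a] h by simp
        qed
        then show "a \<in> nrm H" using a by (simp add: nrm_iff)
      qed
    qed (auto simp: nrm_def)
    then show ?thesis
      using dc_index_eq_1_iff[OF H fin] by (intro trivial) (auto simp: double_cosets_def)
  next
    case 3
    then have n: "n = 8" using nH by simp
    have k: "?k D = 1 \<or> ?k D = 3" if "D \<in> ?C" for D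
      using dvd[OF that] 3 prime_nat_iff[of 3] by auto
    let ?T = "{D \<in> ?C - {double_coset H \<one>}. ?k D = 3}"
    have "3 * card ?T = (\<Sum>D\<in>?T. ?k D)" by simp
    also have "\<dots> \<le> (\<Sum>D\<in>?C - {double_coset H \<one>}. ?k D)" using finC by (intro sum_mono2) auto
    finally have "card ?T \<le> 2" using sum n by simp
    then have "(2/9 :: real) ^ 2 \<le> (2/9) ^ card ?T" by (intro power_decreasing) auto
    also have "\<dots> = (\<Prod>D\<in>?T. fact_ratio (?k D))" by (simp add: fact_ratio_small)
    also have "\<dots> = (\<Prod>D\<in>?C - {double_coset H \<one>}. fact_ratio (?k D))"
    proof (rule prod.mono_neutral_left)
      show "\<forall>D\<in>?C - {double_coset H \<one>} - ?T. fact_ratio (?k D) = 1"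
      proof
        fix D assume "D \<in> ?C - {double_coset H \<one>} - ?T"
        then have "?k D = 1" using k[of D] by blast
        then show "fact_ratio (?k D) = 1" by simp
      qed
    qed (use finC in auto)
    finally show ?thesis unfolding prod by (simp add: power_divide)
  next
    case 4
    have n6: "n \<le> 6"
    proof (rule ccontr)
      assume "\<not> n \<le> 6"
      then have "7 * 4 \<le> n * card H" using 4 by (intro mult_le_mono) auto
      then show False using nH by simp
    qed
    \<comment> \<open>k = 5 would need all five remaining left cosets, hence n = 6 and |H| = 4, but
      k divides |H|.\<close>
    have k4: "?k D \<le> 4" if D: "D \<in> ?C - {double_coset H \<one>}" for D
    proof (rule ccontr)
      assume "\<not> ?k D \<le> 4"
      moreover have "?k D \<le> n - 1" unfolding sum[symmetric] using finC D by (intro member_le_sum) auto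
      ultimately have "?k D = 5" "n = 6" using n6 by linarith+
      then have "card H = 4" "5 dvd card H" using nH dvd[of D] D by auto
      then show False by simp
    qed
    \<comment> \<open>\<open>11/20\<close> satisfies \<open>(11/20)\<^sup>k \<le> k!/k\<^sup>k\<close> for \<open>k \<le> 4\<close> and still \<open>(11/20)\<^sup>5 \<ge> 4/81\<close>.\<close>
    have le: "(11/20) ^ ?k D \<le> fact_ratio (?k D)" if D: "D \<in> ?C - {double_coset H \<one>}" for D
    proof -
      have "?k D \<in> {1, 2, 3, 4}" using k4[OF D] pos[of D] D by auto
      then show ?thesis
        using fact_ratio_small by (auto simp: power_divide)
    qed
    have "4/81 \<le> (11/20 :: real) ^ 5" by (simp add: power_divide)
    also have "\<dots> \<le> (11/20) ^ (n - 1)" using n6 by (intro power_decreasing) auto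
    also have "\<dots> = (\<Prod>D\<in>?C - {double_coset H \<one>}. (11/20) ^ ?k D)" by (simp only: sum[symmetric] power_sum)
    also have "\<dots> \<le> (\<Prod>D\<in>?C - {double_coset H \<one>}. fact_ratio (?k D))"
      by (intro prod_mono) (use le in auto)
    finally show ?thesis unfolding prod .
  qed
qed

lemma tp_ge_order_24:
  assumes o: "order G = 24"
    and inv: "\<And>t a. t \<in> carrier G \<Longrightarrow> a \<in> carrier G \<Longrightarrow> t \<otimes> t = \<one> \<Longrightarrow> t \<otimes> a = a \<otimes> t"
  shows "tp G \<ge> 4 / 81"
proof -
  have fin: "finite (carrier G)" using o by (metis card.infinite order_def zero_neq_numeral)
  have "finite {H. subgroup H G}"
    using fin by (auto intro!: finite_subset[of _ "Pow (carrier G)"] dest: subgroup.subset)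
  moreover have "{H. subgroup H G} \<noteq> {}" using subgroup_self by blast
  moreover have "transversal_prob G H \<ge> 4/81" if "subgroup H G" for H
    by (rule transversal_prob_ge_order_24[OF o that]) (metis cj_eq_self_iff inv)
  ultimately show ?thesis unfolding tp_def by (subst Min_ge_iff) auto
qed

section \<open>Commutators and derived length\<close>

lemma derived_eq_one_of_commute:
  assumes B: "B \<subseteq> carrier G" and comm: "\<And>a b. a \<in> B \<Longrightarrow> b \<in> B \<Longrightarrow> a \<otimes> b = b \<otimes> a"
  shows "derived G B = {\<one>}"
proof -
  have "derived_set G B \<subseteq> {\<one>}"
  proof clarify
    fix a b assume ab: "a \<in> B" "b \<in> B"
    then have c: "a \<in> carrier G" "b \<in> carrier G" using B by auto
    have "a \<otimes> b \<otimes> inv a \<otimes> inv b = (b \<otimes> a) \<otimes> inv a \<otimes> inv b" using comm[OF ab] by simp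
    also have "\<dots> = \<one>" using c by (simp add: group_word_simps)
    finally show "a \<otimes> b \<otimes> inv a \<otimes> inv b = \<one>" .
  qed
  then have "derived G B \<subseteq> {\<one>}" unfolding derived_def by (rule generate_subgroup_incl[OF _ triv_subgroup])
  then show ?thesis unfolding derived_def using generate.one[of G "derived_set G B"] by blast
qed

lemma comm_group_of_derived_eq_one:
  assumes "comms = {\<one>}"
  shows "comm_group G"
proof (rule group_comm_groupI)
  fix a b assume ab: "a \<in> carrier G" "b \<in> carrier G"
  then have "a \<otimes> b \<otimes> inv a \<otimes> inv b \<in> comms" by (auto simp: derived_def intro!: generate.incl)
  then have "(a \<otimes> b) \<otimes> inv (b \<otimes> a) = \<one>" using assms ab by (simp add: group_word_simps)
  then show "a \<otimes> b = b \<otimes> a" using ab by (metis inv_equality inv_inv m_closed inv_closed)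
qed

text \<open>p and q are the commutators of a, b and of c, d. Specifying them by products alone lets
  a concrete group be checked without computing inverses.\<close>

lemma not_derived_length_two:
  assumes G: "a \<in> carrier G" "b \<in> carrier G" "c \<in> carrier G" "d \<in> carrier G" "p \<in> carrier G" "q \<in> carrier G"
    and p: "p \<otimes> (b \<otimes> a) = a \<otimes> b" and q: "q \<otimes> (d \<otimes> c) = c \<otimes> d" and ne: "p \<otimes> q \<noteq> q \<otimes> p"
  shows "\<not> derived_length_two G"
proof
  assume "derived_length_two G"
  then have triv: "derived G comms = {\<one>}" by (simp add: derived_length_two_def)
  have comm: "a \<otimes> b \<otimes> inv a \<otimes> inv b \<in> derived G B" if "a \<in> B" "b \<in> B" for a b B
    using that by (auto simp: derived_def intro!: generate.incl)
  have "p = a \<otimes> b \<otimes> inv (b \<otimes> a)" using p[symmetric] G by (simp add: group_word_simps)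
  then have "p \<in> comms" using comm[OF G(1,2)] G by (simp add: group_word_simps)
  moreover have "q = c \<otimes> d \<otimes> inv (d \<otimes> c)" using q[symmetric] G by (simp add: group_word_simps)
  then have "q \<in> comms" using comm[OF G(3,4)] G by (simp add: group_word_simps)
  ultimately have "p \<otimes> q \<otimes> inv p \<otimes> inv q = \<one>" using comm triv by blast
  then have "(p \<otimes> q) \<otimes> inv (q \<otimes> p) = \<one>" using G by (simp add: group_word_simps)
  then show False using ne G by (metis inv_equality inv_inv m_closed inv_closed)
qed

end

text \<open>The matrix \<open>[[a, b], [c, d]]\<close> over the field with three elements is the tuple \<open>(a, b, c, d)\<close>.\<close>

type_synonym mat2 = "int \<times> int \<times> int \<times> int"

text \<open>An explicit list over the residues 0, 1, 2 lets the group laws be verified by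
  evaluation; the condition is that the determinant is 1.\<close>

definition sl23_list :: "mat2 list" where
  "sl23_list = [(a, b, c, d). a \<leftarrow> [0, 1, 2], b \<leftarrow> [0, 1, 2], c \<leftarrow> [0, 1, 2], d \<leftarrow> [0, 1, 2],
    (a * d - b * c) mod 3 = 1]"

definition mat_mult :: "mat2 \<Rightarrow> mat2 \<Rightarrow> mat2" where
  "mat_mult = (\<lambda>(a, b, c, d) (e, f, g, h).
    ((a * e + b * g) mod 3, (a * f + b * h) mod 3, (c * e + d * g) mod 3, (c * f + d * h) mod 3))"

definition sl23 :: "mat2 monoid" where
  "sl23 = \<lparr>carrier = set sl23_list, monoid.mult = mat_mult, one = (1, 0, 0, 1)\<rparr>"

lemma mod_lincomb_left: "(p mod 3 * i + q mod 3 * j) mod 3 = (p * i + q * j) mod (3::int)"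
  using mod_add_eq[of "p mod 3 * i" 3 "q mod 3 * j"] by (simp only: mod_mult_left_eq mod_add_eq)

lemma mod_lincomb_right: "(i * (p mod 3) + j * (q mod 3)) mod 3 = (i * p + j * q) mod (3::int)"
  using mod_add_eq[of "i * (p mod 3)" 3 "j * (q mod 3)"] by (simp only: mod_mult_right_eq mod_add_eq)

lemma mat_mult_assoc: "mat_mult (mat_mult x y) z = mat_mult x (mat_mult y z)"
  by (cases x; cases y; cases z)
    (simp add: mat_mult_def mod_lincomb_left mod_lincomb_right, simp add: algebra_simps)

lemma card_sl23_list: "card (set sl23_list) = 24"
  by code_simp

lemma mat_mult_closed: "\<forall>s\<in>set sl23_list. \<forall>t\<in>set sl23_list. mat_mult s t \<in> set sl23_list"
  by code_simp

text \<open>The inverse of a matrix of determinant 1 is its adjugate.\<close>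

lemma mat_mult_inverse:
  "\<forall>(a, b, c, d)\<in>set sl23_list. (d, - b mod 3, - c mod 3, a) \<in> set sl23_list \<and>
    mat_mult (d, - b mod 3, - c mod 3, a) (a, b, c, d) = (1, 0, 0, 1)"
  by code_simp

lemma mat_mult_one: "\<forall>s\<in>set sl23_list. mat_mult (1, 0, 0, 1) s = s"
  by code_simp

lemma mat_involution_central:
  "\<forall>s\<in>set sl23_list. mat_mult s s = (1, 0, 0, 1) \<longrightarrow>
    (\<forall>t\<in>set sl23_list. mat_mult s t = mat_mult t s)"
  by code_simp

lemma group_sl23: "group sl23"
proof (rule groupI)
  show "\<exists>y\<in>carrier sl23. y \<otimes>\<^bsub>sl23\<^esub> x = \<one>\<^bsub>sl23\<^esub>" if "x \<in> carrier sl23" for x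
    using mat_mult_inverse that by (cases x) (fastforce simp: sl23_def)
  show "\<one>\<^bsub>sl23\<^esub> \<in> carrier sl23" by (simp add: sl23_def) code_simp
qed (use mat_mult_closed mat_mult_one in \<open>auto simp: sl23_def mat_mult_assoc\<close>)

text \<open>Sharpness is stated for groups on the natural numbers, so the matrix group is
  transported along \<open>to_nat\<close>. The lower bound for \<open>tp\<close> suffices, since it
  exceeds every c below 4/81.\<close>

lemma sl23_nat_group:
  defines "S \<equiv> (image_group to_nat sl23 :: nat monoid)"
  shows "group S" "order S = 24" "\<not> derived_length_two S" "\<not> comm_group S" "tp S \<ge> 4 / 81"
proof -
  interpret M: group sl23 by (rule group_sl23)
  have inj: "inj_on to_nat (carrier sl23)" by (meson inj_on_subset inj_to_nat subset_UNIV)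
  have iso: "to_nat \<in> iso sl23 S" unfolding S_def by (rule inj_imp_image_group_iso[OF inj])
  show S: "group S" unfolding S_def by (rule M.inj_imp_image_group_is_group[OF inj])
  interpret S: group S by fact
  have carr: "carrier S = to_nat ` set sl23_list" by (simp add: S_def image_group_carrier sl23_def)
  have hom: "to_nat (mat_mult s t) = to_nat s \<otimes>\<^bsub>S\<^esub> to_nat t" if "s \<in> set sl23_list" "t \<in> set sl23_list" for s t
    using iso that by (auto simp: iso_def hom_def sl23_def)
  have one: "\<one>\<^bsub>S\<^esub> = to_nat (1::int, 0::int, 0::int, 1::int)" by (simp add: S_def image_group_one sl23_def)
  show o: "order S = 24"
    using card_sl23_list inj by (simp add: order_def carr card_image sl23_def)
  show "tp S \<ge> 4 / 81"
  proof (rule S.tp_ge_order_24[OF o])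
    fix t a assume "t \<in> carrier S" "a \<in> carrier S" and tt: "t \<otimes>\<^bsub>S\<^esub> t = \<one>\<^bsub>S\<^esub>"
    then obtain t' a' where t': "t' \<in> set sl23_list" "t = to_nat t'" and a': "a' \<in> set sl23_list" "a = to_nat a'"
      by (auto simp: carr)
    have "mat_mult t' t' = (1, 0, 0, 1)" using tt hom[OF t'(1) t'(1)] t' one by simp
    then have "mat_mult t' a' = mat_mult a' t'" using mat_involution_central t' a' by blast
    then show "t \<otimes>\<^bsub>S\<^esub> a = a \<otimes>\<^bsub>S\<^esub> t" using hom t' a' by metis
  qed
  \<comment> \<open>\<open>?p\<close> and \<open>?q\<close> are the commutators of \<open>?a\<close>
    with \<open>?b\<close> and with \<open>?c\<close>. They are elements of order 4 of the
    quaternion subgroup that do not commute.\<close>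
  let ?a = "(0, 1, 2, 0) :: mat2" and ?b = "(0, 1, 2, 1) :: mat2" and ?c = "(0, 1, 2, 2) :: mat2"
    and ?p = "(2, 2, 2, 1) :: mat2" and ?q = "(2, 1, 1, 1) :: mat2"
  have mem: "?a \<in> set sl23_list" "?b \<in> set sl23_list" "?c \<in> set sl23_list" "?p \<in> set sl23_list" "?q \<in> set sl23_list"
    by code_simp+
  have p: "mat_mult ?p (mat_mult ?b ?a) = mat_mult ?a ?b" and q: "mat_mult ?q (mat_mult ?c ?a) = mat_mult ?a ?c"
    and pq: "mat_mult ?p ?q \<noteq> mat_mult ?q ?p"
    by (simp_all add: mat_mult_def)
  have ne: "to_nat ?p \<otimes>\<^bsub>S\<^esub> to_nat ?q \<noteq> to_nat ?q \<otimes>\<^bsub>S\<^esub> to_nat ?p"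
    using pq hom mem by (metis injD inj_to_nat)
  show "\<not> derived_length_two S"
  proof (rule S.not_derived_length_two[OF _ _ _ _ _ _ _ _ ne])
    show "to_nat ?p \<otimes>\<^bsub>S\<^esub> (to_nat ?b \<otimes>\<^bsub>S\<^esub> to_nat ?a) = to_nat ?a \<otimes>\<^bsub>S\<^esub> to_nat ?b"
      using p hom mem mat_mult_closed by metis
    show "to_nat ?q \<otimes>\<^bsub>S\<^esub> (to_nat ?c \<otimes>\<^bsub>S\<^esub> to_nat ?a) = to_nat ?a \<otimes>\<^bsub>S\<^esub> to_nat ?c"
      using q hom mem mat_mult_closed by metis
  qed (use mem in \<open>auto simp: carr\<close>)
  show "\<not> comm_group S"
  proof
    assume "comm_group S"
    then have "to_nat ?p \<otimes>\<^bsub>S\<^esub> to_nat ?q = to_nat ?q \<otimes>\<^bsub>S\<^esub> to_nat ?p"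
      using mem by (intro comm_monoid.m_comm[OF comm_group.axioms(1)]) (auto simp: carr)
    then show False using ne by simp
  qed
qed

theorem proposition4p14:
  shows "(\<forall>G :: ('a, 'b) monoid_scheme.
            group G \<and> finite (carrier G) \<and> \<not> comm_group G \<and> tp G > 4 / 81
              \<longrightarrow> solvable G \<and> derived_length_two G) \<and>
         \<not> (\<exists>c::real. c < 4 / 81 \<and>
            (\<forall>G :: nat monoid.
               group G \<and> finite (carrier G) \<and> \<not> comm_group G \<and> tp G > c
                 \<longrightarrow> derived_length_two G))"
proof (intro conjI allI impI notI)
  fix G :: "('a, 'b) monoid_scheme"
  assume A: "group G \<and> finite (carrier G) \<and> \<not> comm_group G \<and> tp G > 4 / 81"
  then interpret high_tp_group G by (simp add: high_tp_group_def high_tp_group_axioms_def)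
  have "derived G (derived G (carrier G)) = {\<one>\<^bsub>G\<^esub>}"
    using comms_commute comms_carrier by (intro derived_eq_one_of_commute) auto
  moreover have "derived G (carrier G) \<noteq> {\<one>\<^bsub>G\<^esub>}"
    using comm_group_of_derived_eq_one A by blast
  ultimately show "derived_length_two G" by (simp add: derived_length_two_def)
  then have "(derived G ^^ 2) (carrier G) = {\<one>\<^bsub>G\<^esub>}"
    by (simp add: derived_length_two_def numeral_2_eq_2)
  then show "solvable G" using solvable_iff_trivial_derived_seq by blast
next
  assume "\<exists>c::real. c < 4 / 81 \<and> (\<forall>G :: nat monoid.
    group G \<and> finite (carrier G) \<and> \<not> comm_group G \<and> tp G > c \<longrightarrow> derived_length_two G)"
  then obtain c :: real where c: "c < 4 / 81" and all: "\<And>G :: nat monoid.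
    group G \<Longrightarrow> finite (carrier G) \<Longrightarrow> \<not> comm_group G \<Longrightarrow> tp G > c \<Longrightarrow> derived_length_two G"
    by blast
  let ?S = "image_group to_nat sl23 :: nat monoid"
  have "finite (carrier ?S)" using sl23_nat_group(2) by (intro card_ge_0_finite) (simp add: order_def)
  moreover have "tp ?S > c" using sl23_nat_group(5) c by simp
  ultimately show False using all[of ?S] sl23_nat_group(1,3,4) by blast
qed

end
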